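(* Let $p$ be a prime and let $G$ be a finite $p$-group that can be generated by two elements. Suppose that at least one of the following holds: (1) $G$ is regular; (2) $G$ has maximal class; (3) $G$ is powerful; (4) the commutator subgroup $G'$ is regular; (5) $G'$ is powerful; (6) $G'$ is order-closed; (7) $G$ has order at most $p^{p+2}$; (8) $G$ has nilpotency class at most $p$. Then all $p$-origamis with deck group isomorphic to $G$ lie in the same stratum.
   Context: An origami is a connected closed surface obtained from finitely many copies of the Euclidean unit square by gluing edges via translations, so that each left edge is glued to exactly one right edge and each upper edge to exactly one lower edge. It comes with a covering $c:\mathcal{O}\to\mathbb{T}$ of the torus ramified over at most one point (the image of the corners). The deck transformation group consists of all homeomorphisms $f:\mathcal{O}\to\mathcal{O}$ with $c\circ f=c$. The origami is normal if the deck group acts transitively on the squares. Given a finite group $G$ generated by two elements $x,y$, the normal origami $(G,x,y)$ has squares labeled by the elements of $G$, the right neighbor of the square $g$ being $gx$ and its upper neighbor being $gy$; its deck group is $G$, and every normal origami is of this form. A $p$-origami is a normal origami whose deck group is a finite $p$-group. The cone angle at a point of an origami is $2\pi a$ with $a$ a positive integer; $a$ is the multiplicity of the point. A singularity is a point of multiplicity $>1$. For positive integers $a_i,k_i$, the stratum $\mathcal{H}(k_1\times a_1,\dots,k_m\times a_m)$ is the set of translation surfaces with exactly $k_i$ singularities of multiplicity $a_i+1$ for $1\le i\le m$; $\mathcal{H}(0)$ is the set of translation surfaces without singularities. For a finite $p$-group $H$ put $\mho^i(H)=\langle h^{p^i}: h\in H\rangle$. $H$ is regular if for all $g,h\in H$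 and all integers $i\ge 1$ there is $c\in\mho^i(\langle g,h\rangle')$ with $(gh)^{p^i}=g^{p^i}h^{p^i}c$. $H$ is powerful if $p$ is odd and $H'\subseteq\mho^1(H)$, or $p=2$ and $H'\subseteq\mho^2(H)$. $H$ is weakly order-closed if for every $k\ge0$ the product of elements of order at most $p^k$ has order at most $p^k$; $H$ is order-closed if all its sections (subquotients) are weakly order-closed. A $p$-group of order $p^n$ has maximal class if its nilpotency class is $n-1$. *)

theory Defs
  imports
    "HOL-Analysis.Analysis"
    "HOL-Computational_Algebra.Primes"
    "HOL-Algebra.Generated_Groups"
    "HOL-Algebra.Multiplicative_Group"
    "HOL-Algebra.Bij"
begin

section \<open>Finite p-groups\<close>

text \<open>The trivial group (\<open>n = 0\<close>) is included.  As \<open>order\<close> of an infinite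
  carrier is \<open>0\<close>, finiteness follows for \<open>p > 0\<close>.\<close>

definition p_group :: "nat \<Rightarrow> ('g, 'm) monoid_scheme \<Rightarrow> bool" where
  "p_group p G \<longleftrightarrow> group G \<and> (\<exists>n. order G = p ^ n)"

definition two_generated :: "('g, 'm) monoid_scheme \<Rightarrow> bool" where
  "two_generated G \<longleftrightarrow> (\<exists>x\<in>carrier G. \<exists>y\<in>carrier G. generate G {x, y} = carrier G)"

definition commutator_group :: "('g, 'm) monoid_scheme \<Rightarrow> ('g, 'm) monoid_scheme" where
  "commutator_group G = G\<lparr>carrier := derived G (carrier G)\<rparr>"

text \<open>The subgroup generated by the \<open>p^i\<close>-th powers of the elements of \<open>H\<close>, where \<open>H\<close> is the
  carrier of a subgroup of \<open>G\<close>.\<close>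

definition agemo :: "('g, 'm) monoid_scheme \<Rightarrow> nat \<Rightarrow> nat \<Rightarrow> 'g set \<Rightarrow> 'g set" where
  "agemo G p i H = generate G ((\<lambda>h. h [^]\<^bsub>G\<^esub> (p ^ i)) ` H)"

definition regular_p_group :: "nat \<Rightarrow> ('g, 'm) monoid_scheme \<Rightarrow> bool" where
  "regular_p_group p G \<longleftrightarrow>
     (\<forall>g\<in>carrier G. \<forall>h\<in>carrier G. \<forall>i\<ge>1. \<exists>c\<in>agemo G p i (derived G (generate G {g, h})).
        (g \<otimes>\<^bsub>G\<^esub> h) [^]\<^bsub>G\<^esub> (p ^ i) = g [^]\<^bsub>G\<^esub> (p ^ i) \<otimes>\<^bsub>G\<^esub> h [^]\<^bsub>G\<^esub> (p ^ i) \<otimes>\<^bsub>G\<^esub> c)"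

definition powerful_p_group :: "nat \<Rightarrow> ('g, 'm) monoid_scheme \<Rightarrow> bool" where
  "powerful_p_group p G \<longleftrightarrow>
     odd p \<and> derived G (carrier G) \<subseteq> agemo G p 1 (carrier G) \<or>
     p = 2 \<and> derived G (carrier G) \<subseteq> agemo G p 2 (carrier G)"

definition weakly_order_closed :: "nat \<Rightarrow> ('g, 'm) monoid_scheme \<Rightarrow> bool" where
  "weakly_order_closed p G \<longleftrightarrow>
     (\<forall>k. \<forall>g\<in>carrier G. \<forall>h\<in>carrier G.
        group.ord G g \<le> p ^ k \<longrightarrow> group.ord G h \<le> p ^ k \<longrightarrow> group.ord G (g \<otimes>\<^bsub>G\<^esub> h) \<le> p ^ k)"

definition order_closed :: "nat \<Rightarrow> ('g, 'm) monoid_scheme \<Rightarrow> bool" where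
  "order_closed p G \<longleftrightarrow>
     (\<forall>K N. subgroup K G \<longrightarrow> N \<lhd> (G\<lparr>carrier := K\<rparr>) \<longrightarrow>
        weakly_order_closed p ((G\<lparr>carrier := K\<rparr>) Mod N))"

primrec lower_central :: "('g, 'm) monoid_scheme \<Rightarrow> nat \<Rightarrow> 'g set" where
  "lower_central G 0 = carrier G"
| "lower_central G (Suc n) =
     generate G (\<Union>g\<in>lower_central G n. \<Union>h\<in>carrier G.
       {g \<otimes>\<^bsub>G\<^esub> h \<otimes>\<^bsub>G\<^esub> inv\<^bsub>G\<^esub> g \<otimes>\<^bsub>G\<^esub> inv\<^bsub>G\<^esub> h})"

text \<open>Meaningful for nilpotent groups only, in particular for finite \<open>p\<close>-groups.\<close>

definition nilpotency_class :: "('g, 'm) monoid_scheme \<Rightarrow> nat" where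
  "nilpotency_class G = (LEAST n. lower_central G n = {\<one>\<^bsub>G\<^esub>})"

text \<open>Order \<open>p^n\<close> and class \<open>n - 1\<close>, written without truncated subtraction.\<close>

definition maximal_class :: "nat \<Rightarrow> ('g, 'm) monoid_scheme \<Rightarrow> bool" where
  "maximal_class p G \<longleftrightarrow> order G = p ^ (nilpotency_class G + 1)"


section \<open>Origamis and their surfaces\<close>

text \<open>The gluing data: the right edge of the square \<open>s\<close> is glued to the left edge of
  \<open>right X s\<close>, its upper edge to the lower edge of \<open>upper X s\<close>.\<close>

record 'a origami =
  squares :: "'a set"
  right :: "'a \<Rightarrow> 'a"
  upper :: "'a \<Rightarrow> 'a"

definition unit_square :: "(real \<times> real) set" where
  "unit_square = {0..1} \<times> {0..1}"

inductive edge_glued :: "'a origami \<Rightarrow> 'a \<times> real \<times> real \<Rightarrow> 'a \<times> real \<times> real \<Rightarrow> bool"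
  for X where
  vertical: "s \<in> squares X \<Longrightarrow> b \<in> {0..1} \<Longrightarrow> edge_glued X (s, 1, b) (right X s, 0, b)"
| horizontal: "s \<in> squares X \<Longrightarrow> a \<in> {0..1} \<Longrightarrow> edge_glued X (s, a, 1) (upper X s, a, 0)"

definition gluing :: "'a origami \<Rightarrow> (('a \<times> real \<times> real) \<times> ('a \<times> real \<times> real)) set" where
  "gluing X = {(P, Q). P \<in> squares X \<times> unit_square \<and> Q \<in> squares X \<times> unit_square \<and>
     equivclp (edge_glued X) P Q}"

lemma equiv_gluing: "equiv (squares X \<times> unit_square) (gluing X)"
  unfolding gluing_def
  by (rule equivI)
    (auto simp: refl_on_def sym_def trans_def intro: equivclp_sym equivclp_trans)

definition surface_points :: "'a origami \<Rightarrow> ('a \<times> real \<times> real) set set" where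
  "surface_points X = (squares X \<times> unit_square) // gluing X"

definition glue_proj :: "'a origami \<Rightarrow> 'a \<times> real \<times> real \<Rightarrow> ('a \<times> real \<times> real) set" where
  "glue_proj X P = gluing X `` {P}"

definition disjoint_squares :: "'a origami \<Rightarrow> ('a \<times> real \<times> real) topology" where
  "disjoint_squares X =
     prod_topology (discrete_topology (squares X)) (subtopology euclidean unit_square)"

definition quotient_topology :: "'b topology \<Rightarrow> ('b \<Rightarrow> 'c) \<Rightarrow> 'c topology" where
  "quotient_topology T f =
     topology (\<lambda>U. U \<subseteq> f ` topspace T \<and> openin T {x \<in> topspace T. f x \<in> U})"

lemma openin_quotient_topology:
  "openin (quotient_topology T f) U \<longleftrightarrow>
     U \<subseteq> f ` topspace T \<and> openin T {x \<in> topspace T. f x \<in> U}"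
proof -
  have "istopology (\<lambda>U. U \<subseteq> f ` topspace T \<and> openin T {x \<in> topspace T. f x \<in> U})"
    unfolding istopology_def
  proof (intro conjI allI impI)
    fix S R
    assume "S \<subseteq> f ` topspace T \<and> openin T {x \<in> topspace T. f x \<in> S}"
      and "R \<subseteq> f ` topspace T \<and> openin T {x \<in> topspace T. f x \<in> R}"
    moreover have "{x \<in> topspace T. f x \<in> S \<inter> R} =
        {x \<in> topspace T. f x \<in> S} \<inter> {x \<in> topspace T. f x \<in> R}" by blast
    ultimately show "S \<inter> R \<subseteq> f ` topspace T" "openin T {x \<in> topspace T. f x \<in> S \<inter> R}"
      by auto
  next
    fix K
    assume K: "\<forall>S\<in>K. S \<subseteq> f ` topspace T \<and> openin T {x \<in> topspace T. f x \<in> S}"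
    then show "\<Union>K \<subseteq> f ` topspace T" by blast
    have "{x \<in> topspace T. f x \<in> \<Union>K} = (\<Union>S\<in>K. {x \<in> topspace T. f x \<in> S})" by blast
    then show "openin T {x \<in> topspace T. f x \<in> \<Union>K}" using K by auto
  qed
  then show ?thesis by (simp add: quotient_topology_def topology_inverse')
qed

lemma topspace_quotient_topology: "topspace (quotient_topology T f) = f ` topspace T"
proof -
  have "{x \<in> topspace T. f x \<in> f ` topspace T} = topspace T" by blast
  then have "openin (quotient_topology T f) (f ` topspace T)"
    by (simp add: openin_quotient_topology)
  moreover have "openin (quotient_topology T f) (topspace (quotient_topology T f))" by simp
  ultimately show ?thesis
    by (metis openin_quotient_topology openin_subset subset_antisym)
qed

lemma quotient_map_quotient_topology: "quotient_map T (quotient_topology T f) f"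
  unfolding quotient_map_def by (auto simp: openin_quotient_topology topspace_quotient_topology)

definition surface :: "'a origami \<Rightarrow> ('a \<times> real \<times> real) set topology" where
  "surface X = quotient_topology (disjoint_squares X) (glue_proj X)"

lemma topspace_surface: "topspace (surface X) = surface_points X"
  by (auto simp: surface_def topspace_quotient_topology disjoint_squares_def surface_points_def
      glue_proj_def quotient_def)

text \<open>\<open>connected_space\<close> holds for the empty space, which has to be excluded.\<close>

definition origami :: "'a origami \<Rightarrow> bool" where
  "origami X \<longleftrightarrow> finite (squares X) \<and> squares X \<noteq> {} \<and>
     bij_betw (right X) (squares X) (squares X) \<and>
     bij_betw (upper X) (squares X) (squares X) \<and>
     connected_space (surface X)"


section \<open>Deck transformations\<close>

text \<open>The torus is the quotient of the plane by the integer lattice; its points are cosets.\<close>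

definition torus_point :: "real \<times> real \<Rightarrow> (real \<times> real) set" where
  "torus_point z = {w. fst w - fst z \<in> \<int> \<and> snd w - snd z \<in> \<int>}"

text \<open>All representatives \<open>(s, z)\<close> of a point of the surface have the same \<open>torus_point z\<close>,
  so this union is over a single coset.\<close>

definition covering :: "'a origami \<Rightarrow> ('a \<times> real \<times> real) set \<Rightarrow> (real \<times> real) set" where
  "covering X P = (\<Union>(s, z)\<in>P. torus_point z)"

text \<open>The elements are extensional functions, so that each homeomorphism of the surface
  is represented exactly once; multiplication is composition.\<close>

definition deck_group ::
  "'a origami \<Rightarrow> (('a \<times> real \<times> real) set \<Rightarrow> ('a \<times> real \<times> real) set) monoid" where
  "deck_group X = (BijGroup (surface_points X))
     \<lparr>carrier := {f \<in> Bij (surface_points X). homeomorphic_map (surface X) (surface X) f \<and>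
        (\<forall>P\<in>surface_points X. covering X (f P) = covering X P)}\<rparr>"

definition square_in_surface :: "'a origami \<Rightarrow> 'a \<Rightarrow> ('a \<times> real \<times> real) set set" where
  "square_in_surface X s = glue_proj X ` ({s} \<times> unit_square)"

definition normal_origami :: "'a origami \<Rightarrow> bool" where
  "normal_origami X \<longleftrightarrow> origami X \<and>
     (\<forall>s\<in>squares X. \<forall>t\<in>squares X. \<exists>f\<in>carrier (deck_group X).
        f ` square_in_surface X s = square_in_surface X t)"

definition p_origami :: "nat \<Rightarrow> 'a origami \<Rightarrow> bool" where
  "p_origami p X \<longleftrightarrow> normal_origami X \<and> p_group p (deck_group X)"


section \<open>Singularities and strata\<close>

text \<open>The angle of the closed unit square at \<open>z\<close>: a full angle in the interior, a straight angle
  on an open edge, a right angle at a corner.\<close>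

definition square_angle :: "real \<times> real \<Rightarrow> real" where
  "square_angle z =
     2 * pi * (if fst z \<in> {0, 1} then 1 / 2 else 1) * (if snd z \<in> {0, 1} then 1 / 2 else 1)"

text \<open>A point of the surface is a finite equivalence class of points of the squares; the
  angles at its representatives add up to the cone angle.\<close>

definition cone_angle :: "('a \<times> real \<times> real) set \<Rightarrow> real" where
  "cone_angle P = (\<Sum>(s, z)\<in>P. square_angle z)"

definition points_of_multiplicity :: "'a origami \<Rightarrow> nat \<Rightarrow> ('a \<times> real \<times> real) set set" where
  "points_of_multiplicity X a = {P \<in> surface_points X. cone_angle P = 2 * pi * real a}"

definition singularities :: "'a origami \<Rightarrow> ('a \<times> real \<times> real) set set" where
  "singularities X = (\<Union>a\<in>{1<..}. points_of_multiplicity X a)"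

text \<open>The list of pairs \<open>(k\<^sub>i, a\<^sub>i)\<close> stands for the symbol
  \<open>k\<^sub>1 \<times> a\<^sub>1, \<dots>, k\<^sub>m \<times> a\<^sub>m\<close>; the empty list gives the stratum \<open>\<H>(0)\<close>
  of surfaces without singularities.\<close>

definition stratum_symbol :: "(nat \<times> nat) list \<Rightarrow> bool" where
  "stratum_symbol ks \<longleftrightarrow> distinct (map snd ks) \<and> (\<forall>(k, a)\<in>set ks. k > 0 \<and> a > 0)"

text \<open>The origamis in the stratum of translation surfaces with the given symbol.\<close>

definition stratum :: "(nat \<times> nat) list \<Rightarrow> 'a origami set" where
  "stratum ks = {X. origami X \<and>
     (\<forall>(k, a)\<in>set ks. card (points_of_multiplicity X (a + 1)) = k) \<and>
     singularities X = (\<Union>(k, a)\<in>set ks. points_of_multiplicity X (a + 1))}"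

end

theory Submission
  imports Defs "HOL-Algebra.Zassenhaus"
begin

text \<open>The deck group \<open>G\<close> of a normal origami acts simply transitively on the squares, so the squares
  are labelled by \<open>G\<close> and the right and upper neighbours of \<open>g\<close> are \<open>g x\<close> and \<open>g y\<close> for generators
  \<open>x\<close>, \<open>y\<close>.  The vertices correspond to the left cosets of the subgroup generated by the commutator
  of \<open>x\<^sup>-\<^sup>1\<close> and \<open>y\<^sup>-\<^sup>1\<close>, and each has the order of this commutator as its multiplicity.  Hence it
  suffices that the order of \<open>[x, y]\<close> is the same for all pairs of generators of \<open>G\<close>.

  As \<open>G'\<close> is generated by the conjugates of \<open>[x, y]\<close>, this order is the exponent of \<open>G'\<close> as soon as
  the elements of \<open>G'\<close> of order at most \<open>p\<^sup>k\<close> are closed under products.  They are if \<open>G'\<close> is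
  regular, order-closed or, by the Hall--Petrescu formula, of class less than \<open>p\<close>, which settles the
  groups of small order or class.  If \<open>G\<close> is powerful, then \<open>[G', G] \<le> (G')\<^sup>p\<close>, so \<open>G'\<close> is cyclic
  and generated by \<open>[x, y]\<close>.  If \<open>G'\<close> is powerful, its subgroup of \<open>p\<close>-th powers is powerful again and
  generated by the \<open>p\<close>-th powers of generators of \<open>G'\<close>, so \<open>G'\<close> has the exponent of its generators.

  Let \<open>G\<close> have maximal class and order at least \<open>p\<^sup>p\<^sup>+\<^sup>3\<close>.  The centralizers of the sections
  \<open>\<gamma>\<^sub>k / \<gamma>\<^sub>k\<^sub>+\<^sub>2\<close> repeat with period \<open>p - 1\<close>, so some \<open>t\<close> lies in none of them.  Then \<open>t\<^sup>p\<close> is central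
  and every \<open>w t\<close> with \<open>w \<in> \<gamma>\<^sub>2\<close> is conjugate to \<open>t\<close>, whence \<open>(w t)\<^sup>p = t\<^sup>p\<close>.  On the other hand,
  \<open>(w t)\<^sup>p t\<^sup>-\<^sup>p\<close> is, modulo deeper terms, the product of \<open>w\<^sup>p\<close> and an iterated commutator of \<open>w\<close> with
  \<open>p - 1\<close> factors \<open>w t\<close>.  So the \<open>p\<close>-th power map takes \<open>\<gamma>\<^sub>i - \<gamma>\<^sub>i\<^sub>+\<^sub>1\<close> to \<open>\<gamma>\<^sub>i\<^sub>+\<^sub>p\<^sub>-\<^sub>1 - \<gamma>\<^sub>i\<^sub>+\<^sub>p\<close>, and
  all elements of \<open>\<gamma>\<^sub>2 - \<gamma>\<^sub>3\<close>, such as \<open>[x, y]\<close>, have the same order.\<close>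

section \<open>Commutators and the lower central series\<close>

text \<open>The Hall-Petrescu formula is obtained from sequences in a filtered group whose k-th
  multiplicative differences lie k steps deeper. These sequences are closed under products, inverses
  and commutators, and one that is trivial at 0, ..., k - 1 takes all its values k steps deeper;
  dividing off binomial powers one at a time then yields the formula. The same calculus treats
  [x^q, y] in powerful groups and, with the highest difference kept, (w t)^p in groups of maximal
  class.

  For maximal class the obstacle is a circularity: the periodicity of the centralizers rests on an
  element outside them, and the existence of that element rests on periodicity. It is broken by
  working modulo \<open>gam m\<close> with an element that avoids the centralizers concerned, and
  letting \<open>m\<close> grow. The element is found by a pigeonhole argument, which works as long
  as at most p centralizers have to be avoided.

  On the geometric side a deck transformation is merely a homeomorphism over the torus. That it
  carries squares to squares rests on the connectedness of the open square and on continuity at its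
  boundary.\<close>

definition cm :: "('a, 'b) monoid_scheme \<Rightarrow> 'a \<Rightarrow> 'a \<Rightarrow> 'a" where
  "cm G a b = a \<otimes>\<^bsub>G\<^esub> b \<otimes>\<^bsub>G\<^esub> inv\<^bsub>G\<^esub> a \<otimes>\<^bsub>G\<^esub> inv\<^bsub>G\<^esub> b"

context group begin

lemma inv_mult_cancel: "x \<in> carrier G \<Longrightarrow> y \<in> carrier G \<Longrightarrow> inv x \<otimes> (x \<otimes> y) = y"
  by (simp add: m_assoc[symmetric])

lemma mult_inv_cancel: "x \<in> carrier G \<Longrightarrow> y \<in> carrier G \<Longrightarrow> x \<otimes> (inv x \<otimes> y) = y"
  by (simp add: m_assoc[symmetric])

lemmas word = m_assoc inv_mult_group inv_mult_cancel mult_inv_cancel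

lemma cm_closed [simp, intro]:
  "a \<in> carrier G \<Longrightarrow> b \<in> carrier G \<Longrightarrow> cm G a b \<in> carrier G"
  by (simp add: cm_def)

lemma cm_one [simp]: "a \<in> carrier G \<Longrightarrow> cm G a \<one> = \<one>" "a \<in> carrier G \<Longrightarrow> cm G \<one> a = \<one>"
  by (simp_all add: cm_def)

lemma cm_swap: "a \<in> carrier G \<Longrightarrow> b \<in> carrier G \<Longrightarrow> cm G b a = inv (cm G a b)"
  by (simp add: cm_def word)

lemma cm_mult_left:
  assumes "a \<in> carrier G" "b \<in> carrier G" "c \<in> carrier G"
  shows "cm G (a \<otimes> b) c = a \<otimes> cm G b c \<otimes> inv a \<otimes> cm G a c"
  using assms by (simp add: cm_def word)

lemma cm_mult_right:
  assumes "a \<in> carrier G" "b \<in> carrier G" "c \<in> carrier G"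
  shows "cm G a (b \<otimes> c) = cm G a b \<otimes> (b \<otimes> cm G a c \<otimes> inv b)"
  using assms by (simp add: cm_def word)

lemma cm_eq_one_iff:
  assumes "a \<in> carrier G" "b \<in> carrier G"
  shows "cm G a b = \<one> \<longleftrightarrow> a \<otimes> b = b \<otimes> a"
proof
  assume "cm G a b = \<one>"
  then have "cm G a b \<otimes> (b \<otimes> a) = b \<otimes> a" using assms by simp
  then show "a \<otimes> b = b \<otimes> a" using assms by (simp add: cm_def word)
next
  assume "a \<otimes> b = b \<otimes> a"
  then show "cm G a b = \<one>" using assms by (simp add: cm_def) (simp add: word)
qed

lemma conj_eq_cm: "a \<in> carrier G \<Longrightarrow> b \<in> carrier G \<Longrightarrow> a \<otimes> b \<otimes> inv a = cm G a b \<otimes> b"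
  by (simp add: cm_def word)

text \<open>An identity of the free group, so reduction of words proves it. It plays the part of the
  Jacobi identity in \<open>gam_cm\<close>.\<close>

lemma hall_witt:
  assumes "x \<in> carrier G" "y \<in> carrier G" "z \<in> carrier G"
  shows "(y \<otimes> cm G x (cm G (inv y) z) \<otimes> inv y) \<otimes> (z \<otimes> cm G y (cm G (inv z) x) \<otimes> inv z)
       \<otimes> (x \<otimes> cm G z (cm G (inv x) y) \<otimes> inv x) = \<one>"
  using assms by (simp add: cm_def word)

lemma normalI':
  assumes "subgroup N G" "\<And>g n. g \<in> carrier G \<Longrightarrow> n \<in> N \<Longrightarrow> g \<otimes> n \<otimes> inv g \<in> N"
  shows "N \<lhd> G"
  using assms by (auto simp: normal_inv_iff)

lemma normal_conj:
  assumes "N \<lhd> G" "g \<in> carrier G" "n \<in> N"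
  shows "g \<otimes> n \<otimes> inv g \<in> N"
  using assms by (auto simp: normal_inv_iff)

lemma normal_conj':
  assumes "N \<lhd> G" "g \<in> carrier G" "n \<in> N"
  shows "inv g \<otimes> n \<otimes> g \<in> N"
  using normal_conj[OF assms(1), of "inv g" n] assms by simp

lemma subgroup_cm:
  assumes "subgroup H G" "a \<in> H" "b \<in> H" shows "cm G a b \<in> H"
  using assms by (simp add: cm_def subgroup.m_closed subgroup.m_inv_closed)

lemma normal_cm_left:
  assumes "N \<lhd> G" "n \<in> N" "g \<in> carrier G" shows "cm G n g \<in> N"
proof -
  have sg: "subgroup N G" using assms(1) by (rule normal_imp_subgroup)
  have n: "n \<in> carrier G" using sg assms(2) by (rule subgroup.mem_carrier)
  have "cm G n g = n \<otimes> (g \<otimes> inv n \<otimes> inv g)" using n assms by (simp add: cm_def word)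
  then show ?thesis using sg assms n
    by (metis normal_conj subgroup.m_closed subgroup.m_inv_closed)
qed

lemma normal_cm_right:
  assumes "N \<lhd> G" "n \<in> N" "g \<in> carrier G" shows "cm G g n \<in> N"
proof -
  have sg: "subgroup N G" using assms(1) by (rule normal_imp_subgroup)
  have n: "n \<in> carrier G" using sg assms(2) by (rule subgroup.mem_carrier)
  show ?thesis using normal_cm_left[OF assms] cm_swap[OF n assms(3)] sg
    by (simp add: subgroup.m_inv_closed)
qed

text \<open>Being a subgroup for normal \<open>N\<close>, it reduces statements about a generated subgroup to its
  generators.\<close>

definition cent_mod :: "'a set \<Rightarrow> 'a set \<Rightarrow> 'a set" where
  "cent_mod A N = {u \<in> carrier G. \<forall>a\<in>A. cm G u a \<in> N}"

lemma cent_mod_subgroup: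
  assumes N: "N \<lhd> G" and A: "A \<subseteq> carrier G"
  shows "subgroup (cent_mod A N) G"
proof -
  have sg: "subgroup N G" using N by (rule normal_imp_subgroup)
  show ?thesis
  proof (rule subgroupI)
    show "cent_mod A N \<subseteq> carrier G" by (auto simp: cent_mod_def)
    have "\<one> \<in> cent_mod A N" using A sg
      by (auto simp: cent_mod_def subgroup.one_closed subset_iff)
    then show "cent_mod A N \<noteq> {}" by auto
  next
    fix u assume u: "u \<in> cent_mod A N"
    then have uc: "u \<in> carrier G" by (simp add: cent_mod_def)
    have "cm G (inv u) a \<in> N" if "a \<in> A" for a
    proof -
      have a: "a \<in> carrier G" using that A by auto
      have "cm G (inv u) a = inv u \<otimes> inv (cm G u a) \<otimes> u"
        using uc a by (simp add: cm_def word)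
      then show ?thesis using u that N sg uc
        by (simp add: cent_mod_def normal_conj' subgroup.m_inv_closed)
    qed
    then show "inv u \<in> cent_mod A N" using uc by (simp add: cent_mod_def)
  next
    fix u v assume u: "u \<in> cent_mod A N" and v: "v \<in> cent_mod A N"
    then have uv: "u \<in> carrier G" "v \<in> carrier G" by (simp_all add: cent_mod_def)
    have "cm G (u \<otimes> v) a \<in> N" if "a \<in> A" for a
      using uv u v that A N sg
      by (auto simp: cm_mult_left cent_mod_def subset_iff intro!: subgroup.m_closed normal_conj)
    then show "u \<otimes> v \<in> cent_mod A N" using uv by (simp add: cent_mod_def)
  qed
qed

lemma cent_mod_generate:
  assumes N: "N \<lhd> G" and A: "A \<subseteq> carrier G" and S: "S \<subseteq> carrier G"
    and "\<And>s a. s \<in> S \<Longrightarrow> a \<in> A \<Longrightarrow> cm G s a \<in> N"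
    and "u \<in> generate G S" "a \<in> A"
  shows "cm G u a \<in> N"
proof -
  have "S \<subseteq> cent_mod A N" using assms by (auto simp: cent_mod_def)
  then have "generate G S \<subseteq> cent_mod A N"
    using cent_mod_subgroup[OF N A] by (rule generate_subgroup_incl)
  then show ?thesis using assms by (auto simp: cent_mod_def)
qed

lemma normal_carrier: "carrier G \<lhd> G"
  by (rule normalI'[OF subgroup_self]) auto

lemma normal_generate_conj:
  assumes S: "S \<subseteq> carrier G"
    and conj: "\<And>g s. g \<in> carrier G \<Longrightarrow> s \<in> S \<Longrightarrow> g \<otimes> s \<otimes> inv g \<in> generate G S"
  shows "generate G S \<lhd> G"
proof (rule normalI'[OF generate_is_subgroup[OF S]])
  fix g n assume g: "g \<in> carrier G" and n: "n \<in> generate G S"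
  have N: "subgroup (generate G S) G" using S by (rule generate_is_subgroup)
  from n show "g \<otimes> n \<otimes> inv g \<in> generate G S"
  proof (induction rule: generate.induct)
    case one then show ?case using g N by (simp add: subgroup.one_closed)
  next
    case (incl h) then show ?case using g conj by auto
  next
    case (inv h)
    have h: "h \<in> carrier G" using inv S by auto
    have "g \<otimes> inv h \<otimes> inv g = inv (g \<otimes> h \<otimes> inv g)" using g h by (simp add: word)
    then show ?case using N conj[OF g inv] by (simp add: subgroup.m_inv_closed)
  next
    case (eng h1 h2)
    have h: "h1 \<in> carrier G" "h2 \<in> carrier G"
      using eng generate_in_carrier[OF S] by auto
    have "g \<otimes> (h1 \<otimes> h2) \<otimes> inv g = (g \<otimes> h1 \<otimes> inv g) \<otimes> (g \<otimes> h2 \<otimes> inv g)"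
      using g h by (simp add: word)
    then show ?case using N eng by (simp add: subgroup.m_closed)
  qed
qed

section \<open>Mutual commutator subgroups and the terms of the lower central series\<close>

definition comm_sub :: "'a set \<Rightarrow> 'a set \<Rightarrow> 'a set" where
  "comm_sub A B = generate G {cm G a b | a b. a \<in> A \<and> b \<in> B}"

lemma comm_sub_memI: "a \<in> A \<Longrightarrow> b \<in> B \<Longrightarrow> cm G a b \<in> comm_sub A B"
  unfolding comm_sub_def by (rule generate.incl) blast

lemma comm_sub_least:
  assumes "subgroup N G" "\<And>a b. a \<in> A \<Longrightarrow> b \<in> B \<Longrightarrow> cm G a b \<in> N"
  shows "comm_sub A B \<subseteq> N"
  unfolding comm_sub_def using assms by (intro generate_subgroup_incl) auto

lemma comm_sub_normal:
  assumes A: "A \<lhd> G" and B: "B \<lhd> G" shows "comm_sub A B \<lhd> G"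
  unfolding comm_sub_def
proof (rule normal_generate_conj)
  have sA: "A \<subseteq> carrier G" and sB: "B \<subseteq> carrier G"
    using A B by (auto dest!: normal_imp_subgroup subgroup.subset)
  then show "{cm G a b | a b. a \<in> A \<and> b \<in> B} \<subseteq> carrier G" by auto
  fix g s assume g: "g \<in> carrier G" and "s \<in> {cm G a b | a b. a \<in> A \<and> b \<in> B}"
  then obtain a b where s: "s = cm G a b" "a \<in> A" "b \<in> B" by auto
  then have c: "a \<in> carrier G" "b \<in> carrier G" using sA sB by auto
  have "g \<otimes> s \<otimes> inv g = cm G (g \<otimes> a \<otimes> inv g) (g \<otimes> b \<otimes> inv g)"
    using g c s by (simp add: cm_def word)
  then show "g \<otimes> s \<otimes> inv g \<in> generate G {cm G a b | a b. a \<in> A \<and> b \<in> B}"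
    using s g A B by (intro generate.incl) (auto intro: normal_conj)
qed

lemma derived_eq_comm_sub: "derived G H = comm_sub H H"
proof -
  have "derived_set G H = {cm G a b | a b. a \<in> H \<and> b \<in> H}" by (auto simp: cm_def)
  then show ?thesis by (simp add: derived_def comm_sub_def)
qed

lemma cm_in_derived: "a \<in> H \<Longrightarrow> b \<in> H \<Longrightarrow> cm G a b \<in> derived G H"
  by (simp add: derived_eq_comm_sub comm_sub_memI)

lemma lower_central_Suc: "lower_central G (Suc n) = comm_sub (lower_central G n) (carrier G)"
proof -
  have "(\<Union>g\<in>lower_central G n. \<Union>h\<in>carrier G. {g \<otimes> h \<otimes> inv g \<otimes> inv h})
    = {cm G a b | a b. a \<in> lower_central G n \<and> b \<in> carrier G}" by (auto simp: cm_def)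
  then show ?thesis by (simp add: comm_sub_def)
qed

text \<open>Indexed from \<open>1\<close> as usual in the literature; \<open>gam 0\<close> is again the whole group.\<close>

definition gam :: "nat \<Rightarrow> 'a set" where "gam k = lower_central G (k - 1)"

lemma lower_central_normal: "lower_central G n \<lhd> G"
proof (induction n)
  case 0 then show ?case by (simp add: normal_carrier)
next
  case (Suc n) then show ?case
    unfolding lower_central_Suc by (rule comm_sub_normal[OF _ normal_carrier])
qed

lemma gam_normal: "gam k \<lhd> G" by (simp add: gam_def lower_central_normal)

lemma gam_subgroup: "subgroup (gam k) G" using gam_normal by (rule normal_imp_subgroup)

lemma gam_carrier: "x \<in> gam k \<Longrightarrow> x \<in> carrier G"
  using gam_subgroup by (rule subgroup.mem_carrier)

lemma gam_0 [simp]: "gam 0 = carrier G" and gam_1 [simp]: "gam (Suc 0) = carrier G"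
  by (simp_all add: gam_def)

lemma gam_Suc: "k \<ge> 1 \<Longrightarrow> gam (Suc k) = comm_sub (gam k) (carrier G)"
  by (cases k) (simp_all add: gam_def lower_central_Suc del: lower_central.simps)

lemma gam_Suc_subset: "gam (Suc k) \<subseteq> gam k"
proof (cases "k = 0")
  case True then show ?thesis by simp
next
  case False
  then have "gam (Suc k) = comm_sub (gam k) (carrier G)" by (simp add: gam_Suc)
  also have "\<dots> \<subseteq> gam k"
    by (rule comm_sub_least[OF gam_subgroup]) (rule normal_cm_left[OF gam_normal])
  finally show ?thesis .
qed

lemma gam_mono: "i \<le> j \<Longrightarrow> gam j \<subseteq> gam i"
  by (rule lift_Suc_antimono_le[of gam]) (rule gam_Suc_subset)

lemma gam_2: "gam 2 = derived G (carrier G)"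
  using gam_Suc[of 1] by (simp add: derived_eq_comm_sub numeral_2_eq_2)

lemma gam_Suc_cm: "a \<in> gam k \<Longrightarrow> g \<in> carrier G \<Longrightarrow> k \<ge> 1 \<Longrightarrow> cm G a g \<in> gam (Suc k)"
  by (simp add: gam_Suc comm_sub_memI)

text \<open>The three subgroups argument, by induction on \<open>j\<close>: for a generator [u, v]
  of \<open>gam (Suc j)\<close> the Hall-Witt identity expresses [a', [u, v]] by two commutators
  that the induction hypothesis places in \<open>gam (i + Suc j)\<close>. As \<open>gam 0\<close>
  and \<open>gam 1\<close> are both the whole group, small indices are treated apart.\<close>

lemma gam_cm: "a \<in> gam i \<Longrightarrow> b \<in> gam j \<Longrightarrow> cm G a b \<in> gam (i + j)"
proof (induction j arbitrary: i a b)
  case 0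
  then show ?case by (simp add: normal_cm_left[OF gam_normal])
next
  case (Suc j)
  consider "i = 0" | "j = 0" "i \<ge> 1" | "i \<ge> 1" "j \<ge> 1" by linarith
  then show ?case
  proof cases
    case 1 then show ?thesis using Suc.prems normal_cm_right[OF gam_normal] by simp
  next
    case 2 then show ?thesis using Suc.prems gam_Suc_cm by simp
  next
    case 3
    let ?N = "gam (i + Suc j)"
    have N: "?N \<lhd> G" by (rule gam_normal)
    have sN: "subgroup ?N G" by (rule gam_subgroup)
    have b: "b \<in> generate G {cm G u v | u v. u \<in> gam j \<and> v \<in> carrier G}"
      using Suc.prems 3 by (simp add: gam_Suc comm_sub_def)
    have "cm G s a' \<in> ?N"
      if s: "s \<in> {cm G u v | u v. u \<in> gam j \<and> v \<in> carrier G}" and a': "a' \<in> gam i" for s a'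
    proof -
      obtain u v where uv: "s = cm G u v" "u \<in> gam j" "v \<in> carrier G" using s by auto
      have c: "u \<in> carrier G" "a' \<in> carrier G" using uv a' gam_carrier by auto
      \<comment> \<open>With this choice the inner commutator \<open>cm G (inv ?y) v\<close> of the
        Hall-Witt identity is the generator \<open>s\<close> itself.\<close>
      let ?y = "inv u"
      have y: "?y \<in> gam j" using uv gam_subgroup by (simp add: subgroup.m_inv_closed)
      have "cm G (inv a') ?y \<in> gam (i + j)"
        using Suc.IH[of "inv a'" i ?y] a' y gam_subgroup by (simp add: subgroup.m_inv_closed)
      then have t3: "cm G v (cm G (inv a') ?y) \<in> ?N"
        using cm_swap[of "cm G (inv a') ?y" v] gam_Suc_cm[of "cm G (inv a') ?y" "i + j" v] c uv 3
          subgroup.m_inv_closed[OF sN] by simp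
      have "cm G (inv v) a' \<in> gam (Suc i)"
        using cm_swap[of a' "inv v"] gam_Suc_cm[OF a', of "inv v"] c uv 3
          subgroup.m_inv_closed[OF gam_subgroup] by simp
      then have "cm G (cm G (inv v) a') ?y \<in> ?N" using Suc.IH[of _ "Suc i" ?y] y by simp
      then have t2: "cm G ?y (cm G (inv v) a') \<in> ?N"
        using cm_swap[of "cm G (inv v) a'" ?y] c uv subgroup.m_inv_closed[OF sN] by simp
      define A where "A = ?y \<otimes> cm G a' (cm G (inv ?y) v) \<otimes> inv ?y"
      define B where "B = v \<otimes> cm G ?y (cm G (inv v) a') \<otimes> inv v"
      define C where "C = a' \<otimes> cm G v (cm G (inv a') ?y) \<otimes> inv a'"
      have BN: "B \<in> ?N" "C \<in> ?N" unfolding B_def C_def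
        using N t2 t3 c uv by (auto intro: normal_conj)
      have Ac: "A \<in> carrier G" "B \<in> carrier G" "C \<in> carrier G"
        unfolding A_def using c uv BN gam_carrier by auto
      have "A \<otimes> B \<otimes> C = \<one>"
        unfolding A_def B_def C_def using c uv by (intro hall_witt) auto
      then have "A = inv (B \<otimes> C)" using Ac by (simp add: m_assoc inv_equality[symmetric])
      then have "A \<in> ?N" using BN sN by (simp add: subgroup.m_closed subgroup.m_inv_closed)
      then have "inv ?y \<otimes> A \<otimes> ?y \<in> ?N" using N c by (intro normal_conj') auto
      moreover have "inv ?y \<otimes> A \<otimes> ?y = cm G a' s" unfolding A_def using c uv by (simp add: word)
      ultimately have "cm G a' s \<in> ?N" by simp
      then show ?thesis using cm_swap[of a' s] c uv subgroup.m_inv_closed[OF sN] by simp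
    qed
    then have "cm G b a \<in> ?N"
      using cent_mod_generate[OF N _ _ _ b, of "gam i" a] Suc.prems gam_carrier by blast
    moreover have "a \<in> carrier G" "b \<in> carrier G" using Suc.prems gam_carrier by auto
    ultimately show ?thesis using cm_swap[of b a] subgroup.m_inv_closed[OF sN] by simp
  qed
qed

end

section \<open>Polynomial sequences in filtered groups\<close>

context group begin

definition diff :: "(nat \<Rightarrow> 'a) \<Rightarrow> nat \<Rightarrow> 'a" where
  "diff f n = f (Suc n) \<otimes> inv (f n)"

text \<open>A polynomial sequence in the sense of Leibman, tested up to order \<open>k\<close>: for
  i up to \<open>k\<close> the i-th difference lies in \<open>\<Gamma> (a + i)\<close>.\<close>

primrec poly_seq :: "(nat \<Rightarrow> 'a set) \<Rightarrow> nat \<Rightarrow> nat \<Rightarrow> (nat \<Rightarrow> 'a) \<Rightarrow> bool" where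
  "poly_seq \<Gamma> 0 a f \<longleftrightarrow> (\<forall>n. f n \<in> \<Gamma> a)"
| "poly_seq \<Gamma> (Suc k) a f \<longleftrightarrow> (\<forall>n. f n \<in> \<Gamma> a) \<and> poly_seq \<Gamma> k (Suc a) (diff f)"

text \<open>Kept abstract because the lower central series is also used in a form cut off at
  \<open>gam m\<close>.\<close>

definition filtration :: "(nat \<Rightarrow> 'a set) \<Rightarrow> bool" where
  "filtration \<Gamma> \<longleftrightarrow> (\<forall>i. \<Gamma> i \<lhd> G) \<and> (\<forall>i. \<Gamma> (Suc i) \<subseteq> \<Gamma> i) \<and>
     (\<forall>i j. \<forall>a\<in>\<Gamma> i. \<forall>b\<in>\<Gamma> j. cm G a b \<in> \<Gamma> (i + j))"

lemma filtration_gam: "filtration gam"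
  unfolding filtration_def using gam_normal gam_Suc_subset gam_cm by blast

end

locale filtered_group = group G for G (structure) +
  fixes \<Gamma> :: "nat \<Rightarrow> 'a set"
  assumes filtration: "filtration \<Gamma>"
begin

lemma fl_normal: "\<Gamma> i \<lhd> G" using filtration by (simp add: filtration_def)
lemma fl_subgroup: "subgroup (\<Gamma> i) G" using fl_normal by (rule normal_imp_subgroup)
lemma fl_carrier: "x \<in> \<Gamma> i \<Longrightarrow> x \<in> carrier G" using fl_subgroup by (rule subgroup.mem_carrier)
lemma fl_Suc: "x \<in> \<Gamma> (Suc i) \<Longrightarrow> x \<in> \<Gamma> i" using filtration by (auto simp: filtration_def)
lemma fl_mono: "i \<le> j \<Longrightarrow> \<Gamma> j \<subseteq> \<Gamma> i"
  by (rule lift_Suc_antimono_le[of \<Gamma>]) (auto intro: fl_Suc)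
lemma fl_cm: "a \<in> \<Gamma> i \<Longrightarrow> b \<in> \<Gamma> j \<Longrightarrow> cm G a b \<in> \<Gamma> (i + j)"
  using filtration by (simp add: filtration_def)
lemma fl_one: "\<one> \<in> \<Gamma> i" using fl_subgroup by (rule subgroup.one_closed)
lemma fl_mult: "a \<in> \<Gamma> i \<Longrightarrow> b \<in> \<Gamma> i \<Longrightarrow> a \<otimes> b \<in> \<Gamma> i" using fl_subgroup by (rule subgroup.m_closed)
lemma fl_inv: "a \<in> \<Gamma> i \<Longrightarrow> inv a \<in> \<Gamma> i" using fl_subgroup by (rule subgroup.m_inv_closed)
lemma fl_pow: "a \<in> \<Gamma> i \<Longrightarrow> a [^] (n::nat) \<in> \<Gamma> i"
  by (induction n) (simp_all add: fl_one fl_mult)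

lemma poly_seq_val: "poly_seq \<Gamma> k a f \<Longrightarrow> f n \<in> \<Gamma> a" by (cases k) auto

lemma poly_seq_carrier: "poly_seq \<Gamma> k a f \<Longrightarrow> f n \<in> carrier G"
  using poly_seq_val fl_carrier by blast

lemma poly_seq_prev: "poly_seq \<Gamma> (Suc k) a f \<Longrightarrow> poly_seq \<Gamma> k a f"
  by (induction k arbitrary: a f) auto

lemma poly_seq_mono_Suc: "poly_seq \<Gamma> k (Suc a) f \<Longrightarrow> poly_seq \<Gamma> k a f"
  by (induction k arbitrary: a f) (auto intro: fl_Suc)

lemma poly_seq_mono: "a \<le> b \<Longrightarrow> poly_seq \<Gamma> k b f \<Longrightarrow> poly_seq \<Gamma> k a f"
  by (induction rule: inc_induct) (auto intro: poly_seq_mono_Suc)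

lemma poly_seq_shift: "poly_seq \<Gamma> k a f \<Longrightarrow> poly_seq \<Gamma> k a (\<lambda>n. f (Suc n))"
proof (induction k arbitrary: a f)
  case (Suc k)
  have "diff (\<lambda>n. f (Suc n)) = (\<lambda>n. diff f (Suc n))" by (simp add: diff_def fun_eq_iff)
  then show ?case using Suc by simp
qed auto

lemma poly_seq_diff: "poly_seq \<Gamma> (Suc k) a f \<Longrightarrow> poly_seq \<Gamma> k (Suc a) (diff f)" by simp

lemma diff_mult:
  assumes "\<And>n. f n \<in> carrier G" "\<And>n. g n \<in> carrier G"
  shows "diff (\<lambda>n. f n \<otimes> g n) = (\<lambda>n. diff f n \<otimes> cm G (f n) (diff g n) \<otimes> diff g n)"
  using assms by (simp add: diff_def cm_def word fun_eq_iff)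

lemma diff_inv:
  assumes "\<And>n. f n \<in> carrier G"
  shows "diff (\<lambda>n. inv (f n)) = (\<lambda>n. cm G (inv (f n)) (inv (diff f n)) \<otimes> inv (diff f n))"
proof
  fix n show "diff (\<lambda>n. inv (f n)) n = cm G (inv (f n)) (inv (diff f n)) \<otimes> inv (diff f n)"
    using assms by (simp add: diff_def cm_def word)
qed

text \<open>Expansion of the commutator after writing f (n + 1) as diff f n times f n, and likewise
  for \<open>g\<close>. The shape matters: every factor is, up to conjugation, a commutator in which
  a difference occurs, so its degree exceeds that of the original commutator by one.\<close>

lemma diff_cm:
  assumes "\<And>n. f n \<in> carrier G" "\<And>n. g n \<in> carrier G"
  shows "diff (\<lambda>n. cm G (f n) (g n)) = (\<lambda>n.
     cm G (diff f n) (cm G (f n) (g (Suc n))) \<otimes> cm G (f n) (diff g n)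
       \<otimes> cm G (diff g n) (cm G (f n) (g n)) \<otimes> (cm G (f n) (g n) \<otimes> cm G (diff f n) (g (Suc n))
       \<otimes> inv (cm G (f n) (g n))))"
proof
  fix n
  have c: "f n \<in> carrier G" "g n \<in> carrier G" "f (Suc n) \<in> carrier G" "g (Suc n) \<in> carrier G"
    using assms by auto
  let ?d = "diff f n" and ?e = "diff g n" and ?w = "cm G (f n) (g n)"
  have de: "?d \<in> carrier G" "?e \<in> carrier G" using c by (simp_all add: diff_def)
  have f: "f (Suc n) = ?d \<otimes> f n" and g: "g (Suc n) = ?e \<otimes> g n"
    using c by (simp_all add: diff_def word)
  have 1: "cm G (f (Suc n)) (g (Suc n))
      = ?d \<otimes> cm G (f n) (g (Suc n)) \<otimes> inv ?d \<otimes> cm G ?d (g (Suc n))"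
    unfolding f using c de by (intro cm_mult_left)
  also have "\<dots> = cm G ?d (cm G (f n) (g (Suc n))) \<otimes> cm G (f n) (g (Suc n)) \<otimes> cm G ?d (g (Suc n))"
    using c de by (simp add: conj_eq_cm)
  also have "cm G (f n) (g (Suc n)) = cm G (f n) ?e \<otimes> (?e \<otimes> ?w \<otimes> inv ?e)"
    unfolding g using c de by (intro cm_mult_right)
  also have "?e \<otimes> ?w \<otimes> inv ?e = cm G ?e ?w \<otimes> ?w"
    using c de by (simp add: conj_eq_cm)
  finally have *: "cm G (f (Suc n)) (g (Suc n)) = cm G ?d (cm G (f n) ?e \<otimes> (cm G ?e ?w \<otimes> ?w)) \<otimes>
     (cm G (f n) ?e \<otimes> (cm G ?e ?w \<otimes> ?w)) \<otimes> cm G ?d (g (Suc n))" .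
  have **: "cm G (f n) (g (Suc n)) = cm G (f n) ?e \<otimes> (cm G ?e ?w \<otimes> ?w)"
    unfolding g using c de by (simp add: cm_mult_right conj_eq_cm)
  have "?w \<in> carrier G" "cm G (f n) ?e \<in> carrier G" "cm G ?e ?w \<in> carrier G"
    "cm G ?d (cm G (f n) (g (Suc n))) \<in> carrier G" "cm G ?d (g (Suc n)) \<in> carrier G"
    using c de by auto
  then show "diff (\<lambda>n. cm G (f n) (g n)) n = cm G ?d (cm G (f n) (g (Suc n))) \<otimes> cm G (f n) ?e
       \<otimes> cm G ?e ?w \<otimes> (?w \<otimes> cm G ?d (g (Suc n)) \<otimes> inv ?w)"
    unfolding diff_def[of "\<lambda>n. cm G (f n) (g n)"] * ** by (simp add: m_assoc)
qed

text \<open>The Lazard--Leibman theorem. Truncating the polynomiality condition at order \<open>k\<close> makes an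
  upward induction possible: the difference of a commutator involves that commutator again, but
  only to a lower order.\<close>

lemma poly_seq_closed:
  shows "(\<forall>a f g. poly_seq \<Gamma> k a f \<longrightarrow> poly_seq \<Gamma> k a g \<longrightarrow> poly_seq \<Gamma> k a (\<lambda>n. f n \<otimes> g n)) \<and>
    (\<forall>a f. poly_seq \<Gamma> k a f \<longrightarrow> poly_seq \<Gamma> k a (\<lambda>n. inv (f n))) \<and>
    (\<forall>a b f g. poly_seq \<Gamma> k a f \<longrightarrow> poly_seq \<Gamma> k b g \<longrightarrow> poly_seq \<Gamma> k (a + b) (\<lambda>n. cm G (f n) (g n)))"
proof (induction k)
  case 0
  then show ?case by (simp add: fl_mult fl_inv fl_cm)
next
  case (Suc k)
  have P: "poly_seq \<Gamma> k a (\<lambda>n. f n \<otimes> g n)" if "poly_seq \<Gamma> k a f" "poly_seq \<Gamma> k a g" for a f g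
    using Suc that by blast
  have I: "poly_seq \<Gamma> k a (\<lambda>n. inv (f n))" if "poly_seq \<Gamma> k a f" for a f
    using Suc that by blast
  have C: "poly_seq \<Gamma> k c (\<lambda>n. cm G (f n) (g n))"
    if "poly_seq \<Gamma> k a f" "poly_seq \<Gamma> k b g" "c \<le> a + b" for a b c f g
    using Suc that by (blast intro: poly_seq_mono)
  show ?case
  proof (intro conjI allI impI)
    fix a f g assume f: "poly_seq \<Gamma> (Suc k) a f" and g: "poly_seq \<Gamma> (Suc k) a g"
    have "poly_seq \<Gamma> k (Suc a) (diff (\<lambda>n. f n \<otimes> g n))"
      unfolding diff_mult[of f g, OF poly_seq_carrier[OF f] poly_seq_carrier[OF g]]
      by (rule P[OF P[OF poly_seq_diff[OF f] C[OF poly_seq_prev[OF f] poly_seq_diff[OF g]]]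
            poly_seq_diff[OF g]]) simp
    then show "poly_seq \<Gamma> (Suc k) a (\<lambda>n. f n \<otimes> g n)" using f g by (simp add: fl_mult)
  next
    fix a f assume f: "poly_seq \<Gamma> (Suc k) a f"
    have "poly_seq \<Gamma> k (Suc a) (diff (\<lambda>n. inv (f n)))"
      unfolding diff_inv[of f, OF poly_seq_carrier[OF f]]
      by (rule P[OF C[OF I[OF poly_seq_prev[OF f]] I[OF poly_seq_diff[OF f]]] I[OF poly_seq_diff[OF f]]])
        simp
    then show "poly_seq \<Gamma> (Suc k) a (\<lambda>n. inv (f n))" using f by (simp add: fl_inv)
  next
    fix a b f g assume f: "poly_seq \<Gamma> (Suc k) a f" and g: "poly_seq \<Gamma> (Suc k) b g"
    note f' = poly_seq_prev[OF f] and g' = poly_seq_prev[OF g]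
    note d = poly_seq_diff[OF f] and e = poly_seq_diff[OF g]
    let ?w = "\<lambda>n. cm G (f n) (g n)"
    have w: "poly_seq \<Gamma> k (a + b) ?w" by (rule C[OF f' g']) simp
    have dg: "poly_seq \<Gamma> k (Suc (a + b)) (\<lambda>n. cm G (diff f n) (g (Suc n)))"
      by (rule C[OF d poly_seq_shift[OF g']]) simp
    have "poly_seq \<Gamma> k (Suc (a + b)) (diff ?w)"
    proof (subst diff_cm)
      \<comment> \<open>The induction hypothesis speaks of products, inverses and commutators, so
        the conjugate is rewritten in these terms.\<close>
      have "(\<lambda>n. ?w n \<otimes> cm G (diff f n) (g (Suc n)) \<otimes> inv (?w n)) =
          (\<lambda>n. cm G (?w n) (cm G (diff f n) (g (Suc n))) \<otimes> cm G (diff f n) (g (Suc n)))"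
        using poly_seq_carrier[OF f] poly_seq_carrier[OF g] poly_seq_carrier[OF d]
        by (simp add: conj_eq_cm)
      moreover have "poly_seq \<Gamma> k (Suc (a + b))
          (\<lambda>n. cm G (?w n) (cm G (diff f n) (g (Suc n))) \<otimes> cm G (diff f n) (g (Suc n)))"
        by (rule P[OF C[OF w dg] dg]) simp
      ultimately have 4: "poly_seq \<Gamma> k (Suc (a + b))
          (\<lambda>n. ?w n \<otimes> cm G (diff f n) (g (Suc n)) \<otimes> inv (?w n))" by simp
      have 3: "poly_seq \<Gamma> k (Suc (a + b)) (\<lambda>n. cm G (diff g n) (?w n))"
        by (rule C[OF e w]) simp
      have 2: "poly_seq \<Gamma> k (Suc (a + b)) (\<lambda>n. cm G (f n) (diff g n))"
        by (rule C[OF f' e]) simp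
      have 1: "poly_seq \<Gamma> k (Suc (a + b)) (\<lambda>n. cm G (diff f n) (cm G (f n) (g (Suc n))))"
        by (rule C[OF d C[OF f' poly_seq_shift[OF g'] order.refl]]) simp
      show "poly_seq \<Gamma> k (Suc (a + b)) (\<lambda>n. cm G (diff f n) (cm G (f n) (g (Suc n)))
          \<otimes> cm G (f n) (diff g n) \<otimes> cm G (diff g n) (?w n)
          \<otimes> (?w n \<otimes> cm G (diff f n) (g (Suc n)) \<otimes> inv (?w n)))"
        using P[OF P[OF P[OF 1 2] 3] 4] .
    qed (use poly_seq_carrier[OF f] poly_seq_carrier[OF g] in auto)
    then show "poly_seq \<Gamma> (Suc k) (a + b) ?w"
      using poly_seq_val[OF f] poly_seq_val[OF g] by (simp add: fl_cm)
  qed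
qed

section \<open>Polynomial sequences and the Hall-Petrescu formula\<close>

definition poly :: "nat \<Rightarrow> (nat \<Rightarrow> 'a) \<Rightarrow> bool" where
  "poly a f \<longleftrightarrow> (\<forall>k. poly_seq \<Gamma> k a f)"

lemma poly_mult: "poly a f \<Longrightarrow> poly a g \<Longrightarrow> poly a (\<lambda>n. f n \<otimes> g n)"
  and poly_inv: "poly a f \<Longrightarrow> poly a (\<lambda>n. inv (f n))"
  and poly_cm: "poly a f \<Longrightarrow> poly b g \<Longrightarrow> poly (a + b) (\<lambda>n. cm G (f n) (g n))"
  using poly_seq_closed unfolding poly_def by blast+

lemma poly_val: "poly a f \<Longrightarrow> f n \<in> \<Gamma> a"
  unfolding poly_def using poly_seq_val by blast

lemma poly_carrier: "poly a f \<Longrightarrow> f n \<in> carrier G"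
  using poly_val fl_carrier by blast

lemma poly_diff: "poly a f \<Longrightarrow> poly (Suc a) (diff f)"
  unfolding poly_def by (metis poly_seq_diff)

lemma poly_diffI:
  assumes "poly (Suc a) (diff f)" "\<And>n. f n \<in> \<Gamma> a" shows "poly a f"
  unfolding poly_def
proof
  fix k show "poly_seq \<Gamma> k a f" using assms by (cases k) (auto simp: poly_def)
qed

lemma poly_mono: "a \<le> b \<Longrightarrow> poly b f \<Longrightarrow> poly a f"
  unfolding poly_def using poly_seq_mono by blast

lemma diff_const: "c \<in> carrier G \<Longrightarrow> diff (\<lambda>n. c) = (\<lambda>n. \<one>)"
  by (simp add: diff_def fun_eq_iff)

lemma poly_one: "poly a (\<lambda>n. \<one>)"
proof -
  have "poly_seq \<Gamma> k a (\<lambda>n. \<one>)" for k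
  proof (induction k arbitrary: a)
    case (Suc k)
    then show ?case by (simp add: fl_one diff_const)
  qed (simp add: fl_one)
  then show ?thesis by (simp add: poly_def)
qed

lemma poly_const: "c \<in> \<Gamma> a \<Longrightarrow> poly a (\<lambda>n. c)"
  by (rule poly_diffI) (simp_all add: diff_const fl_carrier poly_one)

text \<open>Pascal's rule: the binomial powers of \<open>c\<close> play the part of
  monomials.\<close>

lemma diff_choose:
  assumes "c \<in> carrier G"
  shows "diff (\<lambda>n. c [^] (n choose Suc k)) = (\<lambda>n. c [^] (n choose k))"
  using assms by (simp add: diff_def fun_eq_iff nat_pow_mult[symmetric] m_assoc)

lemma poly_choose: "c \<in> \<Gamma> (a + k) \<Longrightarrow> poly a (\<lambda>n. c [^] (n choose k))"
proof (induction k arbitrary: a)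
  case 0
  then show ?case using poly_const by (simp add: fl_carrier)
next
  case (Suc k)
  have c: "c \<in> \<Gamma> a" using Suc.prems fl_mono[of a "a + Suc k"] by auto
  have "poly (Suc a) (\<lambda>n. c [^] (n choose k))" using Suc.IH[of "Suc a"] Suc.prems by simp
  then have "poly (Suc a) (diff (\<lambda>n. c [^] (n choose Suc k)))"
    by (simp only: diff_choose[OF fl_carrier[OF c]])
  then show ?case by (rule poly_diffI) (rule fl_pow[OF c])
qed

lemma poly_pow:
  assumes "c \<in> \<Gamma> (Suc a)" shows "poly a (\<lambda>n. c [^] n)"
  using poly_choose[of c a 1] assms by simp

text \<open>The analogue of splitting off known roots of a polynomial: the difference has one root
  less and is deep enough by induction, and \<open>f\<close> is recovered from its trivial value at
  0 by telescoping.\<close>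

lemma poly_vanish:
  assumes "poly a f" "\<And>j. j < k \<Longrightarrow> f j = \<one>"
  shows "f n \<in> \<Gamma> (a + k)"
  using assms
proof (induction k arbitrary: a f n)
  case 0 then show ?case by (simp add: poly_val)
next
  case (Suc k)
  have f: "f n \<in> carrier G" for n using Suc.prems poly_carrier by blast
  have d: "diff f n \<in> \<Gamma> (a + Suc k)" for n
    using Suc.IH[OF poly_diff[OF Suc.prems(1)]] Suc.prems(2) by (simp add: diff_def)
  show ?case
  proof (induction n)
    case 0 then show ?case using Suc.prems fl_one by simp
  next
    case (Suc n)
    have "f (Suc n) = diff f n \<otimes> f n" using f by (simp add: diff_def word)
    then show ?case using d Suc fl_mult by simp
  qed
qed

text \<open>A sequence that vanishes below \<open>k\<close> is divided by \<open>n \<mapsto> c\<close> to the power \<open>n choose k\<close>, with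
  \<open>c\<close> its value at \<open>k\<close>; the remaining sequence vanishes up to \<open>k\<close>.  Iterating this is the
  Hall--Petrescu collection process.\<close>

lemma poly_peel:
  assumes "poly a f" "\<And>j. j < k \<Longrightarrow> f j = \<one>"
  defines "h \<equiv> (\<lambda>n. inv (f k [^] (n choose k)) \<otimes> f n)"
  shows "poly a h" "\<And>j. j < Suc k \<Longrightarrow> h j = \<one>"
proof -
  have c: "f k \<in> \<Gamma> (a + k)" using assms(1,2) by (rule poly_vanish)
  show "poly a h" unfolding h_def using assms(1) c
    by (intro poly_mult poly_inv poly_choose)
  fix j assume "j < Suc k"
  then consider "j < k" | "j = k" by linarith
  then show "h j = \<one>"
    by cases (use assms(2) fl_carrier[OF c] in \<open>simp_all add: h_def binomial_eq_0\<close>)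
qed

text \<open>Downward induction from \<open>m\<close>, where \<open>poly_vanish\<close> applies. Each
  step splits off one power c^(q choose i) with c in \<open>\<Gamma> (a + i)\<close>, so f q is a
  product of such powers for k <= i < m and a rest in \<open>\<Gamma> (a + m)\<close>.\<close>

lemma hall_petrescu:
  assumes "poly a f" "\<And>j. j < k \<Longrightarrow> f j = \<one>" "k \<le> m" "subgroup N G"
    and "\<And>i c. k \<le> i \<Longrightarrow> i < m \<Longrightarrow> c \<in> \<Gamma> (a + i) \<Longrightarrow> c [^] (q choose i) \<in> N"
    and "\<Gamma> (a + m) \<subseteq> N"
  shows "f q \<in> N"
  using assms(3,1,2,5)
proof (induction k arbitrary: f rule: inc_induct)
  case base
  then show ?case using poly_vanish assms(6) by blast
next
  case (step k)
  define h where "h = (\<lambda>n. inv (f k [^] (n choose k)) \<otimes> f n)"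
  have fk: "f k \<in> \<Gamma> (a + k)" using step.prems by (intro poly_vanish)
  have h: "poly a h" "\<And>j. j < Suc k \<Longrightarrow> h j = \<one>"
    using poly_peel[of a f k] step.prems unfolding h_def by auto
  have "h q \<in> N" using step.IH[OF h] step.prems by auto
  moreover have "f k [^] (q choose k) \<in> N" using step fk by auto
  moreover have "f q = f k [^] (q choose k) \<otimes> h q"
    using fl_carrier[OF fk] poly_carrier[OF step.prems(1)] by (simp add: h_def word)
  ultimately show ?case using assms(4) by (simp add: subgroup.m_closed)
qed

section \<open>The highest difference\<close>

lemma diff_carrier: "(\<And>n. f n \<in> carrier G) \<Longrightarrow> (diff ^^ k) f n \<in> carrier G"
  by (induction k arbitrary: n) (auto simp: diff_def)

lemma poly_iterate_diff: "poly a f \<Longrightarrow> poly (a + k) ((diff ^^ k) f)"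
  by (induction k) (auto dest: poly_diff)

text \<open>The commutator term in \<open>diff_mult\<close> has degree 2 a + 1, which is at least a
  + 2 since 1 <= a; the remaining differences push it into the error term.\<close>

lemma top_diff_mult:
  assumes "poly a f" "poly a g" "1 \<le> a"
  shows "(diff ^^ k) (\<lambda>n. f n \<otimes> g n) 0 \<otimes> inv ((diff ^^ k) f 0 \<otimes> (diff ^^ k) g 0) \<in> \<Gamma> (Suc (a + k))"
  using assms
proof (induction k arbitrary: a f g)
  case 0
  then show ?case using poly_carrier[OF 0(1)] poly_carrier[OF 0(2)] by (simp add: fl_one del: inv_mult_group)
next
  case (Suc k)
  let ?c = "\<lambda>n. cm G (f n) (diff g n)"
  let ?D = "\<lambda>f. (diff ^^ k) f 0"
  let ?N = "\<Gamma> (Suc (a + Suc k))"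
  have f: "\<And>n. f n \<in> carrier G" and g: "\<And>n. g n \<in> carrier G" using Suc.prems poly_carrier by blast+
  have d: "poly (Suc a) (diff f)" "poly (Suc a) (diff g)" using Suc.prems poly_diff by auto
  have c2: "poly (Suc (Suc a)) ?c"
    by (rule poly_mono[OF _ poly_cm[OF Suc.prems(1) d(2)]]) (use Suc.prems in auto)
  then have c: "poly (Suc a) ?c" by (rule poly_mono[rotated]) simp
  have fc: "poly (Suc a) (\<lambda>n. diff f n \<otimes> ?c n)" using d c by (intro poly_mult)
  let ?x = "?D (\<lambda>n. diff f n \<otimes> ?c n)"
  have x: "?x \<otimes> inv (?D (diff f) \<otimes> ?D ?c) \<in> ?N"
    using Suc.IH[OF d(1) c] by simp
  have y: "?D (\<lambda>n. diff f n \<otimes> ?c n \<otimes> diff g n) \<otimes> inv (?x \<otimes> ?D (diff g)) \<in> ?N"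
    using Suc.IH[OF fc d(2)] by simp
  have cN: "?D ?c \<in> ?N" using poly_val[OF poly_iterate_diff[OF c2, of k], of 0] by simp
  have cc: "?D (\<lambda>n. diff f n \<otimes> ?c n \<otimes> diff g n) \<in> carrier G" "?x \<in> carrier G"
    "?D (diff f) \<in> carrier G" "?D (diff g) \<in> carrier G" "?D ?c \<in> carrier G"
    using poly_carrier[OF poly_iterate_diff[OF d(1), of k]]
      poly_carrier[OF poly_iterate_diff[OF d(2), of k]]
      poly_carrier[OF poly_iterate_diff[OF fc, of k]] poly_carrier[OF poly_iterate_diff[OF c, of k]]
      poly_carrier[OF poly_iterate_diff[OF poly_mult[OF fc d(2)], of k]] by auto
  have *: "?D (\<lambda>n. diff f n \<otimes> ?c n \<otimes> diff g n) \<otimes> inv (?D (diff f) \<otimes> ?D (diff g))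
     = (?D (\<lambda>n. diff f n \<otimes> ?c n \<otimes> diff g n) \<otimes> inv (?x \<otimes> ?D (diff g)))
       \<otimes> (?x \<otimes> inv (?D (diff f) \<otimes> ?D ?c)) \<otimes> (?D (diff f) \<otimes> ?D ?c \<otimes> inv (?D (diff f)))"
    using cc by (simp add: word)
  have "?D (diff (\<lambda>n. f n \<otimes> g n)) \<otimes> inv (?D (diff f) \<otimes> ?D (diff g)) \<in> ?N"
    unfolding diff_mult[of f g, OF f g] *
    by (rule fl_mult[OF fl_mult[OF y x] normal_conj[OF fl_normal cc(3) cN]])
  then show ?case by (simp add: funpow_swap1)
qed

lemma top_diff_choose:
  assumes "c \<in> carrier G" "k < p"
  shows "(diff ^^ p) (\<lambda>n. c [^] (n choose k)) n = \<one>"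
  using assms(2)
proof (induction p arbitrary: k n)
  case (Suc p)
  show ?case
  proof (cases k)
    case 0
    have "(diff ^^ Suc p) (\<lambda>n. c) = (\<lambda>n. \<one>)"
      by (induction p) (use assms(1) in \<open>simp_all add: diff_const\<close>)
    then show ?thesis using 0 assms by simp
  next
    case (Suc k')
    have "diff (\<lambda>n. c [^] (n choose k)) = (\<lambda>n. c [^] (n choose k'))"
      using diff_choose[OF assms(1)] Suc by simp
    then show ?thesis using Suc.IH[of k' n] Suc.prems Suc by (simp add: funpow_swap1)
  qed
qed simp

lemma top_diff_vanish:
  assumes "\<And>n. f n \<in> carrier G" "\<And>j. j < k \<Longrightarrow> f j = \<one>"
  shows "(diff ^^ k) f 0 = f k"
  using assms
proof (induction k arbitrary: f)
  case (Suc k)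
  have "(diff ^^ k) (diff f) 0 = diff f k"
    using Suc.prems by (intro Suc.IH) (auto simp: diff_def)
  moreover have "diff f k = f (Suc k)" using Suc.prems by (simp add: diff_def)
  ultimately show ?case by (simp add: funpow_swap1)
qed simp

text \<open>A refinement of \<open>hall_petrescu\<close> that identifies the coefficient at
  \<open>p\<close> as the p-th difference at 0. The binomial powers divided off have trivial p-th
  difference, and by assumption their values at \<open>p\<close> are negligible.\<close>

lemma hall_petrescu_top:
  assumes "poly a f" "\<And>j. j < k \<Longrightarrow> f j = \<one>" "k \<le> p" "1 \<le> a"
    and "\<And>i c. k \<le> i \<Longrightarrow> i < p \<Longrightarrow> c \<in> \<Gamma> (a + i) \<Longrightarrow> c [^] (p choose i) \<in> \<Gamma> (Suc (a + p))"
  shows "f p \<otimes> inv ((diff ^^ p) f 0) \<in> \<Gamma> (Suc (a + p))"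
  using assms(3,1,2,5)
proof (induction k arbitrary: f rule: inc_induct)
  case base
  then have "(diff ^^ p) f 0 = f p" using poly_carrier[OF base(1)] by (intro top_diff_vanish) auto
  then show ?case using poly_carrier[OF base(1)] by (simp add: fl_one)
next
  case (step k)
  let ?N = "\<Gamma> (Suc (a + p))"
  define h where "h = (\<lambda>n. inv (f k [^] (n choose k)) \<otimes> f n)"
  have fk: "f k \<in> \<Gamma> (a + k)" using step.prems by (intro poly_vanish)
  have fc: "f n \<in> carrier G" for n using poly_carrier[OF step.prems(1)] .
  have h: "poly a h" "\<And>j. j < Suc k \<Longrightarrow> h j = \<one>"
    using poly_peel[of a f k] step.prems unfolding h_def by auto
  have 1: "h p \<otimes> inv ((diff ^^ p) h 0) \<in> ?N" using step.IH[OF h] step.prems by auto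
  have 2: "f k [^] (p choose k) \<in> ?N" using step fk by auto
  have ch: "poly a (\<lambda>n. f k [^] (n choose k))" using fk by (rule poly_choose)
  have f: "f = (\<lambda>n. f k [^] (n choose k) \<otimes> h n)"
    using fc by (simp add: h_def word fun_eq_iff)
  have "(diff ^^ p) f 0 \<otimes> inv (\<one> \<otimes> (diff ^^ p) h 0) \<in> ?N"
    using top_diff_mult[OF ch h(1) assms(4), of p] step(2) fc
    by (simp only: f[symmetric] top_diff_choose)
  moreover have c: "(diff ^^ p) f 0 \<in> carrier G" "(diff ^^ p) h 0 \<in> carrier G" "h p \<in> carrier G"
    using fc poly_carrier[OF h(1)] diff_carrier by auto
  ultimately have 3: "inv ((diff ^^ p) f 0 \<otimes> inv ((diff ^^ p) h 0)) \<in> ?N"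
    by (simp add: fl_inv del: inv_mult_group)
  have "f p \<otimes> inv ((diff ^^ p) f 0) = f k [^] (p choose k) \<otimes>
      ((h p \<otimes> inv ((diff ^^ p) h 0)) \<otimes> inv ((diff ^^ p) f 0 \<otimes> inv ((diff ^^ p) h 0)))"
    using c fc by (subst f) (simp add: word)
  then show ?case using 1 2 3 by (simp add: fl_mult)
qed

end

section \<open>Finite p-groups\<close>

context group begin

lemma set_mult_iff: "x \<in> A <#> B \<longleftrightarrow> (\<exists>a\<in>A. \<exists>b\<in>B. x = a \<otimes> b)"
  by (auto simp: set_mult_def)

lemma subset_set_mult:
  assumes "subgroup A G" "subgroup B G"
  shows "A \<subseteq> A <#> B" "B \<subseteq> A <#> B"
proof -
  have "a = a \<otimes> \<one>" "\<one> \<in> B" if "a \<in> A" for a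
    using that assms by (auto dest: subgroup.mem_carrier subgroup.one_closed)
  then show "A \<subseteq> A <#> B" by (force simp: set_mult_iff)
  have "b = \<one> \<otimes> b" "\<one> \<in> A" if "b \<in> B" for b
    using that assms by (auto dest: subgroup.mem_carrier subgroup.one_closed)
  then show "B \<subseteq> A <#> B" by (force simp: set_mult_iff)
qed

lemma set_mult_least:
  assumes "subgroup H G" "A \<subseteq> H" "B \<subseteq> H" shows "A <#> B \<subseteq> H"
  using assms by (auto simp: set_mult_iff intro!: subgroup.m_closed)

lemma set_mult_normal:
  assumes "A \<lhd> G" "B \<lhd> G" shows "A <#> B \<lhd> G"
proof (rule normalI')
  have sA: "subgroup A G" and sB: "subgroup B G" using assms normal_imp_subgroup by auto
  show "subgroup (A <#> B) G" by (rule mult_norm_subgroup[OF assms(1) sB])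
  fix g n assume g: "g \<in> carrier G" and "n \<in> A <#> B"
  then obtain a b where n: "n = a \<otimes> b" "a \<in> A" "b \<in> B" by (auto simp: set_mult_iff)
  then have "a \<in> carrier G" "b \<in> carrier G" using sA sB by (auto dest: subgroup.mem_carrier)
  then have "g \<otimes> n \<otimes> inv g = (g \<otimes> a \<otimes> inv g) \<otimes> (g \<otimes> b \<otimes> inv g)"
    using g n by (simp add: word)
  then show "g \<otimes> n \<otimes> inv g \<in> A <#> B"
    using n assms g by (auto simp: set_mult_iff intro!: bexI normal_conj)
qed

text \<open>In a finite group an inverse is a power, which disposes of the case of inverses.\<close>

lemma generate_induct_finite [consumes 3, case_names one incl mult]:
  assumes fin: "finite (carrier G)" and S: "S \<subseteq> carrier G" and x: "x \<in> generate G S"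
    and one: "P \<one>" and incl: "\<And>s. s \<in> S \<Longrightarrow> P s"
    and mult: "\<And>a b. a \<in> generate G S \<Longrightarrow> b \<in> generate G S \<Longrightarrow> P a \<Longrightarrow> P b \<Longrightarrow> P (a \<otimes> b)"
  shows "P x"
proof -
  have sg: "subgroup (generate G S) G" using S by (rule generate_is_subgroup)
  show ?thesis using x
  proof (induction rule: generate.induct)
    case (inv h)
    have h: "h \<in> carrier G" using inv S by auto
    have hg: "h \<in> generate G S" using inv by (rule generate.incl)
    have pw: "h [^] n \<in> generate G S \<and> P (h [^] n)" for n :: nat
      by (induction n) (use sg hg one incl[OF inv] mult in
        \<open>auto simp: subgroup.one_closed subgroup.m_closed\<close>)
    have "0 < ord h" using ord_ge_1[OF fin h] by simp
    then obtain n where n: "ord h = Suc n" using gr0_conv_Suc by auto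
    have "h [^] n \<otimes> h = \<one>" using pow_ord_eq_1[OF h] n by simp
    then have "h [^] n = inv h" using h by (simp add: inv_equality)
    then show ?case using pw[of n] by simp
  qed (use assms in auto)
qed

lemma subgroup_cm_consistent:
  assumes "subgroup H G" "a \<in> H" "b \<in> H"
  shows "cm (G\<lparr>carrier := H\<rparr>) a b = cm G a b"
  using assms by (simp add: cm_def m_inv_consistent)

lemma subgroup_nat_pow:
  "x [^]\<^bsub>G\<lparr>carrier := H\<rparr>\<^esub> (n::nat) = x [^] n"
  using nat_pow_consistent by metis

end

locale finite_p_group = group G for G (structure) +
  fixes p :: nat
  assumes prime: "prime p" and p_group: "p_group p G"
begin

lemma p_ge_2: "p \<ge> 2" using prime by (rule prime_ge_2_nat)

lemma order_p_power: "\<exists>n. order G = p ^ n" using p_group by (simp add: p_group_def)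

lemma fin: "finite (carrier G)"
  using order_p_power p_ge_2 order_gt_0_iff_finite by (metis not_gr_zero not_numeral_le_zero power_not_zero)

lemma card_subgroup: assumes "subgroup H G" shows "\<exists>n. card H = p ^ n"
proof -
  obtain n where "order G = p ^ n" using order_p_power by blast
  then have "card H dvd p ^ n" using lagrange[OF assms] by (metis dvd_triv_right)
  then show ?thesis using prime by (auto simp: divides_primepow_nat)
qed

lemma finite_subgroup: "subgroup H G \<Longrightarrow> finite H"
  using fin by (meson finite_subset subgroup.subset)

lemma sub_finite_p_group:
  assumes "subgroup H G" shows "finite_p_group (G\<lparr>carrier := H\<rparr>) p"
  using card_subgroup[OF assms] subgroup_imp_group[OF assms] prime
  by (simp add: finite_p_group_def finite_p_group_axioms_def p_group_def order_def)

lemma card_subgroup_dvd: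
  assumes H: "subgroup H G" and K: "subgroup K G" and "H \<subset> K"
  shows "p * card H dvd card K"
proof -
  obtain a b where ab: "card H = p ^ a" "card K = p ^ b" using card_subgroup H K by metis
  have "card H < card K" using assms finite_subgroup psubset_card_mono by metis
  then have "a < b" using ab p_ge_2 by (simp add: power_strict_increasing_iff)
  then have "p ^ Suc a dvd p ^ b" by (intro le_imp_power_dvd) simp
  then show ?thesis using ab by simp
qed

lemma pow_order: "x \<in> carrier G \<Longrightarrow> order G = p ^ n \<Longrightarrow> x [^] (p ^ n) = \<one>"
  using pow_order_eq_1 by metis

lemma ord_p_power: assumes "x \<in> carrier G" shows "\<exists>k. ord x = p ^ k"
  using ord_dvd_group_order[OF assms] order_p_power prime by (metis divides_primepow_nat)

text \<open>By Bezout \<open>x\<close> is a power of x^m, because \<open>m\<close> is prime to the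
  order of \<open>x\<close>.\<close>

lemma pow_coprime_mem:
  assumes H: "subgroup H G" and x: "x \<in> carrier G" and m: "coprime m p" and xm: "x [^] (m::nat) \<in> H"
  shows "x \<in> H"
proof -
  obtain k where k: "ord x = p ^ k" using ord_p_power[OF x] by blast
  have cop: "gcd m (ord x) = 1" using m k by (simp add: coprime_iff_gcd_eq_1[symmetric])
  have "m \<noteq> 0" using m p_ge_2 by (intro notI) simp
  then obtain u v where uv: "m * u = ord x * v + 1" using bezout_nat[of m "ord x"] cop by auto
  have "(x [^] m) [^] u = (x [^] ord x) [^] v \<otimes> x"
    using x uv by (simp add: nat_pow_pow pow_eq_id)
  then have "(x [^] m) [^] u = x" using x by simp
  moreover have "(x [^] m) [^] u \<in> H"
    using H xm by (induction u) (auto simp: subgroup.one_closed subgroup.m_closed)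
  ultimately show ?thesis by simp
qed

text \<open>Class equation: the size of an orbit with more than one point is divisible by
  \<open>p\<close>, so with \<open>x0\<close> as the only fixed point \<open>card E\<close> would be
  1 modulo \<open>p\<close>.\<close>

lemma another_fixed_point:
  assumes act: "group_action G E \<phi>" and finE: "finite E" and dvd: "p dvd card E"
    and x0: "x0 \<in> E" "\<And>g. g \<in> carrier G \<Longrightarrow> \<phi> g x0 = x0"
  shows "\<exists>x\<in>E. x \<noteq> x0 \<and> (\<forall>g\<in>carrier G. \<phi> g x = x)"
proof (rule ccontr)
  assume no: "\<not> ?thesis"
  interpret group_action G E \<phi> by (rule act)
  let ?O = "orbits G E \<phi>"
  have orb0: "orbit G \<phi> x0 = {x0}" using x0 by (auto simp: orbit_def intro!: exI[of _ \<one>])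
  have in0: "{x0} \<in> ?O" using orb0 x0 by (auto simp: orbits_def intro!: exI[of _ x0])
  have finO: "finite ?O" using finE by (simp add: orbits_def)
  have big: "p dvd card b" if b: "b \<in> ?O - {{x0}}" for b
  proof -
    obtain x where x: "x \<in> E" "b = orbit G \<phi> x" using b by (auto simp: orbits_def)
    then have "x \<noteq> x0" using b orb0 by auto
    then obtain g where g: "g \<in> carrier G" "\<phi> g x \<noteq> x" using no x by auto
    have "card b dvd order G" using orbit_stabilizer_theorem[OF x(1)] x by (metis dvd_triv_left)
    then obtain i where i: "card b = p ^ i" using order_p_power prime by (metis divides_primepow_nat)
    have "\<phi> g x \<in> b" "x \<in> b" using x g orbit_refl by (auto simp: orbit_def)
    then have "card b \<noteq> 1" using g by (auto simp: card_1_singleton_iff)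
    then show ?thesis using i by (cases i) auto
  qed
  have "card E = (\<Sum>b\<in>?O. card b)" using disjoint_sum[OF finE, of "\<lambda>x. 1::nat"] by simp
  also have "\<dots> = 1 + (\<Sum>b\<in>?O - {{x0}}. card b)" using sum.remove[OF finO in0, of card] by simp
  finally have "card E = 1 + (\<Sum>b\<in>?O - {{x0}}. card b)" .
  moreover have "p dvd (\<Sum>b\<in>?O - {{x0}}. card b)" using big by (intro dvd_sum) auto
  ultimately have "p dvd 1" using dvd by (metis dvd_add_left_iff)
  then show False using p_ge_2 by simp
qed

section \<open>Central elements modulo a normal subgroup, and nilpotency\<close>

lemma conj_coset:
  assumes L: "L \<lhd> G" and g: "g \<in> carrier G" and x: "x \<in> carrier G"
  shows "(\<lambda>y. g \<otimes> y \<otimes> inv g) ` (L #> x) = L #> (g \<otimes> x \<otimes> inv g)"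
proof -
  have sL: "L \<subseteq> carrier G" using L normal_imp_subgroup subgroup.subset by blast
  have rim: "L #> y = (\<lambda>l. l \<otimes> y) ` L" for y by (auto simp: r_coset_def)
  have "g \<otimes> (l \<otimes> x) \<otimes> inv g = (g \<otimes> l \<otimes> inv g) \<otimes> (g \<otimes> x \<otimes> inv g)" if "l \<in> L" for l
    using that sL g x by (auto simp: word)
  then have "(\<lambda>y. g \<otimes> y \<otimes> inv g) ` (L #> x) = (\<lambda>l. (g \<otimes> l \<otimes> inv g) \<otimes> (g \<otimes> x \<otimes> inv g)) ` L"
    unfolding rim image_image by (rule image_cong[OF refl])
  also have "\<dots> = (\<lambda>l. l \<otimes> (g \<otimes> x \<otimes> inv g)) ` (\<lambda>l. g \<otimes> l \<otimes> inv g) ` L" by (simp add: image_image)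
  also have "(\<lambda>l. g \<otimes> l \<otimes> inv g) ` L = L"
  proof (intro equalityI subsetI)
    fix l assume l: "l \<in> L"
    have "l = g \<otimes> (inv g \<otimes> l \<otimes> g) \<otimes> inv g" using l sL g by (auto simp: word)
    then show "l \<in> (\<lambda>l. g \<otimes> l \<otimes> inv g) ` L" using normal_conj'[OF L g l] by blast
  qed (use normal_conj[OF L g] in auto)
  finally show ?thesis by (simp add: rim)
qed

text \<open>N / L meets the centre of G / L nontrivially, stated with cosets: \<open>G\<close> acts
  by conjugation on the cosets of \<open>L\<close> in \<open>N\<close>, their number is divisible by
  \<open>p\<close>, and \<open>L\<close> is fixed. Another fixed coset consists of elements as
  required.\<close>

lemma central_mod_exists:
  assumes L: "L \<lhd> G" and N: "N \<lhd> G" and LN: "L \<subset> N"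
  shows "\<exists>x\<in>N - L. \<forall>g\<in>carrier G. cm G g x \<in> L"
proof -
  have sgL: "subgroup L G" and sgN: "subgroup N G" using L N normal_imp_subgroup by auto
  have NG: "N \<subseteq> carrier G" using sgN by (rule subgroup.subset)
  define E where "E = (\<lambda>x. L #> x) ` N"
  \<comment> \<open>Restricted to \<open>E\<close> because the members of \<open>Bij E\<close> are
    extensional.\<close>
  define \<phi> where "\<phi> g = restrict (\<lambda>C. (\<lambda>y. g \<otimes> y \<otimes> inv g) ` C) E" for g
  have \<phi>: "\<phi> g (L #> x) = L #> (g \<otimes> x \<otimes> inv g)" if "g \<in> carrier G" "x \<in> N" for g x
    using that NG conj_coset[OF L that(1), of x] by (simp add: \<phi>_def E_def subset_iff)
  have inE: "L #> (g \<otimes> x \<otimes> inv g) \<in> E" if "g \<in> carrier G" "x \<in> N" for g x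
    using that normal_conj[OF N] by (auto simp: E_def)
  have comp: "\<phi> g (\<phi> h C) = \<phi> (g \<otimes> h) C" if gh: "g \<in> carrier G" "h \<in> carrier G" "C \<in> E" for g h C
  proof -
    obtain x where x: "C = L #> x" "x \<in> N" using gh by (auto simp: E_def)
    then have "x \<in> carrier G" using NG by auto
    then show ?thesis using x gh normal_conj[OF N gh(2) x(2)] by (simp add: \<phi> word)
  qed
  have one: "\<phi> \<one> C = C" if CE: "C \<in> E" for C
  proof -
    obtain x where x: "C = L #> x" "x \<in> N" using CE by (auto simp: E_def)
    then show ?thesis using NG by (auto simp: \<phi>)
  qed
  have maps: "\<phi> g C \<in> E" if "g \<in> carrier G" "C \<in> E" for g C
    using that inE by (auto simp: E_def \<phi>)
  have bij: "\<phi> g \<in> Bij E" if g: "g \<in> carrier G" for g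
  proof -
    have "bij_betw (\<phi> g) E E"
      by (rule bij_betw_byWitness[of _ "\<phi> (inv g)"])
        (use g maps comp one in \<open>auto simp: comp\<close>)
    then show ?thesis by (simp add: Bij_def \<phi>_def)
  qed
  have hom: "\<phi> \<in> hom G (BijGroup E)"
  proof (rule homI)
    fix g assume "g \<in> carrier G" then show "\<phi> g \<in> carrier (BijGroup E)"
      using bij by (simp add: BijGroup_def)
  next
    fix g h assume gh: "g \<in> carrier G" "h \<in> carrier G"
    have "\<phi> (g \<otimes> h) = compose E (\<phi> g) (\<phi> h)"
    proof
      fix C show "\<phi> (g \<otimes> h) C = compose E (\<phi> g) (\<phi> h) C"
        using gh comp[of g h C] by (cases "C \<in> E") (auto simp: compose_def \<phi>_def)
    qed
    then show "\<phi> (g \<otimes> h) = \<phi> g \<otimes>\<^bsub>BijGroup E\<^esub> \<phi> h" using gh bij by (simp add: BijGroup_def)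
  qed
  have act: "group_action G E \<phi>"
    unfolding group_action_def group_hom_def group_hom_axioms_def
    using hom group_BijGroup is_group by auto
  have finE: "finite E" unfolding E_def using finite_subgroup[OF sgN] by simp
  have "p * card L dvd card N" using card_subgroup_dvd[OF sgL sgN LN] .
  moreover have "card E * card L = card N"
  proof -
    interpret N: group "G\<lparr>carrier := N\<rparr>" using sgN by (rule subgroup_imp_group)
    have "subgroup L (G\<lparr>carrier := N\<rparr>)" using sgL sgN LN by (intro subgroup_incl) auto
    from N.lagrange[OF this] have "card (rcosets\<^bsub>G\<lparr>carrier := N\<rparr>\<^esub> L) * card L = card N"
      by (simp add: order_def)
    moreover have "rcosets\<^bsub>G\<lparr>carrier := N\<rparr>\<^esub> L = E" by (auto simp: RCOSETS_def E_def)
    ultimately show ?thesis by simp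
  qed
  moreover have "card L \<noteq> 0" using finite_subgroup[OF sgL] subgroup.one_closed[OF sgL] by auto
  ultimately have dvd: "p dvd card E" by (metis dvd_times_right_cancel_iff)
  have L0: "L = L #> \<one>" using subgroup.subset[OF sgL] by simp
  have LE: "L \<in> E" unfolding E_def using L0 subgroup.one_closed[OF sgN] by blast
  have Lfix: "\<phi> g L = L" if "g \<in> carrier G" for g
    using \<phi>[OF that subgroup.one_closed[OF sgN]] that L0 by simp
  obtain C where C: "C \<in> E" "C \<noteq> L" "\<forall>g\<in>carrier G. \<phi> g C = C"
    using another_fixed_point[OF act finE dvd LE Lfix] by auto
  then obtain x where x: "x \<in> N" "C = L #> x" by (auto simp: E_def)
  have xc: "x \<in> carrier G" using x NG by auto
  have "x \<notin> L" using C x coset_join2[OF xc sgL] by auto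
  moreover have "cm G g x \<in> L" if g: "g \<in> carrier G" for g
  proof -
    have "L #> (g \<otimes> x \<otimes> inv g) = L #> x" using C x g \<phi> by auto
    moreover have "g \<otimes> x \<otimes> inv g \<in> L #> (g \<otimes> x \<otimes> inv g)" using g xc sgL by (intro rcos_self) auto
    ultimately obtain l where l: "l \<in> L" "g \<otimes> x \<otimes> inv g = l \<otimes> x" by (auto simp: r_coset_def)
    then have "cm G g x \<otimes> x = l \<otimes> x" using g xc by (simp add: conj_eq_cm)
    then have "cm G g x = l" using g xc l subgroup.mem_carrier[OF sgL] by simp
    then show ?thesis using l by simp
  qed
  ultimately show ?thesis using x by blast
qed

text \<open>Let \<open>L\<close> be largest among the normal subgroups of \<open>G\<close> properly
  inside \<open>N\<close>, and let \<open>x\<close> in N - L be central modulo \<open>L\<close>. By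
  maximality \<open>L\<close> and \<open>x\<close> generate \<open>N\<close>, so [N, G] lies in
  \<open>L\<close>.\<close>

lemma comm_sub_psubset:
  assumes N: "N \<lhd> G" and nt: "N \<noteq> {\<one>}"
  shows "comm_sub N (carrier G) \<subset> N"
proof -
  have sgN: "subgroup N G" using N by (rule normal_imp_subgroup)
  have NG: "N \<subseteq> carrier G" using sgN by (rule subgroup.subset)
  let ?P = "\<lambda>L. L \<lhd> G \<and> L \<subset> N"
  have P1: "?P {\<one>}" using nt subgroup.one_closed[OF sgN] one_is_normal by auto
  have P2: "\<forall>L. ?P L \<longrightarrow> card L < card N"
    using finite_subgroup[OF sgN] by (auto intro: psubset_card_mono)
  obtain L where L: "L \<lhd> G" "L \<subset> N" and max: "\<And>M. ?P M \<Longrightarrow> card M \<le> card L"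
    using ex_has_greatest_nat[of ?P "{\<one>}" card "card N", OF P1 P2] by auto
  have sgL: "subgroup L G" using L normal_imp_subgroup by auto
  have LG: "L \<subseteq> carrier G" using sgL by (rule subgroup.subset)
  obtain x where x: "x \<in> N" "x \<notin> L" and cx: "\<And>g. g \<in> carrier G \<Longrightarrow> cm G g x \<in> L"
    using central_mod_exists[OF L(1) N L(2)] by blast
  have xc: "x \<in> carrier G" using x NG by auto
  let ?S = "L \<union> {x}" let ?M = "generate G ?S"
  have S: "?S \<subseteq> carrier G" using xc LG by auto
  have SM: "?S \<subseteq> ?M" by (auto intro: generate.incl)
  have sgM: "subgroup ?M G" using S by (rule generate_is_subgroup)
  have "?M \<lhd> G"
  proof (rule normal_generate_conj[OF S])
    fix g s assume g: "g \<in> carrier G" and s: "s \<in> ?S"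
    show "g \<otimes> s \<otimes> inv g \<in> ?M"
    proof (cases "s \<in> L")
      case True then show ?thesis using normal_conj[OF L(1) g True] SM by auto
    next
      case False
      then have sx: "s = x" using s by auto
      have "cm G g x \<otimes> x \<in> ?M" using cx[OF g] SM sgM by (intro subgroup.m_closed) auto
      then show ?thesis using sx g xc by (simp add: conj_eq_cm)
    qed
  qed
  moreover have "?M \<subseteq> N" using sgN L x by (intro generate_subgroup_incl) auto
  moreover have "card L < card ?M"
    using finite_subgroup[OF sgM] SM x by (intro psubset_card_mono) auto
  ultimately have M: "?M = N" using max[of ?M] by (metis leD psubsetI)
  have "comm_sub N (carrier G) \<subseteq> L"
  proof (rule comm_sub_least[OF sgL])
    fix a b assume a: "a \<in> N" and b: "b \<in> carrier G"
    have "cm G s g \<in> L" if "s \<in> ?S" "g \<in> carrier G" for s g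
    proof (cases "s \<in> L")
      case True then show ?thesis using normal_cm_left[OF L(1)] that by auto
    next
      case False
      then have "s = x" using that by auto
      then show ?thesis using cx[OF that(2)] cm_swap[OF that(2) xc] sgL
        by (simp add: subgroup.m_inv_closed)
    qed
    then show "cm G a b \<in> L"
      using cent_mod_generate[OF L(1) order.refl S, of a b] a b M by auto
  qed
  then show ?thesis using L by blast
qed

lemma gam_psubset: assumes "gam k \<noteq> {\<one>}" "k \<ge> 1" shows "gam (Suc k) \<subset> gam k"
  using comm_sub_psubset[OF gam_normal assms(1)] gam_Suc[OF assms(2)] by simp

lemma gam_eq_one_exists: "\<exists>k\<ge>1. gam k = {\<one>}"
proof (rule ccontr)
  assume "\<not> ?thesis"
  then have *: "gam (Suc k) \<subset> gam k" if "k \<ge> 1" for k using that gam_psubset by blast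
  have "card (gam (Suc k)) + k \<le> card (gam 1)" for k
  proof (induction k)
    case (Suc k)
    have "card (gam (Suc (Suc k))) < card (gam (Suc k))"
      using * finite_subgroup[OF gam_subgroup] by (intro psubset_card_mono) auto
    then show ?case using Suc by simp
  qed simp
  from this[of "Suc (card (gam 1))"] show False by simp
qed

text \<open>By iteration, \<open>A\<close> lies in every \<open>N [A, G, \<dots>, G]\<close>, and \<open>G\<close> is nilpotent.\<close>

lemma subset_mod_comm_sub:
  assumes N: "N \<lhd> G" and A: "A \<lhd> G" and sub: "A \<subseteq> N <#> comm_sub A (carrier G)"
  shows "A \<subseteq> N"
proof -
  have sgN: "subgroup N G" using N normal_imp_subgroup by auto
  have AG: "A \<subseteq> carrier G" using A normal_imp_subgroup subgroup.subset by blast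
  have step: "A \<subseteq> N <#> gam k" if "k \<ge> 1" for k using that
  proof (induction k rule: nat_induct_at_least)
    case base
    show ?case using AG subset_set_mult[OF sgN gam_subgroup[of 1]] by auto
  next
    case (Suc k)
    let ?K = "N <#> gam (Suc k)"
    have K: "?K \<lhd> G" using N gam_normal by (rule set_mult_normal)
    have sgK: "subgroup ?K G" using K by (rule normal_imp_subgroup)
    have NK: "N \<subseteq> ?K" "gam (Suc k) \<subseteq> ?K" using subset_set_mult[OF sgN gam_subgroup] by auto
    have "comm_sub A (carrier G) \<subseteq> ?K"
    proof (rule comm_sub_least[OF sgK])
      fix a g assume a: "a \<in> A" and g: "g \<in> carrier G"
      then have "a \<in> N <#> gam k" using Suc.IH by auto
      then obtain n c where nc: "a = n \<otimes> c" "n \<in> N" "c \<in> gam k" by (auto simp: set_mult_iff)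
      have cc: "n \<in> carrier G" "c \<in> carrier G"
        using nc sgN gam_carrier by (auto dest: subgroup.mem_carrier)
      have "cm G c g \<in> ?K" using gam_Suc_cm[OF nc(3) g Suc.hyps] NK by auto
      moreover have "cm G n g \<in> ?K" using normal_cm_left[OF N nc(2) g] NK by auto
      ultimately show "cm G a g \<in> ?K"
        using nc cc g K sgK by (auto simp: cm_mult_left intro!: subgroup.m_closed normal_conj)
    qed
    then show ?case using sub set_mult_least[OF sgK NK(1)] by blast
  qed
  obtain k where "k \<ge> 1" "gam k = {\<one>}" using gam_eq_one_exists by blast
  then have "A \<subseteq> N <#> {\<one>}" using step by metis
  then show ?thesis using subgroup.mem_carrier[OF sgN] by (auto simp: set_mult_iff)
qed

text \<open>\<open>M\<close> is a maximal subgroup containing \<open>K\<close>; it is normal of index \<open>p\<close>.\<close>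

lemma frattini:
  assumes K: "subgroup K G" and KG: "K \<noteq> carrier G"
  shows "\<exists>M. subgroup M G \<and> K \<subseteq> M \<and> M \<noteq> carrier G \<and> derived G (carrier G) \<subseteq> M \<and>
    (\<forall>x\<in>carrier G. x [^] p \<in> M)"
proof -
  let ?P = "\<lambda>M. subgroup M G \<and> K \<subseteq> M \<and> M \<noteq> carrier G"
  have P1: "?P K" using K KG by simp
  have P2: "\<forall>M. ?P M \<longrightarrow> card M < card (carrier G)"
    using fin by (auto intro!: psubset_card_mono dest: subgroup.subset)
  obtain M where M: "subgroup M G" "K \<subseteq> M" "M \<noteq> carrier G"
    and max: "\<And>L. ?P L \<Longrightarrow> card L \<le> card M"
    using ex_has_greatest_nat[of ?P K card "card (carrier G)", OF P1 P2] by auto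
  have MG: "M \<subseteq> carrier G" using M subgroup.subset by blast
  have whole: "L = carrier G" if L: "subgroup L G" "M \<subset> L" for L
  proof (rule ccontr)
    assume "L \<noteq> carrier G"
    then have "card L \<le> card M" using max L M by auto
    moreover have "card M < card L" using L finite_subgroup by (intro psubset_card_mono) auto
    ultimately show False by simp
  qed
  obtain k where k: "k \<ge> 1" "gam k = {\<one>}" using gam_eq_one_exists by blast
  \<comment> \<open>Thus \<open>gam i\<close> is the last term of the lower central series not
    inside \<open>M\<close>. An element \<open>x\<close> of it outside \<open>M\<close> satisfies
    [x, G] <= M and therefore normalizes \<open>M\<close>.\<close>
  define i where "i = (LEAST i. gam (Suc i) \<subseteq> M)"
  have ex: "gam (Suc k) \<subseteq> M"
    using gam_Suc_subset[of k] k subgroup.one_closed[OF M(1)] by auto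
  have i: "gam (Suc i) \<subseteq> M" unfolding i_def using ex by (rule LeastI)
  have "i \<noteq> 0" using i M MG by auto
  then obtain j where j: "i = Suc j" using not0_implies_Suc by blast
  then have "\<not> gam i \<subseteq> M" using not_less_Least[of j "\<lambda>i. gam (Suc i) \<subseteq> M"] i_def by auto
  then obtain x where x: "x \<in> gam i" "x \<notin> M" by auto
  have xc: "x \<in> carrier G" using x gam_carrier by auto
  have cx: "cm G x g \<in> M" if "g \<in> carrier G" for g
    using gam_Suc_cm[OF x(1) that] j i by auto
  have S: "insert x M \<subseteq> carrier G" using MG xc by auto
  have gen: "generate G (insert x M) = carrier G"
    using x generate_is_subgroup[OF S] by (intro whole) (auto intro: generate.incl)
  have MN: "M \<lhd> G"
  proof (rule normalI'[OF M(1)])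
    fix g n assume g: "g \<in> carrier G" and n: "n \<in> M"
    \<comment> \<open>The normalizer of \<open>M\<close>; it contains \<open>M\<close> and
      \<open>x\<close>, which generate \<open>G\<close>. Its closure under inverses uses that
      \<open>M\<close> is finite.\<close>
    have "subgroup {g\<in>carrier G. \<forall>n\<in>M. g \<otimes> n \<otimes> inv g \<in> M} G" (is "subgroup ?N G")
    proof (rule subgroupI)
      fix a assume a: "a \<in> ?N"
      have "inv a \<otimes> n \<otimes> a \<in> M" if n: "n \<in> M" for n
      proof -
        have nc: "n \<in> carrier G" using n MG by auto
        have "(\<lambda>n. a \<otimes> n \<otimes> inv a) ` M = M"
        proof (rule card_subset_eq[OF finite_subgroup[OF M(1)]])
          show "(\<lambda>n. a \<otimes> n \<otimes> inv a) ` M \<subseteq> M" using a by auto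
          show "card ((\<lambda>n. a \<otimes> n \<otimes> inv a) ` M) = card M"
            using a MG by (intro card_image inj_onI) (auto simp: subset_iff)
        qed
        then obtain m where m: "m \<in> M" "n = a \<otimes> m \<otimes> inv a" using n by blast
        then have "inv a \<otimes> n \<otimes> a = m" using a MG by (auto simp: word subset_iff)
        then show ?thesis using m by simp
      qed
      then show "inv a \<in> ?N" using a by auto
    next
      fix a b assume ab: "a \<in> ?N" "b \<in> ?N"
      have "a \<otimes> b \<otimes> n \<otimes> inv (a \<otimes> b) \<in> M" if n: "n \<in> M" for n
      proof -
        have "a \<otimes> (b \<otimes> n \<otimes> inv b) \<otimes> inv a \<in> M" using ab n by auto
        moreover have "n \<in> carrier G" using n MG by auto
        ultimately show ?thesis using ab by (simp add: word)
      qed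
      then show "a \<otimes> b \<in> ?N" using ab by auto
    qed (use subgroup.one_closed[OF subgroup_self] MG in \<open>auto intro!: exI[of _ \<one>] simp: subset_iff\<close>)
    moreover have "x \<otimes> n \<otimes> inv x \<in> M" if n: "n \<in> M" for n
    proof -
      have "cm G x n \<otimes> n \<in> M" using cx n MG M(1) by (intro subgroup.m_closed) auto
      then show ?thesis using xc n MG by (auto simp: conj_eq_cm)
    qed
    moreover have "a \<otimes> n \<otimes> inv a \<in> M" if "a \<in> M" "n \<in> M" for a n
      using that M(1) by (simp add: subgroup.m_closed subgroup.m_inv_closed)
    ultimately have "generate G (insert x M) \<subseteq> ?N"
      using xc MG by (intro generate_subgroup_incl) auto
    then show "g \<otimes> n \<otimes> inv g \<in> M" using gen g n by auto
  qed
  have ab: "cm G a b \<in> M" if a: "a \<in> carrier G" and b: "b \<in> carrier G" for a b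
  proof -
    have 1: "cm G s g \<in> M" if "s \<in> insert x M" "g \<in> carrier G" for s g
      using that cx normal_cm_left[OF MN] by auto
    show ?thesis using cent_mod_generate[OF MN order.refl S 1] gen a b by blast
  qed
  have "derived G (carrier G) \<subseteq> M" unfolding derived_eq_comm_sub
    using ab by (intro comm_sub_least[OF M(1)])
  moreover have "y [^] p \<in> M" if y: "y \<in> carrier G" for y
  proof (rule ccontr)
    assume ny: "y [^] p \<notin> M"
    let ?Y = "generate G {y [^] p}"
    have sgY: "subgroup ?Y G" using y by (intro generate_is_subgroup) auto
    have yY: "y [^] p \<in> ?Y" by (auto intro: generate.incl)
    have "M <#> ?Y = carrier G"
      using subset_set_mult[OF M(1) sgY] yY ny by (intro whole mult_norm_subgroup[OF MN sgY]) auto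
    then have "y \<in> M <#> ?Y" using y by (simp only:)
    then obtain m z where mz: "m \<in> M" "z \<in> ?Y" "y = m \<otimes> z" unfolding set_mult_iff by blast
    have "ord (y [^] p) \<noteq> 0" using ord_ge_1[OF fin, of "y [^] p"] y by simp
    then obtain k :: nat where k: "z = (y [^] p) [^] k" using generate_pow_nat[of "y [^] p"] y mz by auto
    have mc: "m \<in> carrier G" using mz MG by auto
    obtain t where t: "order G = p ^ t" using order_p_power by blast
    \<comment> \<open>From y = m z and z = y^(p k) follows y^(1 - p k) = m. The exponent -p k is
      replaced by p k (p^t - 1), which is the same modulo the group order, and \<open>e\<close> is
      still 1 modulo \<open>p\<close>.\<close>
    define e where "e = p * k * (p ^ t - 1) + 1"
    have "y [^] (p * k) \<otimes> y [^] (p * k * (p ^ t - 1)) = y [^] (p * k + p * k * (p ^ t - 1))"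
      using y by (simp add: nat_pow_mult)
    also have "p * k + p * k * (p ^ t - 1) = p ^ t * (p * k)"
    proof -
      have "p ^ t \<noteq> 0" using p_ge_2 by simp
      then obtain q where "p ^ t = Suc q" using not0_implies_Suc by blast
      then show ?thesis by simp
    qed
    also have "y [^] (p ^ t * (p * k)) = \<one>" using y pow_order[OF y t] nat_pow_pow[OF y, of "p ^ t" "p * k"] by simp
    finally have inv: "z \<otimes> y [^] (p * k * (p ^ t - 1)) = \<one>" using k y by (simp add: nat_pow_pow)
    have "y [^] e = y \<otimes> y [^] (p * k * (p ^ t - 1))"
      unfolding e_def using y nat_pow_Suc2[OF y, of "p * k * (p ^ t - 1)"] by simp
    also have "\<dots> = m \<otimes> (z \<otimes> y [^] (p * k * (p ^ t - 1)))"
      using m_assoc[of m z "y [^] (p * k * (p ^ t - 1))"] mz(3)[symmetric] mc y k by simp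
    also have "\<dots> = m" using inv mc by simp
    finally have "y [^] e \<in> M" using mz by simp
    moreover have "coprime e p"
      unfolding e_def by (metis coprime_Suc_left_nat Suc_eq_plus1 coprime_mult_right_iff mult.assoc coprime_commute)
    ultimately have "y \<in> M" using pow_coprime_mem[OF M(1) y] by blast
    then have "y [^] p \<in> M" using M(1) by (induction p) (auto simp: subgroup.one_closed subgroup.m_closed)
    then show False using ny by simp
  qed
  ultimately show ?thesis using M by blast
qed

end

section \<open>Products of elements of bounded order\<close>

context group begin

lemma conj_pow:
  "g \<in> carrier G \<Longrightarrow> x \<in> carrier G \<Longrightarrow> (g \<otimes> x \<otimes> inv g) [^] (n::nat) = g \<otimes> x [^] n \<otimes> inv g"
  by (induction n) (simp_all add: word)

abbreviation gens :: "'a \<Rightarrow> 'a \<Rightarrow> bool" where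
  "gens x y \<equiv> x \<in> carrier G \<and> y \<in> carrier G \<and> generate G {x, y} = carrier G"

definition conj_class :: "'a \<Rightarrow> 'a set" where
  "conj_class c = {g \<otimes> c \<otimes> inv g | g. g \<in> carrier G}"

lemma conj_class_carrier: "c \<in> carrier G \<Longrightarrow> conj_class c \<subseteq> carrier G"
  by (auto simp: conj_class_def)

lemma normal_generate_conj_class:
  assumes "c \<in> carrier G" shows "generate G (conj_class c) \<lhd> G"
proof (rule normal_generate_conj[OF conj_class_carrier[OF assms]])
  fix g s assume g: "g \<in> carrier G" and "s \<in> conj_class c"
  then obtain h where h: "s = h \<otimes> c \<otimes> inv h" "h \<in> carrier G" by (auto simp: conj_class_def)
  then have "g \<otimes> s \<otimes> inv g = (g \<otimes> h) \<otimes> c \<otimes> inv (g \<otimes> h)" using g assms by (simp add: word)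
  then show "g \<otimes> s \<otimes> inv g \<in> generate G (conj_class c)"
    using g h by (intro generate.incl) (auto simp: conj_class_def)
qed

text \<open>Modulo the normal closure of [x, y] the generators commute, so the quotient is abelian.
  The passage from generators to arbitrary elements is made in one argument of the commutator at a
  time.\<close>

lemma derived_subset_conj_class:
  assumes "gens x y"
  shows "derived G (carrier G) \<subseteq> generate G (conj_class (cm G x y))"
proof -
  let ?N = "generate G (conj_class (cm G x y))"
  have c: "cm G x y \<in> carrier G" using assms by auto
  have N: "?N \<lhd> G" using c by (rule normal_generate_conj_class)
  have sN: "subgroup ?N G" using N by (rule normal_imp_subgroup)
  have "cm G x y = \<one> \<otimes> cm G x y \<otimes> inv \<one>" using c by simp
  then have "cm G x y \<in> conj_class (cm G x y)" unfolding conj_class_def by blast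
  then have xy: "cm G x y \<in> ?N" by (rule generate.incl)
  then have yx: "cm G y x \<in> ?N" using assms cm_swap[of x y] sN by (simp add: subgroup.m_inv_closed)
  have self: "cm G a a = \<one>" if "a \<in> carrier G" for a using that by (simp add: cm_def word)
  have base: "cm G s a \<in> ?N" if "s \<in> {x, y}" "a \<in> {x, y}" for s a
    using that xy yx self assms subgroup.one_closed[OF sN] by auto
  have 1: "cm G u a \<in> ?N" if "u \<in> carrier G" "a \<in> {x, y}" for u a
    using cent_mod_generate[OF N, of "{x, y}" "{x, y}" u a] base that assms by auto
  have 2: "cm G a u \<in> ?N" if "a \<in> {x, y}" "u \<in> carrier G" for u a
    using 1[OF that(2,1)] that assms cm_swap[of u a] sN by (auto simp: subgroup.m_inv_closed)
  have "cm G u v \<in> ?N" if "u \<in> carrier G" "v \<in> carrier G" for u v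
    using cent_mod_generate[OF N, of "carrier G" "{x, y}" u v] 2 that assms by auto
  then show ?thesis unfolding derived_eq_comm_sub by (intro comm_sub_least[OF sN])
qed

lemma generate_finite_pow_eq_one:
  assumes "finite (carrier G)" "S \<subseteq> carrier G" "\<And>s. s \<in> S \<Longrightarrow> s [^] (q::nat) = \<one>"
    and "\<And>a b. a \<in> generate G S \<Longrightarrow> b \<in> generate G S \<Longrightarrow> a [^] q = \<one> \<Longrightarrow> b [^] q = \<one> \<Longrightarrow> (a \<otimes> b) [^] q = \<one>"
    and "w \<in> generate G S"
  shows "w [^] q = \<one>"
  using assms(1,2,5) by (induction rule: generate_induct_finite) (use assms in auto)

end

context finite_p_group begin

lemma derived_exponent:
  assumes gen: "gens x y" and c: "cm G x y [^] (q::nat) = \<one>"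
    and closed: "\<And>a b. a \<in> derived G (carrier G) \<Longrightarrow> b \<in> derived G (carrier G) \<Longrightarrow>
      a [^] q = \<one> \<Longrightarrow> b [^] q = \<one> \<Longrightarrow> (a \<otimes> b) [^] q = \<one>"
    and w: "w \<in> derived G (carrier G)"
  shows "w [^] q = \<one>"
proof -
  let ?S = "conj_class (cm G x y)"
  have cc: "cm G x y \<in> carrier G" using gen by auto
  have DN: "derived G (carrier G) \<lhd> G" using gam_normal[of 2] by (simp add: gam_2)
  have "?S \<subseteq> derived G (carrier G)"
    using normal_conj[OF DN] cm_in_derived gen by (auto simp: conj_class_def)
  then have sub: "generate G ?S \<subseteq> derived G (carrier G)"
    using DN normal_imp_subgroup by (intro generate_subgroup_incl) auto
  show ?thesis
  proof (rule generate_finite_pow_eq_one[OF fin conj_class_carrier[OF cc]])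
    show "s [^] q = \<one>" if "s \<in> ?S" for s
      using that c cc by (auto simp: conj_class_def conj_pow)
    show "w \<in> generate G ?S" using w derived_subset_conj_class[OF gen] by auto
  qed (use closed sub in blast)
qed

lemma derived_psubset:
  assumes "carrier G \<noteq> {\<one>}" shows "derived G (carrier G) \<subset> carrier G"
  using comm_sub_psubset[OF normal_carrier assms] by (simp add: derived_eq_comm_sub)

text \<open>The case y = x of \<open>derived_subset_conj_class\<close>, where [x, x] is
  trivial.\<close>

lemma cyclic_derived_trivial:
  assumes "x \<in> carrier G" "generate G {x} = carrier G" shows "derived G (carrier G) = {\<one>}"
proof -
  have "gens x x" using assms by simp
  then have "derived G (carrier G) \<subseteq> generate G (conj_class (cm G x x))"
    by (rule derived_subset_conj_class)
  also have "conj_class (cm G x x) \<subseteq> {\<one>}"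
    using assms by (auto simp: conj_class_def cm_def word)
  then have "generate G (conj_class (cm G x x)) \<subseteq> {\<one>}"
    using triv_subgroup by (intro generate_subgroup_incl)
  finally show ?thesis
    using subgroup.one_closed[OF gam_subgroup[of 2]] by (auto simp: gam_2)
qed

text \<open>Induction on the order of \<open>H = \<langle>x, y\<rangle>\<close>: the commutator of \<open>x\<close> and \<open>y\<close> is a product of two
  conjugates of \<open>x\<close> and its inverse, which generate a proper subgroup of \<open>H\<close>.\<close>

lemma order_closed_criterion:
  assumes H: "\<And>x y. x \<in> carrier G \<Longrightarrow> y \<in> carrier G \<Longrightarrow> x [^] (q::nat) = \<one> \<Longrightarrow> y [^] q = \<one> \<Longrightarrow>
      (\<And>w. w \<in> derived G (generate G {x, y}) \<Longrightarrow> w [^] q = \<one>) \<Longrightarrow> (x \<otimes> y) [^] q = \<one>"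
  shows "x \<in> carrier G \<Longrightarrow> y \<in> carrier G \<Longrightarrow> x [^] q = \<one> \<Longrightarrow> y [^] q = \<one> \<Longrightarrow> (x \<otimes> y) [^] q = \<one>"
proof (induction "card (generate G {x, y})" arbitrary: x y rule: less_induct)
  case less
  let ?H = "generate G {x, y}" let ?GH = "G\<lparr>carrier := ?H\<rparr>"
  have xyH: "x \<in> ?H" "y \<in> ?H" by (auto intro: generate.incl)
  have sH: "subgroup ?H G" using less.prems by (intro generate_is_subgroup) auto
  interpret H: finite_p_group ?GH p using sH by (rule sub_finite_p_group)
  \<comment> \<open>The induction hypothesis in the form in which it is used: products inside a
    proper subgroup of \<open>?H\<close>.\<close>
  have smaller: "(a \<otimes> b) [^] q = \<one>"
    if "subgroup L G" "L \<subset> ?H" "a \<in> L" "b \<in> L" "a [^] q = \<one>" "b [^] q = \<one>" for a b L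
  proof (rule less.hyps)
    have ab: "generate G {a, b} \<subseteq> L" using that by (intro generate_subgroup_incl) auto
    then show "card (generate G {a, b}) < card ?H"
      using that finite_subgroup[OF sH] by (intro psubset_card_mono) auto
  qed (use that subgroup.mem_carrier[OF that(1)] in auto)
  have dH: "derived ?GH ?H = derived G ?H" using sH by (intro derived_consistent) auto
  show ?case
  proof (rule H[OF less.prems])
    fix w assume w: "w \<in> derived G ?H"
    have genH: "H.gens x y"
      using xyH generate_consistent[OF _ sH, of "{x, y}"] by auto
    have cm: "cm ?GH x y = cm G x y" using sH xyH by (rule subgroup_cm_consistent)
    have c: "cm G x y [^] q = \<one>"
    proof (cases "generate G {x} = ?H")
      case True
      have "derived ?GH ?H = {\<one>}"
        using H.cyclic_derived_trivial[of x] True xyH generate_consistent[OF _ sH, of "{x}"] by simp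
      then have "cm ?GH x y = \<one>" using H.cm_in_derived[of x ?H y] xyH by simp
      then show ?thesis using cm by simp
    next
      case False
      have sx: "subgroup (generate G {x}) G" using less.prems by (intro generate_is_subgroup) auto
      have "generate G {x} \<subseteq> ?H" by (rule mono_generate) auto
      then have sX: "subgroup (generate G {x}) ?GH" using sx sH by (intro subgroup_incl) auto
      \<comment> \<open>A maximal subgroup of \<open>?H\<close> through \<open>x\<close>. It
        contains the derived subgroup, hence also the conjugate of inv x by
        \<open>y\<close>.\<close>
      obtain M where M: "subgroup M ?GH" "generate G {x} \<subseteq> M" "M \<noteq> ?H" "derived ?GH ?H \<subseteq> M"
        using H.frattini[OF sX] False by auto
      have sM: "subgroup M G" using M(1) sH incl_subgroup by blast
      have MH: "M \<subset> ?H" using M subgroup.subset[OF M(1)] by auto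
      have xM: "x \<in> M" using M(2) by (auto intro: generate.incl)
      have "cm G y (inv x) \<in> M"
        using M(4) dH xyH sH cm_in_derived[of y ?H "inv x"] by (auto simp: subgroup.m_inv_closed)
      then have "y \<otimes> inv x \<otimes> inv y \<in> M"
        using conj_eq_cm[of y "inv x"] less.prems xM sM
        by (simp add: subgroup.m_closed subgroup.m_inv_closed)
      moreover have "(y \<otimes> inv x \<otimes> inv y) [^] q = \<one>"
        using less.prems conj_pow[of y "inv x" q] nat_pow_inv[of x q] by simp
      ultimately have "(x \<otimes> (y \<otimes> inv x \<otimes> inv y)) [^] q = \<one>"
        using smaller[OF sM MH xM] less.prems by simp
      then show ?thesis using less.prems by (simp add: cm_def word)
    qed
    show "w [^] q = \<one>"
    proof (cases "?H = {\<one>}")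
      case True
      then have "derived G ?H \<subseteq> {\<one>}" using derived_incl[OF _ sH] by simp
      then show ?thesis using w by auto
    next
      case False
      \<comment> \<open>The derived subgroup is proper in \<open>?H\<close>, so by induction its
        elements with trivial q-th power are closed under products, and
        \<open>derived_exponent\<close> spreads the triviality from [x, y] to all of it.\<close>
      have D: "derived G ?H \<subset> ?H" using H.derived_psubset False dH by simp
      have sD: "subgroup (derived G ?H) G"
        using derived_is_subgroup[OF subgroup.subset[OF sH]] .
      have "w [^]\<^bsub>?GH\<^esub> q = \<one>\<^bsub>?GH\<^esub>"
      proof (rule H.derived_exponent[OF genH])
        show "cm ?GH x y [^]\<^bsub>?GH\<^esub> q = \<one>\<^bsub>?GH\<^esub>" using c cm by (simp add: subgroup_nat_pow)
        show "w \<in> derived ?GH (carrier ?GH)" using w dH by simp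
      qed (use smaller[OF sD D] dH in \<open>auto simp: subgroup_nat_pow\<close>)
      then show ?thesis by (simp add: subgroup_nat_pow)
    qed
  qed
qed

text \<open>In the criterion p^k kills the derived subgroup of <x, y>, so the correcting factor in
  the definition of regularity is trivial. That definition speaks of exponents i >= 1, hence the
  separate case k = 0.\<close>

lemma regular_closed:
  assumes "regular_p_group p G" "x \<in> carrier G" "y \<in> carrier G" "x [^] (p ^ k) = \<one>" "y [^] (p ^ k) = \<one>"
  shows "(x \<otimes> y) [^] (p ^ k) = \<one>"
proof (rule order_closed_criterion[OF _ assms(2-5)])
  fix x y assume x: "x \<in> carrier G" and y: "y \<in> carrier G"
    and p: "x [^] (p ^ k) = \<one>" "y [^] (p ^ k) = \<one>"
    and D: "\<And>w. w \<in> derived G (generate G {x, y}) \<Longrightarrow> w [^] (p ^ k) = \<one>"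
  show "(x \<otimes> y) [^] (p ^ k) = \<one>"
  proof (cases "k = 0")
    case True then show ?thesis using x y p by simp
  next
    case False
    then obtain c where c: "c \<in> agemo G p k (derived G (generate G {x, y}))"
      and eq: "(x \<otimes> y) [^] (p ^ k) = x [^] (p ^ k) \<otimes> y [^] (p ^ k) \<otimes> c"
      using assms(1) x y unfolding regular_p_group_def by (metis One_nat_def Suc_leI neq0_conv)
    have "agemo G p k (derived G (generate G {x, y})) \<subseteq> {\<one>}"
      unfolding agemo_def using D triv_subgroup by (intro generate_subgroup_incl) auto
    then show ?thesis using c eq p by auto
  qed
qed

text \<open>Since i * (p^r choose i) = p^r * (p^r - 1 choose i - 1) and \<open>i\<close> is prime to
  \<open>p\<close>.\<close>

lemma prime_power_dvd_choose:
  assumes "1 \<le> i" "i < p" shows "p ^ r dvd (p ^ r choose i)"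
proof (cases "p ^ r")
  case 0 then show ?thesis using p_ge_2 by simp
next
  case (Suc n)
  obtain j where j: "i = Suc j" using assms by (cases i) auto
  have "Suc j * (Suc n choose Suc j) = (Suc n) * (n choose j)" by (rule Suc_times_binomial)
  then have "p ^ r dvd i * (p ^ r choose i)" unfolding j Suc by (metis dvd_triv_left)
  moreover have "coprime (p ^ r) i"
    using assms prime by (auto intro!: coprime_power_left_iff[THEN iffD2] prime_imp_coprime dest: dvd_imp_le)
  ultimately show ?thesis by (simp add: coprime_dvd_mult_right_iff)
qed

section \<open>Groups with derived subgroup of small class\<close>

lemma pow_dvd_eq_one: "x \<in> carrier G \<Longrightarrow> x [^] (m::nat) = \<one> \<Longrightarrow> m dvd n \<Longrightarrow> x [^] n = \<one>"
  using pow_eq_id dvd_trans by blast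

lemma filtered_gam: "filtered_group G gam"
  by (simp add: filtered_group_def filtered_group_axioms_def filtration_gam is_group)

text \<open>This sequence measures the failure of (x y)^n = x^n y^n. Being trivial at 0 and 1, it
  has an expansion that begins at i = 2, with coefficients in G'.\<close>

lemma poly_product_powers:
  assumes "x \<in> carrier G" "y \<in> carrier G"
  shows "filtered_group.poly G gam 0 (\<lambda>n. (x \<otimes> y) [^] n \<otimes> inv (y [^] n) \<otimes> inv (x [^] n))"
proof -
  interpret filtered_group G gam by (rule filtered_gam)
  show ?thesis using assms by (intro poly_mult poly_inv poly_pow) auto
qed

text \<open>For 2 <= i < p the coefficients of the expansion lie in G', which p^r kills, and p^r
  divides the binomial coefficients. The rest lies in \<open>gam p\<close>.\<close>

lemma small_class_product:
  assumes "x \<in> carrier G" "y \<in> carrier G" "x [^] (p ^ r) = \<one>" "y [^] (p ^ r) = \<one>"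
    and D: "\<And>w. w \<in> derived G (carrier G) \<Longrightarrow> w [^] (p ^ r) = \<one>" and cl: "gam p = {\<one>}"
  shows "(x \<otimes> y) [^] (p ^ r) = \<one>"
proof -
  interpret filtered_group G gam by (rule filtered_gam)
  let ?f = "\<lambda>n. (x \<otimes> y) [^] n \<otimes> inv (y [^] n) \<otimes> inv (x [^] n)"
  have "?f (p ^ r) \<in> {\<one>}"
  proof (rule hall_petrescu[OF poly_product_powers[OF assms(1,2)], of 2 p])
    fix j :: nat assume "j < 2"
    then have "j = 0 \<or> j = 1" by auto
    then show "?f j = \<one>" using assms(1,2) by (auto simp: word)
  next
    fix i c assume i: "2 \<le> i" "i < p" and "c \<in> gam (0 + i)"
    then have c: "c \<in> gam 2" using gam_mono[of 2 i] by auto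
    then have "c [^] (p ^ r) = \<one>" using D by (simp add: gam_2)
    then show "c [^] (p ^ r choose i) \<in> {\<one>}"
      using pow_dvd_eq_one[OF gam_carrier[OF c]] prime_power_dvd_choose[of i r] i by simp
  qed (use p_ge_2 triv_subgroup cl in auto)
  then show ?thesis using assms by simp
qed

text \<open>A commutator with an element of \<open>gam 2\<close> gains two steps, so the lower
  central series of \<open>H\<close> descends twice as fast as that of \<open>G\<close>.\<close>

lemma sub_gam_subset:
  assumes H: "subgroup H G" "H \<subseteq> gam 2" and "k \<ge> 1"
  shows "group.gam (G\<lparr>carrier := H\<rparr>) k \<subseteq> gam (2 * k)"
proof -
  interpret H: finite_p_group "G\<lparr>carrier := H\<rparr>" p using H(1) by (rule sub_finite_p_group)
  show ?thesis using assms(3)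
  proof (induction k rule: nat_induct_at_least)
    case base then show ?case using H by simp
  next
    case (Suc k)
    have "cm (G\<lparr>carrier := H\<rparr>) a b \<in> H \<inter> gam (2 * Suc k)"
      if a: "a \<in> H.gam k" and b: "b \<in> H" for a b
    proof -
      have aH: "a \<in> H" using a H.gam_carrier by auto
      have "cm G a b \<in> gam (2 * k + 2)" using a b Suc H by (intro gam_cm) auto
      then show ?thesis using subgroup_cm_consistent[OF H(1) aH b] subgroup_cm[OF H(1) aH b] by simp
    qed
    moreover have "subgroup (H \<inter> gam (2 * Suc k)) (G\<lparr>carrier := H\<rparr>)"
      using H(1) gam_subgroup subgroups_Inter_pair by (intro subgroup_incl) auto
    ultimately have "H.comm_sub (H.gam k) H \<subseteq> H \<inter> gam (2 * Suc k)"
      by (intro H.comm_sub_least)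
    then show ?case using H.gam_Suc[OF Suc.hyps] by simp
  qed
qed

text \<open>By \<open>sub_gam_subset\<close> the bound 2 p makes the p-th lower central term of
  every subgroup of G' trivial, as \<open>small_class_product\<close> requires inside the
  criterion.\<close>

lemma derived_closed_of_class:
  assumes cl: "gam (2 * p) = {\<one>}"
    and a: "a \<in> derived G (carrier G)" "b \<in> derived G (carrier G)" "a [^] (p ^ r) = \<one>" "b [^] (p ^ r) = \<one>"
  shows "(a \<otimes> b) [^] (p ^ r) = \<one>"
proof -
  let ?D = "derived G (carrier G)" let ?GD = "G\<lparr>carrier := ?D\<rparr>"
  have sD: "subgroup ?D G" using gam_subgroup[of 2] by (simp add: gam_2)
  interpret D: finite_p_group ?GD p using sD by (rule sub_finite_p_group)
  have "(a \<otimes>\<^bsub>?GD\<^esub> b) [^]\<^bsub>?GD\<^esub> (p ^ r) = \<one>\<^bsub>?GD\<^esub>"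
  proof (rule D.order_closed_criterion)
    fix x y assume xy: "x \<in> carrier ?GD" "y \<in> carrier ?GD" "x [^]\<^bsub>?GD\<^esub> (p ^ r) = \<one>\<^bsub>?GD\<^esub>"
      "y [^]\<^bsub>?GD\<^esub> (p ^ r) = \<one>\<^bsub>?GD\<^esub>"
      and w: "\<And>w. w \<in> derived ?GD (generate ?GD {x, y}) \<Longrightarrow> w [^]\<^bsub>?GD\<^esub> (p ^ r) = \<one>\<^bsub>?GD\<^esub>"
    let ?H = "generate G {x, y}" let ?GH = "G\<lparr>carrier := ?H\<rparr>"
    have gH: "generate ?GD {x, y} = ?H" using xy sD by (intro generate_consistent) auto
    have sH: "subgroup ?H G" using xy subgroup.subset[OF sD] by (intro generate_is_subgroup) auto
    have HD: "?H \<subseteq> ?D" using xy sD by (intro generate_subgroup_incl) auto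
    interpret H: finite_p_group ?GH p using sH by (rule sub_finite_p_group)
    have dH: "derived ?GD ?H = derived G ?H" "derived ?GH ?H = derived G ?H"
      using derived_consistent[OF HD sD] derived_consistent[OF order.refl sH] by simp_all
    have "(x \<otimes>\<^bsub>?GH\<^esub> y) [^]\<^bsub>?GH\<^esub> (p ^ r) = \<one>\<^bsub>?GH\<^esub>"
    proof (rule H.small_class_product)
      have "H.gam p \<subseteq> gam (2 * p)" using HD p_ge_2 by (intro sub_gam_subset[OF sH]) (auto simp: gam_2)
      then show "H.gam p = {\<one>\<^bsub>?GH\<^esub>}"
        using cl subgroup.one_closed[OF H.gam_subgroup[of p]] by auto
      fix w' assume "w' \<in> derived ?GH (carrier ?GH)"
      then show "w' [^]\<^bsub>?GH\<^esub> (p ^ r) = \<one>\<^bsub>?GH\<^esub>"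
        using w[of w'] gH dH by (simp add: subgroup_nat_pow)
    qed (use xy in \<open>auto simp: subgroup_nat_pow intro: generate.incl\<close>)
    then show "(x \<otimes>\<^bsub>?GD\<^esub> y) [^]\<^bsub>?GD\<^esub> (p ^ r) = \<one>\<^bsub>?GD\<^esub>" by (simp add: subgroup_nat_pow)
  qed (use a in \<open>auto simp: subgroup_nat_pow\<close>)
  then show ?thesis by (simp add: subgroup_nat_pow)
qed

text \<open>For \<open>x\<close> outside G' there is the chain G' < G' <x> <= M < G: as G' is
  nontrivial, \<open>G\<close> is not cyclic, so <x> lies in a maximal subgroup \<open>M\<close>,
  and that contains G'.\<close>

lemma derived_index:
  assumes nt: "derived G (carrier G) \<noteq> {\<one>}"
  shows "p ^ 2 * card (derived G (carrier G)) dvd order G"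
proof -
  let ?D = "derived G (carrier G)"
  have DN: "?D \<lhd> G" using gam_normal[of 2] by (simp add: gam_2)
  have sD: "subgroup ?D G" using DN by (rule normal_imp_subgroup)
  have "carrier G \<noteq> {\<one>}" using nt subgroup.subset[OF sD] subgroup.one_closed[OF sD] by auto
  then obtain x where x: "x \<in> carrier G" "x \<notin> ?D" using derived_psubset by auto
  let ?X = "generate G {x}" let ?L = "?D <#> ?X"
  have sX: "subgroup ?X G" using x by (intro generate_is_subgroup) auto
  have sL: "subgroup ?L G" by (rule mult_norm_subgroup[OF DN sX])
  have "x \<in> ?X" by (auto intro: generate.incl)
  then have DL: "?D \<subset> ?L" using subset_set_mult[OF sD sX] x by auto
  have "?X \<noteq> carrier G" using cyclic_derived_trivial[OF x(1)] nt by auto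
  then obtain M where M: "subgroup M G" "?X \<subseteq> M" "M \<noteq> carrier G" "?D \<subseteq> M"
    using frattini[OF sX] by auto
  have "?L \<subseteq> M" using M by (intro set_mult_least)
  then have LG: "?L \<subset> carrier G" using M subgroup.subset[OF M(1)] by auto
  have "p * card ?L dvd order G" unfolding order_def by (rule card_subgroup_dvd[OF sL subgroup_self LG])
  moreover have "p * card ?D dvd card ?L" by (rule card_subgroup_dvd[OF sD sL DL])
  ultimately have "p * (p * card ?D) dvd order G" by (meson dvd_trans dvd_refl mult_dvd_mono)
  then show ?thesis by (simp add: power2_eq_square mult.assoc)
qed

lemma gam_index:
  assumes "k \<ge> 2" "gam k \<noteq> {\<one>}" shows "p ^ k * card (gam k) dvd order G"
  using assms
proof (induction k rule: nat_induct_at_least)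
  case base then show ?case using derived_index by (simp add: gam_2)
next
  case (Suc k)
  have "gam k \<noteq> {\<one>}"
    using Suc.prems gam_Suc_subset[of k] subgroup.one_closed[OF gam_subgroup[of "Suc k"]] by auto
  then have 1: "p ^ k * card (gam k) dvd order G" and "gam (Suc k) \<subset> gam k"
    using Suc gam_psubset by auto
  then have "p * card (gam (Suc k)) dvd card (gam k)"
    by (intro card_subgroup_dvd gam_subgroup)
  then have "p ^ k * (p * card (gam (Suc k))) dvd p ^ k * card (gam k)"
    by (intro mult_dvd_mono dvd_refl)
  then have "p ^ k * (p * card (gam (Suc k))) dvd order G" using 1 by (rule dvd_trans)
  then show ?case by (simp add: mult.assoc mult.left_commute)
qed

lemma gam_trivial_of_order:
  assumes "order G \<le> p ^ k" "k \<ge> 2" shows "gam k = {\<one>}"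
proof (rule ccontr)
  assume nt: "gam k \<noteq> {\<one>}"
  then have "{\<one>} \<subset> gam k" using subgroup.one_closed[OF gam_subgroup[of k]] by auto
  then have "1 < card (gam k)"
    using psubset_card_mono[OF finite_subgroup[OF gam_subgroup[of k]], of "{\<one>}"] by simp
  moreover have "p ^ k * card (gam k) \<le> order G"
    using gam_index[OF assms(2) nt] fin order_gt_0_iff_finite by (intro dvd_imp_le) auto
  moreover have "0 < p ^ k" using p_ge_2 by simp
  ultimately have "p ^ k * 1 < order G" by (metis less_le_trans mult_less_mono2)
  then show False using assms by simp
qed

lemma nilpotency_class_gam: "gam (Suc (nilpotency_class G)) = {\<one>}"
proof -
  obtain k where "k \<ge> 1" "gam k = {\<one>}" using gam_eq_one_exists by blast
  then have "lower_central G (k - 1) = {\<one>}" by (simp add: gam_def)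
  then have "lower_central G (nilpotency_class G) = {\<one>}" unfolding nilpotency_class_def by (rule LeastI)
  then show ?thesis by (simp add: gam_def)
qed

lemma gam_trivial_mono:
  assumes "gam i = {\<one>}" "i \<le> j" shows "gam j = {\<one>}"
  using gam_mono[OF assms(2)] assms(1) subgroup.one_closed[OF gam_subgroup[of j]] by auto

text \<open>Applied to the section \<open>G Mod {\<one>}\<close>, whose elements are the singletons.
  Orders are powers of \<open>p\<close>, so an order of at most p^k divides p^k.\<close>

lemma order_closed_closed:
  assumes "order_closed p G" "x \<in> carrier G" "y \<in> carrier G" "x [^] (p ^ k) = \<one>" "y [^] (p ^ k) = \<one>"
  shows "(x \<otimes> y) [^] (p ^ k) = \<one>"
proof -
  have N: "{\<one>} \<lhd> G" by (rule one_is_normal)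
  interpret N: normal "{\<one>}" G by (rule N)
  let ?Q = "G Mod {\<one>}"
  interpret Q: group ?Q by (rule N.factorgroup_is_group)
  have "{\<one>} \<lhd> (G\<lparr>carrier := carrier G\<rparr>)" using N by simp
  then have w: "weakly_order_closed p ?Q"
    using assms(1) subgroup_self unfolding order_closed_def by fastforce
  have car: "{g} \<in> carrier ?Q" if "g \<in> carrier G" for g
    using that by (auto simp: carrier_FactGroup r_coset_def image_iff)
  have ord: "Q.ord {g} = ord g" if g: "g \<in> carrier G" for g
  proof (rule dvd_antisym)
    have pw: "{g} [^]\<^bsub>?Q\<^esub> n = {g [^] n}" for n :: nat
      by (induction n) (use g in \<open>auto simp: set_mult_def\<close>)
    show "Q.ord {g} dvd ord g" using Q.pow_eq_id[OF car[OF g], of "ord g"] pw g by simp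
    have "{g [^] Q.ord {g}} = {\<one>}" using Q.pow_ord_eq_1[OF car[OF g]] pw by simp
    then show "ord g dvd Q.ord {g}" using pow_eq_id[OF g, of "Q.ord {g}"] by simp
  qed
  have "ord g \<le> p ^ k" if "g \<in> carrier G" "g [^] (p ^ k) = \<one>" for g
    using that pow_eq_id[OF that(1)] p_ge_2 by (intro dvd_imp_le) auto
  then have "Q.ord ({x} \<otimes>\<^bsub>?Q\<^esub> {y}) \<le> p ^ k"
    using w assms ord car unfolding weakly_order_closed_def by simp
  moreover have "{x} \<otimes>\<^bsub>?Q\<^esub> {y} = {x \<otimes> y}" by (auto simp: set_mult_def)
  ultimately have le: "ord (x \<otimes> y) \<le> p ^ k" using ord assms by simp
  obtain j where j: "ord (x \<otimes> y) = p ^ j" using ord_p_power[of "x \<otimes> y"] assms by auto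
  then have "j \<le> k" using le p_ge_2 by (simp add: power_increasing_iff)
  then have "ord (x \<otimes> y) dvd p ^ k" using j by (simp add: le_imp_power_dvd)
  then show ?thesis using pow_eq_id[of "x \<otimes> y"] assms by simp
qed

end

section \<open>Powerful groups\<close>

context group begin

lemma comm_sub_mono: "A \<subseteq> A' \<Longrightarrow> comm_sub A B \<subseteq> comm_sub A' B"
  unfolding comm_sub_def by (intro mono_generate) blast

lemma agemo_subgroup: "H \<subseteq> carrier G \<Longrightarrow> subgroup (agemo G p i H) G"
  unfolding agemo_def by (intro generate_is_subgroup) auto

lemma agemo_mem: "h \<in> H \<Longrightarrow> h [^] (p ^ i) \<in> agemo G p i H"
  unfolding agemo_def by (intro generate.incl) auto

lemma agemo_normal: assumes "H \<lhd> G" shows "agemo G p i H \<lhd> G"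
  unfolding agemo_def
proof (rule normal_generate_conj)
  have HG: "H \<subseteq> carrier G" using assms normal_imp_subgroup subgroup.subset by blast
  then show "(\<lambda>h. h [^] (p ^ i)) ` H \<subseteq> carrier G" by auto
  fix g s assume g: "g \<in> carrier G" and "s \<in> (\<lambda>h. h [^] (p ^ i)) ` H"
  then obtain h where h: "h \<in> H" "s = h [^] (p ^ i)" by auto
  then have "g \<otimes> s \<otimes> inv g = (g \<otimes> h \<otimes> inv g) [^] (p ^ i)" using g HG by (auto simp: conj_pow)
  then show "g \<otimes> s \<otimes> inv g \<in> generate G ((\<lambda>h. h [^] (p ^ i)) ` H)"
    using normal_conj[OF assms g h(1)] by (auto intro!: generate.incl)
qed

lemma agemo_least:
  assumes "subgroup K G" "\<And>h. h \<in> H \<Longrightarrow> h [^] (p ^ i) \<in> K" shows "agemo G p i H \<subseteq> K"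
  unfolding agemo_def using assms by (intro generate_subgroup_incl) auto

lemma agemo_mono: "H \<subseteq> K \<Longrightarrow> agemo G p i H \<subseteq> agemo G p i K"
  unfolding agemo_def by (intro mono_generate) auto

lemma subgroup_pow: "subgroup H G \<Longrightarrow> h \<in> H \<Longrightarrow> h [^] (n::nat) \<in> H"
  by (induction n) (auto simp: subgroup.one_closed subgroup.m_closed)

lemma agemo_pow_dvd:
  assumes "H \<subseteq> carrier G" "h \<in> H" "p ^ i dvd n"
  shows "h [^] n \<in> agemo G p i H"
proof -
  obtain m where "n = p ^ i * m" using assms(3) by (auto simp: dvd_def)
  then have "h [^] n = (h [^] (p ^ i)) [^] m" using assms by (auto simp: nat_pow_pow)
  then show ?thesis using agemo_mem[OF assms(2)] agemo_subgroup[OF assms(1)] subgroup_pow by metis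
qed

lemma agemo_consistent:
  assumes "subgroup H G" "K \<subseteq> H"
  shows "agemo (G\<lparr>carrier := H\<rparr>) p i K = agemo G p i K"
proof -
  have "(\<lambda>h. h [^]\<^bsub>G\<lparr>carrier := H\<rparr>\<^esub> (p ^ i)) ` K = (\<lambda>h. h [^] (p ^ i)) ` K"
    by (simp add: subgroup_nat_pow)
  moreover have "generate (G\<lparr>carrier := H\<rparr>) ((\<lambda>h. h [^] (p ^ i)) ` K) = generate G ((\<lambda>h. h [^] (p ^ i)) ` K)"
    using assms subgroup_pow[OF assms(1)] by (intro generate_consistent) auto
  ultimately show ?thesis by (simp add: agemo_def)
qed

end

text \<open>In the definition of a powerful group the exponent \<open>p\<close> is replaced by \<open>4\<close> if \<open>p = 2\<close>.\<close>

definition pow_exp :: "nat \<Rightarrow> nat" where "pow_exp p = (if p = 2 then 2 else 1)"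

context finite_p_group begin

text \<open>As a function of n, [x^n, y] has degree 1 and is trivial at 0, so its i-th coefficient
  lies in \<open>gam (Suc i)\<close>.\<close>

lemma cm_pow_mem:
  assumes N: "subgroup N G" and x: "x \<in> carrier G" and y: "y \<in> carrier G"
    and "1 \<le> m" "\<And>i c. 1 \<le> i \<Longrightarrow> i < m \<Longrightarrow> c \<in> gam (Suc i) \<Longrightarrow> c [^] (q choose i) \<in> N"
    and "gam (Suc m) \<subseteq> N"
  shows "cm G (x [^] q) y \<in> N"
proof -
  interpret filtered_group G gam by (rule filtered_gam)
  have "poly (0 + 1) (\<lambda>n. cm G (x [^] n) y)"
    using x y by (intro poly_cm poly_pow poly_const) auto
  then have f: "poly 1 (\<lambda>n. cm G (x [^] n) y)" by simp
  show ?thesis by (rule hall_petrescu[OF f, of 1 m]) (use assms in auto)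
qed

lemma cm_agemo_mem:
  assumes N: "N \<lhd> G" and "\<And>x y. x \<in> carrier G \<Longrightarrow> y \<in> carrier G \<Longrightarrow> cm G (x [^] (p ^ i)) y \<in> N"
    and w: "w \<in> agemo G p i (carrier G)" and y: "y \<in> carrier G"
  shows "cm G w y \<in> N"
  using w unfolding agemo_def
  by (rule cent_mod_generate[OF N order.refl _ _ _ y, rotated -1]) (use assms in auto)

lemma powerful_iff: "powerful_p_group p G \<longleftrightarrow> derived G (carrier G) \<subseteq> agemo G p (pow_exp p) (carrier G)"
  using prime prime_odd_nat[of p] p_ge_2 by (auto simp: powerful_p_group_def pow_exp_def)

text \<open>For p = 2 the binomial coefficients are 4 and 6; for odd \<open>p\<close> the bound
  gives i < p.\<close>

lemma dvd_choose:
  assumes "1 \<le> i" "i < 3" shows "p dvd (p ^ pow_exp p choose i)"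
proof (cases "p = 2")
  case True
  have "(4::nat) choose 2 = 6" by (simp add: numeral_eq_Suc)
  moreover have "i = 1 \<or> i = 2" using assms by auto
  ultimately show ?thesis using True assms by (auto simp: pow_exp_def)
next
  case False
  then have "p ^ 1 dvd (p ^ 1 choose i)" using assms p_ge_2 by (intro prime_power_dvd_choose) auto
  then show ?thesis using False by (simp add: pow_exp_def)
qed

text \<open>As G' is contained in a subgroup generated by powers x^q, [G', G] is controlled by the
  commutators [x^q, y]. These lie in \<open>?N\<close> up to an error in \<open>gam 4\<close> =
  [gam 3, G], which \<open>subset_mod_comm_sub\<close> removes.\<close>

lemma powerful_gam3:
  assumes pw: "powerful_p_group p G" shows "gam 3 \<subseteq> agemo G p 1 (gam 2)"
proof -
  let ?N = "agemo G p 1 (gam 2)" let ?K = "?N <#> gam 4"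
  have N: "?N \<lhd> G" using gam_normal by (rule agemo_normal)
  have K: "?K \<lhd> G" using N gam_normal by (rule set_mult_normal)
  have sK: "subgroup ?K G" using K by (rule normal_imp_subgroup)
  have NK: "?N \<subseteq> ?K" "gam 4 \<subseteq> ?K"
    using subset_set_mult[OF normal_imp_subgroup[OF N] gam_subgroup] by auto
  have "cm G (x [^] (p ^ pow_exp p)) y \<in> ?K" if "x \<in> carrier G" "y \<in> carrier G" for x y
  proof (rule cm_pow_mem[OF sK that, of 3])
    fix i c assume i: "1 \<le> i" "i < 3" and c: "c \<in> gam (Suc i)"
    have "c \<in> gam 2" using c i gam_mono[of 2 "Suc i"] by auto
    then have "c [^] (p ^ pow_exp p choose i) \<in> ?N"
      using dvd_choose[OF i] gam_carrier by (intro agemo_pow_dvd) auto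
    then show "c [^] (p ^ pow_exp p choose i) \<in> ?K" using NK by auto
  qed (use NK in \<open>simp_all add: numeral_eq_Suc\<close>)
  then have 1: "cm G w y \<in> ?K" if "w \<in> agemo G p (pow_exp p) (carrier G)" "y \<in> carrier G" for w y
    using cm_agemo_mem[OF K _ that] by blast
  have g3: "gam 3 = comm_sub (gam 2) (carrier G)" and g4: "gam 4 = comm_sub (gam 3) (carrier G)"
    using gam_Suc[of 2] gam_Suc[of 3] by (simp_all add: numeral_eq_Suc)
  have "gam 3 \<subseteq> ?K" unfolding g3
    using 1 pw by (intro comm_sub_least[OF sK]) (auto simp: powerful_iff gam_2)
  then show ?thesis using g4 subset_mod_comm_sub[OF N gam_normal[of 3]] by simp
qed

text \<open>Otherwise a maximal subgroup of G' through [x, y] contains the p-th powers of G', hence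
  \<open>gam 3\<close>, hence every conjugate of [x, y], and these generate G'.\<close>

lemma powerful_derived_cyclic:
  assumes pw: "powerful_p_group p G" and gen: "gens x y"
  shows "derived G (carrier G) = generate G {cm G x y}"
proof -
  let ?D = "derived G (carrier G)" let ?GD = "G\<lparr>carrier := ?D\<rparr>" let ?c = "cm G x y"
  let ?C = "generate G {?c}"
  have sD: "subgroup ?D G" using gam_subgroup[of 2] by (simp add: gam_2)
  have cD: "?c \<in> ?D" using gen by (intro cm_in_derived) auto
  have cG: "?c \<in> carrier G" using gen by auto
  have sC: "subgroup ?C G" using cG by (intro generate_is_subgroup) auto
  have CD: "?C \<subseteq> ?D" using cD sD by (intro generate_subgroup_incl) auto
  interpret D: finite_p_group ?GD p using sD by (rule sub_finite_p_group)
  show ?thesis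
  proof (rule ccontr)
    assume "?D \<noteq> ?C"
    then obtain M where M: "subgroup M ?GD" "?C \<subseteq> M" "M \<noteq> ?D" "\<forall>x\<in>?D. x [^] p \<in> M"
      using D.frattini[of ?C] subgroup_incl[OF sC sD CD] by (auto simp: subgroup_nat_pow)
    have sM: "subgroup M G" using M(1) sD incl_subgroup by blast
    have "gam 3 \<subseteq> agemo G p 1 ?D" using powerful_gam3[OF pw] by (simp add: gam_2)
    also have "\<dots> \<subseteq> M" using M(4) by (intro agemo_least[OF sM]) simp
    finally have g3: "gam 3 \<subseteq> M" .
    have "conj_class ?c \<subseteq> M"
    proof
      fix s assume "s \<in> conj_class ?c"
      then obtain g where g: "g \<in> carrier G" "s = g \<otimes> ?c \<otimes> inv g" by (auto simp: conj_class_def)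
      have "?c \<in> gam 2" using cD by (simp add: gam_2)
      then have "cm G ?c g \<in> gam 3" using gam_Suc_cm[of ?c 2 g] g by (simp add: eval_nat_numeral)
      then have "cm G g ?c \<in> M" using g3 cm_swap[OF cG g(1)] sM by (auto simp: subgroup.m_inv_closed)
      moreover have "?c \<in> M" using M(2) by (auto intro: generate.incl)
      ultimately show "s \<in> M" using g cG sM by (simp add: conj_eq_cm subgroup.m_closed)
    qed
    then have "generate G (conj_class ?c) \<subseteq> M" using sM by (intro generate_subgroup_incl)
    then have "?D \<subseteq> M" using derived_subset_conj_class[OF gen] by auto
    then show False using M subgroup.subset[OF M(1)] by auto
  qed
qed

text \<open>Fourth powers are needed where \<open>powerful_gam3\<close> yields squares. The
  coefficient (4 choose 1) = 4 produces them, but (4 choose 2) = 6 produces only squares of elements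
  of \<open>gam 3\<close>, collected in \<open>?S\<close>.\<close>

lemma powerful_2_gam3:
  assumes pw: "powerful_p_group p G" and p2: "p = 2"
  shows "gam 3 \<subseteq> agemo G 2 2 (gam 2)"
proof -
  let ?W = "agemo G 2 2 (gam 2)" let ?S = "agemo G 2 1 (gam 3)" let ?K1 = "?W <#> ?S"
  let ?K = "?K1 <#> gam 4"
  have W: "?W \<lhd> G" and S: "?S \<lhd> G" using gam_normal by (auto intro: agemo_normal)
  have K1: "?K1 \<lhd> G" using W S by (rule set_mult_normal)
  have sW: "subgroup ?W G" and sK1: "subgroup ?K1 G" using W K1 normal_imp_subgroup by auto
  have K: "?K \<lhd> G" using K1 gam_normal by (rule set_mult_normal)
  have sK: "subgroup ?K G" using K by (rule normal_imp_subgroup)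
  have K1K: "?K1 \<subseteq> ?K" "gam 4 \<subseteq> ?K" using subset_set_mult[OF sK1 gam_subgroup] by auto
  have WK: "?W \<subseteq> ?K1" "?S \<subseteq> ?K1" using subset_set_mult[OF sW normal_imp_subgroup[OF S]] by auto
  have "cm G (x [^] (p ^ pow_exp p)) y \<in> ?K" if "x \<in> carrier G" "y \<in> carrier G" for x y
  proof (rule cm_pow_mem[OF sK that, of 3])
    have ch: "(4::nat) choose 2 = 6" "p ^ pow_exp p = 4" by (simp_all add: numeral_eq_Suc p2 pow_exp_def)
    fix i c assume i: "1 \<le> i" "i < 3" and c: "c \<in> gam (Suc i)"
    then consider "i = 1" | "i = 2" by linarith
    then show "c [^] (p ^ pow_exp p choose i) \<in> ?K"
    proof cases
      case 1
      have "c \<in> gam 2" using 1 c by (simp add: numeral_2_eq_2)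
      then have "c [^] (4::nat) \<in> ?W" using gam_carrier by (intro agemo_pow_dvd) auto
      then show ?thesis using 1 WK K1K ch by auto
    next
      case 2
      have "c \<in> gam 3" using 2 c by (simp add: eval_nat_numeral)
      then have "c [^] (6::nat) \<in> ?S" using gam_carrier by (intro agemo_pow_dvd) auto
      then show ?thesis using 2 WK K1K ch by auto
    qed
  qed (use K1K in \<open>simp_all add: numeral_eq_Suc\<close>)
  then have 1: "cm G w y \<in> ?K" if "w \<in> agemo G p (pow_exp p) (carrier G)" "y \<in> carrier G" for w y
    using cm_agemo_mem[OF K _ that] by blast
  have g3: "gam 3 = comm_sub (gam 2) (carrier G)" and g4: "gam 4 = comm_sub (gam 3) (carrier G)"
    using gam_Suc[of 2] gam_Suc[of 3] by (simp_all add: numeral_eq_Suc)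
  have "comm_sub (gam 2) (carrier G) \<subseteq> ?K"
    using 1 pw by (intro comm_sub_least[OF sK]) (auto simp: powerful_iff gam_2)
  then have "gam 3 \<subseteq> ?K" by (simp only: g3)
  then have 3: "gam 3 \<subseteq> ?K1" using g4 subset_mod_comm_sub[OF K1 gam_normal[of 3]] by simp
  \<comment> \<open>The squares in \<open>?S\<close> are removed by a Frattini argument: a maximal
    subgroup of \<open>?L\<close> that contains \<open>?W\<close> contains all squares from
    \<open>?L\<close>, thus \<open>?S\<close>, thus \<open>gam 3\<close>.\<close>
  let ?L = "?W <#> gam 3" let ?GL = "G\<lparr>carrier := ?L\<rparr>"
  have sL: "subgroup ?L G" using W gam_subgroup by (rule mult_norm_subgroup)
  have WL: "?W \<subseteq> ?L" "gam 3 \<subseteq> ?L" using subset_set_mult[OF sW gam_subgroup] by auto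
  interpret L: finite_p_group ?GL p using sL by (rule sub_finite_p_group)
  have "?W = ?L"
  proof (rule ccontr)
    assume "?W \<noteq> ?L"
    then obtain M where M: "subgroup M ?GL" "?W \<subseteq> M" "M \<noteq> ?L" "\<forall>x\<in>?L. x [^] p \<in> M"
      using L.frattini[of ?W] subgroup_incl[OF sW sL WL(1)] by (auto simp: subgroup_nat_pow)
    have sM: "subgroup M G" using M(1) sL incl_subgroup by blast
    have "?S \<subseteq> M" using M(4) WL p2 by (intro agemo_least[OF sM]) auto
    then have "gam 3 \<subseteq> M" using 3 set_mult_least[OF sM M(2)] by auto
    then have "?L \<subseteq> M" by (intro set_mult_least[OF sM M(2)])
    then show False using M subgroup.subset[OF M(1)] by auto
  qed
  then show ?thesis using WL by simp
qed

text \<open>The subgroup generated by squares is powerfully embedded. Commutators with fourth powers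
  are treated before those with squares: G' lies in the subgroup \<open>?L\<close> of fourth powers,
  and [x^2, y] involves the squares of elements of G'.\<close>

lemma powerful_2_embedded:
  assumes pw: "powerful_p_group p G" and p2: "p = 2"
    and w: "w \<in> agemo G 2 1 (carrier G)" and y: "y \<in> carrier G"
  shows "cm G w y \<in> agemo G 2 2 (agemo G 2 1 (carrier G))"
proof -
  let ?M = "agemo G 2 1 (carrier G)" let ?N = "agemo G 2 2 ?M" let ?L = "agemo G 2 2 (carrier G)"
  have M: "?M \<lhd> G" and N: "?N \<lhd> G" using normal_carrier by (auto intro!: agemo_normal)
  have sM: "subgroup ?M G" and sN: "subgroup ?N G" using M N normal_imp_subgroup by auto
  have LM: "?L \<subseteq> ?M" by (rule agemo_least[OF sM]) (auto intro: agemo_pow_dvd)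
  have sL: "subgroup ?L G" by (intro agemo_subgroup) auto
  have g2L: "gam 2 \<subseteq> ?L" using pw[unfolded powerful_iff] p2 by (simp add: gam_2 pow_exp_def)
  have WN: "agemo G 2 2 (gam 2) \<subseteq> ?N" using g2L LM by (intro agemo_mono) auto
  then have g3: "gam 3 \<subseteq> ?N" using powerful_2_gam3[OF pw p2] by auto
  have 4: "cm G (x [^] (p ^ 2)) y \<in> ?N" if "x \<in> carrier G" "y \<in> carrier G" for x y
  proof (rule cm_pow_mem[OF sN that, of 2])
    fix i c assume i': "1 \<le> i" "i < 2" and c: "c \<in> gam (Suc i)"
    from i' have "i = 1" by linarith
    then have i: "i = 1" "c \<in> gam 2" using c by (auto simp: numeral_2_eq_2)
    then have "c [^] (2 ^ 2::nat) \<in> agemo G 2 2 (gam 2)" by (intro agemo_mem)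
    then show "c [^] (p ^ 2 choose i) \<in> ?N" using i WN p2 by auto
  qed (use g3 in \<open>simp_all add: numeral_eq_Suc\<close>)
  have cL: "cm G u y \<in> ?N" if "u \<in> ?L" "y \<in> carrier G" for u y
    using cm_agemo_mem[OF N 4, of u y] that p2 by simp
  have LG: "(\<lambda>h. h [^] (2 ^ 2::nat)) ` carrier G \<subseteq> carrier G" by auto
  \<comment> \<open>A generator x^4 has the square (x^2)^4, and (a b)^2 differs from a^2 b^2 by a
    conjugate of [b, a], which lies in \<open>?N\<close> by \<open>cL\<close>.\<close>
  have sq: "u [^] (2::nat) \<in> ?N" if "u \<in> ?L" for u
    using fin LG that[unfolded agemo_def]
  proof (induction rule: generate_induct_finite)
    case one then show ?case using subgroup.one_closed[OF sN] by simp
  next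
    case (incl s)
    then obtain x where x: "x \<in> carrier G" "s = x [^] (2 ^ 2::nat)" by auto
    have "(x [^] (2 ^ 1::nat)) [^] (2 ^ 2::nat) \<in> ?N" using x by (intro agemo_mem)
    then show ?case using x by (simp add: nat_pow_pow)
  next
    case (mult a b)
    have ab: "a \<in> carrier G" "b \<in> carrier G"
      using mult(1,2) subgroup.subset[OF sL] by (auto simp: agemo_def)
    have "cm G b a \<in> ?N" using cL mult(2) ab by (simp add: agemo_def)
    then have "(a \<otimes> cm G b a \<otimes> inv a) \<otimes> (a [^] (2::nat) \<otimes> b [^] (2::nat)) \<in> ?N"
      using mult(3,4) N sN ab by (intro subgroup.m_closed normal_conj) auto
    also have "(a \<otimes> cm G b a \<otimes> inv a) \<otimes> (a [^] (2::nat) \<otimes> b [^] (2::nat)) = (a \<otimes> b) [^] (2::nat)"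
      using ab by (simp add: cm_def word numeral_2_eq_2)
    finally show ?case .
  qed
  have 2: "cm G (x [^] (p ^ 1)) y \<in> ?N" if "x \<in> carrier G" "y \<in> carrier G" for x y
  proof (rule cm_pow_mem[OF sN that, of 2])
    fix i c assume i': "1 \<le> i" "i < 2" and c: "c \<in> gam (Suc i)"
    from i' have "i = 1" by linarith
    then have i: "i = 1" "c \<in> gam 2" using c by (auto simp: numeral_2_eq_2)
    then show "c [^] (p ^ 1 choose i) \<in> ?N" using sq g2L p2 by auto
  qed (use g3 in \<open>simp_all add: numeral_eq_Suc\<close>)
  show ?thesis using cm_agemo_mem[OF N 2, of w y] w y p2 by simp
qed

text \<open>For odd \<open>p\<close> one gets [M, G] <= N [M, G, G]: the error is in
  \<open>gam 4\<close>, and G' <= M gives gam 4 <= [M, G, G]. Nilpotency removes the second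
  factor.\<close>

lemma powerful_embedded:
  assumes pw: "powerful_p_group p G"
    and w: "w \<in> agemo G p 1 (carrier G)" and y: "y \<in> carrier G"
  shows "cm G w y \<in> agemo G p (pow_exp p) (agemo G p 1 (carrier G))"
proof (cases "p = 2")
  case True then show ?thesis using powerful_2_embedded assms by (simp add: pow_exp_def)
next
  case False
  let ?M = "agemo G p 1 (carrier G)" let ?N = "agemo G p 1 ?M"
  let ?A = "comm_sub ?M (carrier G)" let ?K = "?N <#> comm_sub ?A (carrier G)"
  have M: "?M \<lhd> G" using normal_carrier by (rule agemo_normal)
  have N: "?N \<lhd> G" using M by (rule agemo_normal)
  have A: "?A \<lhd> G" using M normal_carrier by (rule comm_sub_normal)
  have AA: "comm_sub ?A (carrier G) \<lhd> G" using A normal_carrier by (rule comm_sub_normal)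
  have K: "?K \<lhd> G" using N AA by (rule set_mult_normal)
  have sM: "subgroup ?M G" and sK: "subgroup ?K G" and sN: "subgroup ?N G" and sAA: "subgroup (comm_sub ?A (carrier G)) G"
    and sA: "subgroup ?A G"
    using M K N AA A normal_imp_subgroup by auto
  have NK: "?N \<subseteq> ?K" "comm_sub ?A (carrier G) \<subseteq> ?K" using subset_set_mult[OF sN sAA] by auto
  have e: "pow_exp p = 1" using False by (simp add: pow_exp_def)
  have g2: "gam 2 \<subseteq> ?M" using pw e by (simp add: powerful_iff gam_2)
  have "gam 3 = comm_sub (gam 2) (carrier G)" using gam_Suc[of 2] by (simp add: numeral_eq_Suc)
  then have g3: "gam 3 \<subseteq> ?A" using comm_sub_mono[OF g2] by simp
  have "gam 4 = comm_sub (gam 3) (carrier G)" using gam_Suc[of 3] by (simp add: numeral_eq_Suc)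
  then have g4: "gam 4 \<subseteq> ?K" using comm_sub_mono[OF g3] NK by blast
  have 1: "cm G (x [^] (p ^ 1)) y \<in> ?K" if "x \<in> carrier G" "y \<in> carrier G" for x y
  proof (rule cm_pow_mem[OF sK that, of 3])
    fix i c assume i: "1 \<le> i" "i < 3" and c: "c \<in> gam (Suc i)"
    have "c \<in> ?M" using c i gam_mono[of 2 "Suc i"] g2 by auto
    then have "c [^] (p ^ 1 choose i) \<in> ?N"
      using dvd_choose[OF i] e subgroup.subset[OF sM] by (intro agemo_pow_dvd) auto
    then show "c [^] (p ^ 1 choose i) \<in> ?K" using NK by auto
  qed (use g4 in \<open>simp_all add: numeral_eq_Suc\<close>)
  have "?A \<subseteq> ?K" using cm_agemo_mem[OF K 1] by (intro comm_sub_least[OF sK]) auto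
  then have "?A \<subseteq> ?N" by (rule subset_mod_comm_sub[OF N A])
  then show ?thesis using comm_sub_memI[OF w y] e by auto
qed

section \<open>The subgroup of p-th powers of a powerful group\<close>

lemma powerful_agemo:
  assumes pw: "powerful_p_group p G"
  shows "powerful_p_group p (G\<lparr>carrier := agemo G p 1 (carrier G)\<rparr>)"
proof -
  let ?M = "agemo G p 1 (carrier G)" let ?GM = "G\<lparr>carrier := ?M\<rparr>"
  have sM: "subgroup ?M G" by (rule agemo_subgroup) auto
  have MG: "?M \<subseteq> carrier G" using sM by (rule subgroup.subset)
  interpret M: finite_p_group ?GM p using sM by (rule sub_finite_p_group)
  have "derived G ?M \<subseteq> agemo G p (pow_exp p) ?M" unfolding derived_eq_comm_sub
    using powerful_embedded[OF pw] MG by (intro comm_sub_least agemo_subgroup) auto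
  then show ?thesis
    unfolding M.powerful_iff
    using derived_consistent[OF order.refl sM] agemo_consistent[OF sM order.refl] by simp
qed

text \<open>Modulo \<open>?N\<close> taking p-th powers is a homomorphism, so \<open>?M\<close> is
  the product of \<open>?N\<close> and \<open>?T\<close>. As every maximal subgroup of
  \<open>?M\<close> contains \<open>?N\<close>, already \<open>?T\<close> is all of
  \<open>?M\<close>.\<close>

lemma powerful_agemo_generated:
  assumes pw: "powerful_p_group p G" and S: "S \<subseteq> carrier G" "generate G S = carrier G"
  shows "agemo G p 1 (carrier G) = generate G ((\<lambda>s. s [^] p) ` S)"
proof -
  let ?M = "agemo G p 1 (carrier G)" let ?N = "agemo G p 1 ?M" let ?T = "generate G ((\<lambda>s. s [^] p) ` S)"
  let ?K = "?N <#> ?T" let ?GM = "G\<lparr>carrier := ?M\<rparr>"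
  have M: "?M \<lhd> G" using normal_carrier by (rule agemo_normal)
  have N: "?N \<lhd> G" using M by (rule agemo_normal)
  have sM: "subgroup ?M G" and sN: "subgroup ?N G" using M N normal_imp_subgroup by auto
  have TG: "(\<lambda>s. s [^] p) ` S \<subseteq> carrier G" using S by auto
  have sT: "subgroup ?T G" using TG by (rule generate_is_subgroup)
  have sK: "subgroup ?K G" using N sT by (rule mult_norm_subgroup)
  have NK: "?N \<subseteq> ?K" "?T \<subseteq> ?K" using subset_set_mult[OF sN sT] by auto
  have TM: "?T \<subseteq> ?M" using S agemo_mem[of _ "carrier G" p 1] sM by (intro generate_subgroup_incl) auto
  interpret M: finite_p_group ?GM p using sM by (rule sub_finite_p_group)
  have g2: "gam 2 \<subseteq> agemo G p (pow_exp p) (carrier G)" using pw by (simp add: powerful_iff gam_2)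
  have LM: "agemo G p (pow_exp p) (carrier G) \<subseteq> ?M"
    by (rule agemo_least[OF sM]) (auto intro!: agemo_pow_dvd simp: pow_exp_def)
  have eN: "agemo G p (pow_exp p) ?M \<subseteq> ?N"
    using subgroup.subset[OF sM] by (intro agemo_least[OF sN] agemo_pow_dvd) (auto simp: pow_exp_def)
  have g3: "gam 3 \<subseteq> ?N"
  proof -
    have "gam 3 = comm_sub (gam 2) (carrier G)" using gam_Suc[of 2] by (simp add: numeral_eq_Suc)
    moreover have "comm_sub (gam 2) (carrier G) \<subseteq> ?N"
      using powerful_embedded[OF pw] g2 LM eN by (intro comm_sub_least[OF sN]) blast
    ultimately show ?thesis by simp
  qed
  \<comment> \<open>For p = 2 the exponent is 1, so G' itself must lie in \<open>?N\<close>. It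
    does, since G' is contained in the subgroup of fourth powers and h^4 = (h^2)^2.\<close>
  have c2: "c [^] (p choose 2) \<in> ?N" if c: "c \<in> gam 2" for c
  proof (cases "p = 2")
    case True
    have "agemo G p 2 (carrier G) \<subseteq> ?N"
    proof (rule agemo_least[OF sN])
      fix h assume h: "h \<in> carrier G"
      have "(h [^] (p ^ 1)) [^] (p ^ 1) \<in> ?N" using h by (intro agemo_mem)
      then show "h [^] (p ^ 2) \<in> ?N" using h by (simp add: nat_pow_pow power2_eq_square)
    qed
    then show ?thesis using c g2 True gam_carrier by (auto simp: pow_exp_def)
  next
    case False
    then show ?thesis using c g2 LM dvd_choose[of 2] subgroup.subset[OF sM]
      by (intro agemo_pow_dvd) (auto simp: pow_exp_def)
  qed
  have prod: "(x \<otimes> y) [^] p \<otimes> inv (y [^] p) \<otimes> inv (x [^] p) \<in> ?N"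
    if xy: "x \<in> carrier G" "y \<in> carrier G" for x y
  proof -
    interpret filtered_group G gam by (rule filtered_gam)
    show ?thesis
    proof (rule hall_petrescu[OF poly_product_powers[OF xy] _ _ sN, of 2 3])
      fix j :: nat assume "j < 2"
      then have "j = 0 \<or> j = 1" by auto
      then show "(x \<otimes> y) [^] j \<otimes> inv (y [^] j) \<otimes> inv (x [^] j) = \<one>" using xy by (auto simp: word)
    next
      fix i c assume i: "2 \<le> i" "i < 3" and c: "c \<in> gam (0 + i)"
      from i have "i = 2" by linarith
      then have "i = 2" "c \<in> gam 2" using c by (simp_all only: add_0)
      then show "c [^] (p choose i) \<in> ?N" using c2 by simp
    qed (use g3 in auto)
  qed
  have pK: "x [^] p \<in> ?K" if "x \<in> carrier G" for x
    using fin S(1) that[folded S(2)]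
  proof (induction rule: generate_induct_finite)
    case one then show ?case using subgroup.one_closed[OF sK] by simp
  next
    case (incl s) then show ?case using NK by (auto intro: generate.incl)
  next
    case (mult a b)
    have ab: "a \<in> carrier G" "b \<in> carrier G" using mult(1,2) S by auto
    have "((a \<otimes> b) [^] p \<otimes> inv (b [^] p) \<otimes> inv (a [^] p)) \<otimes> (a [^] p \<otimes> b [^] p) \<in> ?K"
      by (rule subgroup.m_closed[OF sK subsetD[OF NK(1) prod[OF ab]] subgroup.m_closed[OF sK mult(3,4)]])
    also have "((a \<otimes> b) [^] p \<otimes> inv (b [^] p) \<otimes> inv (a [^] p)) \<otimes> (a [^] p \<otimes> b [^] p) = (a \<otimes> b) [^] p"
      using ab by (simp add: word)
    finally show ?case .
  qed
  have MK: "?M \<subseteq> ?K" using pK by (intro agemo_least[OF sK]) simp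
  show ?thesis
  proof (rule ccontr)
    assume "?M \<noteq> ?T"
    then obtain Q where Q: "subgroup Q ?GM" "?T \<subseteq> Q" "Q \<noteq> ?M" "\<forall>x\<in>?M. x [^] p \<in> Q"
      using M.frattini[of ?T] subgroup_incl[OF sT sM TM] by (auto simp: subgroup_nat_pow)
    have sQ: "subgroup Q G" using Q(1) sM incl_subgroup by blast
    have "?N \<subseteq> Q" using Q(4) by (intro agemo_least[OF sQ]) simp
    then have "?K \<subseteq> Q" using Q by (intro set_mult_least[OF sQ])
    then show False using Q MK subgroup.subset[OF Q(1)] by auto
  qed
qed

end

text \<open>Induction on \<open>k\<close>, passing from \<open>G\<close> to its subgroup of p-th
  powers with the p-th powers of \<open>S\<close> as generators. As the group changes, the lemma
  stands outside the locale.\<close>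

lemma powerful_exponent:
  assumes "finite_p_group G p" "powerful_p_group p G" "S \<subseteq> carrier G" "generate G S = carrier G"
    and "\<And>s. s \<in> S \<Longrightarrow> s [^]\<^bsub>G\<^esub> (p ^ k) = \<one>\<^bsub>G\<^esub>" and "x \<in> carrier G"
  shows "x [^]\<^bsub>G\<^esub> (p ^ k) = \<one>\<^bsub>G\<^esub>"
  using assms
proof (induction k arbitrary: G S x)
  case 0
  interpret finite_p_group G p by (rule 0)
  have "S \<subseteq> {\<one>\<^bsub>G\<^esub>}"
  proof
    fix s assume "s \<in> S"
    then have "s \<in> carrier G" "s [^]\<^bsub>G\<^esub> (p ^ 0) = \<one>\<^bsub>G\<^esub>" using 0(3,5) by auto
    then show "s \<in> {\<one>\<^bsub>G\<^esub>}" by simp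
  qed
  then have "generate G S \<subseteq> {\<one>\<^bsub>G\<^esub>}" using triv_subgroup by (intro generate_subgroup_incl)
  then show ?case using 0 by auto
next
  case (Suc k)
  interpret finite_p_group G p by (rule Suc)
  let ?M = "agemo G p 1 (carrier G)" let ?GM = "G\<lparr>carrier := ?M\<rparr>" let ?T = "(\<lambda>s. s [^]\<^bsub>G\<^esub> p) ` S"
  have sM: "subgroup ?M G" by (rule agemo_subgroup) auto
  have gen: "?M = generate G ?T" using powerful_agemo_generated[OF Suc.prems(2-4)] .
  have TM: "?T \<subseteq> ?M" unfolding gen by (auto intro: generate.incl)
  have "(x [^]\<^bsub>G\<^esub> p) [^]\<^bsub>?GM\<^esub> (p ^ k) = \<one>\<^bsub>?GM\<^esub>"
  proof (rule Suc.IH[OF sub_finite_p_group[OF sM] powerful_agemo[OF Suc.prems(2)], of ?T])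
    show "?T \<subseteq> carrier ?GM" using TM by simp
    show "generate ?GM ?T = carrier ?GM" using generate_consistent[OF TM sM] gen by simp
    fix s assume "s \<in> ?T"
    then obtain t where t: "t \<in> S" "s = t [^]\<^bsub>G\<^esub> p" by auto
    then show "s [^]\<^bsub>?GM\<^esub> (p ^ k) = \<one>\<^bsub>?GM\<^esub>"
      using Suc.prems(3,5) by (auto simp: subgroup_nat_pow nat_pow_pow)
  next
    show "x [^]\<^bsub>G\<^esub> p \<in> carrier ?GM" using agemo_mem[of x "carrier G" p 1] Suc.prems by simp
  qed
  then show ?case using Suc.prems by (simp add: subgroup_nat_pow nat_pow_pow)
qed

section \<open>Groups of maximal class\<close>

context filtered_group begin

lemma diff_conj_powers:
  assumes "u \<in> carrier G" "g \<in> carrier G"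
  shows "diff (\<lambda>n. u [^] n \<otimes> g \<otimes> inv (u [^] n)) = (\<lambda>n. u [^] n \<otimes> cm G u g \<otimes> inv (u [^] n))"
  using assms by (simp add: diff_def cm_def word fun_eq_iff)

lemma iterate_diff_conj_powers:
  assumes "u \<in> carrier G" "g \<in> carrier G"
  shows "(diff ^^ k) (\<lambda>n. u [^] n \<otimes> g \<otimes> inv (u [^] n)) 0 = (cm G u ^^ k) g"
  using assms(2)
proof (induction k arbitrary: g)
  case (Suc k)
  have "(diff ^^ Suc k) (\<lambda>n. u [^] n \<otimes> g \<otimes> inv (u [^] n))
      = (diff ^^ k) (\<lambda>n. u [^] n \<otimes> cm G u g \<otimes> inv (u [^] n))"
    using diff_conj_powers[OF assms(1) Suc.prems] by (simp add: funpow_swap1)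
  then show ?case using Suc.IH[of "cm G u g"] Suc.prems assms(1) by (simp add: funpow_swap1)
qed simp

text \<open>The sequence \<open>(w t)\<^sup>n t\<^sup>-\<^sup>n\<close> has the successive differences \<open>(w t)\<^sup>n w (w t)\<^sup>-\<^sup>n\<close>, so its
  \<open>p\<close>-th difference at \<open>0\<close> is the iterated commutator.\<close>

lemma power_mod_filtration:
  assumes t: "t \<in> carrier G" and w: "w \<in> \<Gamma> i" and i: "2 \<le> i" and \<Gamma>1: "\<Gamma> 1 = carrier G"
    and p: "prime p" and pow: "\<And>c. c \<in> \<Gamma> (Suc i) \<Longrightarrow> c [^] p \<in> \<Gamma> (i + p)"
  shows "(w \<otimes> t) [^] p \<otimes> inv (t [^] p) \<otimes> inv (w [^] p) \<otimes> inv ((cm G (w \<otimes> t) ^^ (p - 1)) w) \<in> \<Gamma> (i + p)"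
proof -
  let ?u = "w \<otimes> t"
  \<comment> \<open>The degree is i - 1, because the sequence of the powers of \<open>w\<close> has
    degree one less than the depth of \<open>w\<close>.\<close>
  obtain a where a: "i = Suc a" "1 \<le> a" using i by (cases i) auto
  have wc: "w \<in> carrier G" using w by (rule fl_carrier)
  have uc: "?u \<in> carrier G" using wc t by simp
  have pw: "poly 0 (\<lambda>n. g [^] n)" if "g \<in> carrier G" for g
    using that \<Gamma>1 by (intro poly_pow) simp
  let ?U = "\<lambda>n::nat. ?u [^] n \<otimes> w \<otimes> inv (?u [^] n)" let ?F = "\<lambda>n::nat. ?u [^] n \<otimes> inv (t [^] n)"
  have "poly (0 + i) (\<lambda>n. cm G (?u [^] n) w)" by (intro poly_cm pw uc poly_const w)
  then have "poly i (\<lambda>n. cm G (?u [^] n) w \<otimes> w)" using poly_const[OF w] by (intro poly_mult) auto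
  moreover have "(\<lambda>n::nat. cm G (?u [^] n) w \<otimes> w) = ?U" using uc wc by (simp add: conj_eq_cm)
  ultimately have U: "poly i ?U" by simp
  have dF: "diff ?F = ?U" using wc t by (simp add: diff_def word fun_eq_iff)
  have F: "poly a ?F"
  proof (rule poly_diffI)
    show "poly (Suc a) (diff ?F)" using U dF a by simp
    show "?F n \<in> \<Gamma> a" for n
    proof (induction n)
      case (Suc n)
      have "?F (Suc n) = ?U n \<otimes> ?F n" using wc t by (simp add: word)
      moreover have "?U n \<in> \<Gamma> a" using poly_val[OF U] a fl_Suc by simp
      ultimately show ?case using Suc fl_mult by simp
    qed (simp add: fl_one)
  qed
  have wp: "poly a (\<lambda>n. inv (w [^] n))" using w a by (intro poly_inv poly_pow) simp
  \<comment> \<open>Division by w^n makes the sequence trivial at 1 as well, so the expansion begins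
    at 2, with coefficients in \<open>\<Gamma> (Suc i)\<close>, to which \<open>pow\<close>
    applies.\<close>
  let ?f = "\<lambda>n::nat. ?F n \<otimes> inv (w [^] n)"
  have f: "poly a ?f" using F wp by (rule poly_mult)
  have p2: "p \<ge> 2" using p by (rule prime_ge_2_nat)
  have "?f p \<otimes> inv ((diff ^^ p) ?f 0) \<in> \<Gamma> (Suc (a + p))"
  proof (rule hall_petrescu_top[OF f _ p2 a(2)])
    fix j :: nat assume "j < 2"
    then have "j = 0 \<or> j = 1" by auto
    then show "?f j = \<one>" using wc t by (auto simp: word)
  next
    fix r c assume r: "2 \<le> r" "r < p" and c: "c \<in> \<Gamma> (a + r)"
    have c': "c \<in> \<Gamma> (Suc i)" using c r a fl_mono[of "Suc i" "a + r"] by auto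
    have "p dvd (p choose r)" using r p by (intro dvd_choose_prime) auto
    then obtain m where m: "p choose r = p * m" by (auto simp: dvd_def)
    have "c [^] (p choose r) = (c [^] p) [^] m"
      using fl_carrier[OF c'] m by (simp add: nat_pow_pow)
    then show "c [^] (p choose r) \<in> \<Gamma> (Suc (a + p))" using fl_pow[OF pow[OF c']] a by simp
  qed
  then have 1: "?f p \<otimes> inv ((diff ^^ p) ?f 0) \<in> \<Gamma> (i + p)" using a by simp
  have "(diff ^^ p) ?f 0 \<otimes> inv ((diff ^^ p) ?F 0 \<otimes> (diff ^^ p) (\<lambda>n. inv (w [^] n)) 0) \<in> \<Gamma> (i + p)"
    using top_diff_mult[OF F wp a(2), of p] a by simp
  moreover have "(diff ^^ p) (\<lambda>n. inv (w [^] n)) 0 = \<one>"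
    using top_diff_choose[of "inv w" 1 p 0] wc p2 by (simp add: nat_pow_inv)
  moreover have "(diff ^^ p) ?F 0 = (cm G ?u ^^ (p - 1)) w"
  proof -
    obtain r where r: "p = Suc r" using p2 by (cases p) auto
    have "(diff ^^ p) ?F 0 = (diff ^^ r) (diff ?F) 0" using r by (simp add: funpow_swap1)
    also have "\<dots> = (cm G ?u ^^ r) w" unfolding dF by (rule iterate_diff_conj_powers[OF uc wc])
    finally show ?thesis using r by simp
  qed
  moreover have Ic: "(cm G ?u ^^ k) w \<in> carrier G" for k using uc wc by (induction k) auto
  ultimately have 2: "(diff ^^ p) ?f 0 \<otimes> inv ((cm G ?u ^^ (p - 1)) w) \<in> \<Gamma> (i + p)" by simp
  have dc: "(diff ^^ p) ?f 0 \<in> carrier G" using wc t by (intro diff_carrier) simp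
  have "(?f p \<otimes> inv ((diff ^^ p) ?f 0)) \<otimes> ((diff ^^ p) ?f 0 \<otimes> inv ((cm G ?u ^^ (p - 1)) w))
      = ?f p \<otimes> inv ((cm G ?u ^^ (p - 1)) w)"
    using dc Ic[of "p - 1"] poly_carrier[OF f, of p] by (simp add: m_assoc inv_mult_cancel)
  then show ?thesis using fl_mult[OF 1 2] by simp
qed

end

context group begin

lemma gam_antimono: "x \<in> gam j \<Longrightarrow> i \<le> j \<Longrightarrow> x \<in> gam i"
  using gam_mono by blast

text \<open>This filtration makes it possible to work modulo \<open>gam m\<close> without passing to
  the quotient.\<close>

lemma filtration_gam_min: "filtration (\<lambda>k. gam (min k m))"
  unfolding filtration_def
proof (intro conjI allI ballI)
  show "gam (min i m) \<lhd> G" for i by (rule gam_normal)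
  show "gam (min (Suc i) m) \<subseteq> gam (min i m)" for i by (rule gam_mono) simp
  fix i j a b assume a: "a \<in> gam (min i m)" and b: "b \<in> gam (min j m)"
  have "cm G a b \<in> gam (min i m + min j m)" using a b by (rule gam_cm)
  moreover have "min (i + j) m \<le> min i m + min j m" by linarith
  ultimately show "cm G a b \<in> gam (min (i + j) m)" using gam_mono by blast
qed

lemma pow_mod_normal:
  assumes N: "N \<lhd> G" and z: "z \<in> N" and u: "u \<in> carrier G"
  shows "(z \<otimes> u) [^] (k::nat) \<otimes> inv (u [^] k) \<in> N"
proof (induction k)
  case 0 then show ?case using N normal_imp_subgroup subgroup.one_closed by auto
next
  case (Suc k)
  have sN: "subgroup N G" using N by (rule normal_imp_subgroup)
  have zc: "z \<in> carrier G" using sN z by (rule subgroup.mem_carrier)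
  have "(z \<otimes> u) [^] Suc k \<otimes> inv (u [^] Suc k) =
      ((z \<otimes> u) [^] k \<otimes> z \<otimes> inv ((z \<otimes> u) [^] k)) \<otimes> ((z \<otimes> u) [^] k \<otimes> inv (u [^] k))"
    using zc u by (simp add: word)
  moreover have "(z \<otimes> u) [^] k \<in> carrier G" using zc u by simp
  ultimately show ?case using subgroup.m_closed[OF sN normal_conj[OF N _ z] Suc] by simp
qed

text \<open>Commutation with \<open>T\<close> induces a homomorphism from the i-th lower central
  factor to the next one.\<close>

lemma cm_pow_mod:
  assumes g: "g \<in> gam i" and i: "i \<ge> 1" and T: "T \<in> carrier G"
  shows "cm G (g [^] (a::nat)) T \<otimes> inv (cm G g T [^] a) \<in> gam (i + 2)"
proof (induction a)
  case 0 then show ?case using T subgroup.one_closed[OF gam_subgroup] by simp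
next
  case (Suc a)
  let ?N = "gam (i + 2)" let ?c = "cm G g T" let ?x = "g [^] a"
  have gc: "g \<in> carrier G" using g by (rule gam_carrier)
  have c: "?c \<in> gam (Suc i)" using g T i by (rule gam_Suc_cm)
  have "?x \<in> gam i" using gam_subgroup g by (induction a) (auto simp: subgroup.one_closed subgroup.m_closed)
  then have "cm G ?x ?c \<in> gam (i + Suc i)" using c by (rule gam_cm)
  then have 1: "cm G ?x ?c \<in> ?N" using gam_mono[of "i + 2" "i + Suc i"] i by auto
  have cc: "?c \<in> carrier G" using gc T by simp
  have 2: "?c \<otimes> (cm G ?x T \<otimes> inv (?c [^] a)) \<otimes> inv ?c \<in> ?N"
    using Suc by (intro normal_conj[OF gam_normal cc])
  have comm: "?c [^] a \<otimes> ?c = ?c \<otimes> ?c [^] a" using cc by (metis nat_pow_Suc nat_pow_Suc2)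
  have "cm G (?x \<otimes> g) T = (cm G ?x ?c \<otimes> ?c) \<otimes> cm G ?x T"
    using gc T by (simp add: cm_mult_left conj_eq_cm)
  then have "cm G (g [^] Suc a) T \<otimes> inv (?c [^] Suc a)
      = cm G ?x ?c \<otimes> (?c \<otimes> (cm G ?x T \<otimes> inv (?c [^] a)) \<otimes> inv ?c)"
    using gc T cc by (simp add: comm m_assoc inv_mult_group)
  then show ?case using 1 2 gam_subgroup by (simp add: subgroup.m_closed)
qed

end

locale maximal_class_group = finite_p_group +
  fixes n :: nat
  assumes order: "order G = p ^ n" and class_eq: "n = Suc (nilpotency_class G)" and large: "p + 3 \<le> n"
begin

lemma gam_n: "gam n = {\<one>}" using nilpotency_class_gam class_eq by simp

lemma gam_nontrivial: assumes "k < n" shows "gam k \<noteq> {\<one>}"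
proof -
  have "gam (Suc j) \<noteq> {\<one>}" if "Suc j < n" for j
    using not_less_Least[of j "\<lambda>n. lower_central G n = {\<one>}"] that class_eq
    by (simp add: gam_def nilpotency_class_def)
  from this[of 0] this[of "k - 1"] show ?thesis using assms large by (cases k) auto
qed

text \<open>The upper bound from \<open>gam_index\<close> coincides with the lower bound that comes
  from the n - k strict inclusions down to \<open>gam n\<close>.\<close>

lemma card_gam: assumes "2 \<le> k" "k \<le> n" shows "card (gam k) = p ^ (n - k)"
proof (rule antisym)
  show "card (gam k) \<le> p ^ (n - k)"
  proof (cases "k = n")
    case True then show ?thesis using gam_n by simp
  next
    case False
    then have "p ^ k * card (gam k) dvd p ^ k * p ^ (n - k)"
      using gam_index[OF assms(1)] gam_nontrivial assms order by (simp add: power_add[symmetric])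
    then have "card (gam k) dvd p ^ (n - k)" using p_ge_2 by simp
    then show ?thesis using p_ge_2 by (intro dvd_imp_le) auto
  qed
  show "p ^ (n - k) \<le> card (gam k)" using assms(2,1)
  proof (induction k rule: inc_induct)
    case base then show ?case using gam_n by simp
  next
    case (step k)
    have "gam (Suc k) \<subset> gam k" using gam_psubset gam_nontrivial step by simp
    then have "p * card (gam (Suc k)) dvd card (gam k)" by (intro card_subgroup_dvd gam_subgroup)
    moreover have "0 < card (gam k)"
      using finite_subgroup[OF gam_subgroup] subgroup.one_closed[OF gam_subgroup] by (auto simp: card_gt_0_iff)
    ultimately have "p * card (gam (Suc k)) \<le> card (gam k)" by (rule dvd_imp_le)
    moreover have "p * p ^ (n - Suc k) = p ^ (n - k)" using step by (simp flip: power_Suc add: Suc_diff_Suc)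
    moreover have "p * p ^ (n - Suc k) \<le> p * card (gam (Suc k))" using step by (intro mult_le_mono) auto
    ultimately show ?case by linarith
  qed
qed

text \<open>The factor of \<open>gam k\<close> by \<open>gam (Suc k)\<close> has order
  \<open>p\<close>, so \<open>g\<close> generates it.\<close>

lemma gam_level:
  assumes k: "2 \<le> k" "k < n" and g: "g \<in> gam k" "g \<notin> gam (Suc k)" and h: "h \<in> gam k"
  shows "\<exists>z\<in>gam (Suc k). \<exists>a::nat. h = z \<otimes> g [^] a"
proof -
  have gc: "g \<in> carrier G" using g gam_carrier by auto
  let ?X = "generate G {g}" let ?L = "gam (Suc k) <#> ?X"
  have sX: "subgroup ?X G" using gc by (intro generate_is_subgroup) auto
  have gX: "g \<in> ?X" by (auto intro: generate.incl)
  have sL: "subgroup ?L G" by (rule mult_norm_subgroup[OF gam_normal sX])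
  have sub: "gam (Suc k) \<subset> ?L" using subset_set_mult[OF gam_subgroup[of "Suc k"] sX] gX g by blast
  have Lk: "?L \<subseteq> gam k"
    using g gam_Suc_subset by (intro set_mult_least gam_subgroup generate_subgroup_incl) auto
  have "p * card (gam (Suc k)) dvd card ?L" by (rule card_subgroup_dvd[OF gam_subgroup sL sub])
  moreover have "p * card (gam (Suc k)) = card (gam k)"
    using card_gam[of k] card_gam[of "Suc k"] k by (simp flip: power_Suc add: Suc_diff_Suc)
  moreover have fk: "finite (gam k)" by (rule finite_subgroup[OF gam_subgroup])
  moreover have "0 < card ?L" using finite_subgroup[OF sL] sub by (auto simp: card_gt_0_iff)
  ultimately have "card (gam k) \<le> card ?L" by (metis dvd_imp_le)
  then have "?L = gam k" using card_seteq[OF fk Lk] by simp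
  then have "h \<in> ?L" using h by simp
  then obtain z y where zy: "h = z \<otimes> y" "z \<in> gam (Suc k)" "y \<in> ?X" by (auto simp: set_mult_iff)
  have "ord g \<noteq> 0" using ord_ge_1[OF fin gc] by simp
  then obtain a :: nat where "y = g [^] a" using generate_pow_nat[OF gc] zy(3) by auto
  then show ?thesis using zy by blast
qed

section \<open>Two-step centralizers and uniform elements\<close>

definition two_step :: "nat \<Rightarrow> 'a set" where "two_step k = cent_mod (gam k) (gam (k + 2))"

lemma two_step_subgroup: "subgroup (two_step k) G"
  unfolding two_step_def by (rule cent_mod_subgroup[OF gam_normal subgroup.subset[OF gam_subgroup]])

lemma two_step_iff: "u \<in> two_step k \<longleftrightarrow> u \<in> carrier G \<and> (\<forall>a\<in>gam k. cm G u a \<in> gam (k + 2))"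
  by (simp add: two_step_def cent_mod_def)

lemma gam_2_two_step: "gam 2 \<subseteq> two_step k"
  using gam_cm[of _ 2 _ k] gam_carrier by (auto simp: two_step_iff add.commute)

lemma gam_cm_right: "u \<in> carrier G \<Longrightarrow> a \<in> gam k \<Longrightarrow> 1 \<le> k \<Longrightarrow> cm G u a \<in> gam (Suc k)"
  using gam_Suc_cm[of a k u] cm_swap[of a u] gam_carrier[of a k]
    subgroup.m_inv_closed[OF gam_subgroup] by simp

lemma two_step_proper: assumes "2 \<le> k" "k + 2 \<le> n" shows "two_step k \<noteq> carrier G"
proof
  assume C: "two_step k = carrier G"
  have "cm G a u \<in> gam (Suc (Suc k))" if "a \<in> gam k" "u \<in> carrier G" for a u
    using that C two_step_iff[of u k] cm_swap[of u a] gam_carrier[OF that(1)]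
      subgroup.m_inv_closed[OF gam_subgroup, of _ "Suc (Suc k)"] by auto
  then have "comm_sub (gam k) (carrier G) \<subseteq> gam (Suc (Suc k))" by (intro comm_sub_least[OF gam_subgroup])
  then have "gam (Suc k) \<subseteq> gam (Suc (Suc k))" using gam_Suc[of k] assms by simp
  moreover have "gam (Suc (Suc k)) \<subset> gam (Suc k)" using gam_psubset gam_nontrivial assms by simp
  ultimately show False by auto
qed

text \<open>The bound \<open>m\<close> allows such elements to be used before their existence for m
  = n is known. The index k = 1 is included, since the approximation in \<open>uniform_conj\<close>
  starts there.\<close>

definition uniform :: "nat \<Rightarrow> 'a \<Rightarrow> bool" where
  "uniform m t \<longleftrightarrow> t \<in> carrier G \<and> (\<forall>k. 1 \<le> k \<longrightarrow> k + 2 \<le> m \<longrightarrow> t \<notin> two_step k)"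

lemma uniform_carrier: "uniform m t \<Longrightarrow> t \<in> carrier G" by (simp add: uniform_def)

lemma uniform_mult:
  assumes "uniform m t" "w \<in> gam 2" shows "uniform m (w \<otimes> t)"
proof -
  have c: "t \<in> carrier G" "w \<in> carrier G" using assms gam_carrier by (auto simp: uniform_def)
  have "t \<in> two_step k" if "w \<otimes> t \<in> two_step k" for k
  proof -
    have "inv w \<in> two_step k" using assms(2) gam_2_two_step two_step_subgroup by (auto intro: subgroup.m_inv_closed)
    then have "inv w \<otimes> (w \<otimes> t) \<in> two_step k" using that two_step_subgroup by (simp add: subgroup.m_closed)
    then show ?thesis using c by (simp add: word)
  qed
  then show ?thesis using assms c by (auto simp: uniform_def)
qed

text \<open>The elements that \<open>t\<close> centralizes modulo \<open>gam (k + 2)\<close> form a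
  subgroup containing \<open>gam (Suc k)\<close>. With \<open>g\<close> in it, it would contain all
  of \<open>gam k\<close>, against the choice of \<open>t\<close>.\<close>

lemma uniform_cm:
  assumes t: "uniform m t" and k: "2 \<le> k" "k + 2 \<le> m" "m \<le> n" and g: "g \<in> gam k" "g \<notin> gam (Suc k)"
  shows "cm G t g \<notin> gam (k + 2)"
proof
  assume *: "cm G t g \<in> gam (k + 2)"
  have tc: "t \<in> carrier G" using t by (rule uniform_carrier)
  let ?Z = "cent_mod {t} (gam (k + 2))"
  have sZ: "subgroup ?Z G" using gam_normal tc by (intro cent_mod_subgroup) auto
  have inZ: "u \<in> ?Z" if "cm G t u \<in> gam (k + 2)" "u \<in> carrier G" for u
    using that tc cm_swap[of t u] subgroup.m_inv_closed[OF gam_subgroup] by (auto simp: cent_mod_def)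
  have "g \<in> ?Z" using * g gam_carrier by (intro inZ) auto
  moreover have "gam (Suc k) \<subseteq> ?Z"
  proof
    fix u assume u: "u \<in> gam (Suc k)"
    have "cm G t u \<in> gam (k + 2)" using gam_cm_right[OF tc u] by simp
    then show "u \<in> ?Z" using u gam_carrier by (intro inZ) auto
  qed
  moreover have "h \<in> ?Z" if "h \<in> gam k" "g \<in> ?Z" "gam (Suc k) \<subseteq> ?Z" for h
  proof -
    obtain z a where "z \<in> gam (Suc k)" "h = z \<otimes> g [^] (a::nat)"
      using gam_level[OF k(1) _ g \<open>h \<in> gam k\<close>] k by auto
    then show ?thesis using subgroup.m_closed[OF sZ, of z "g [^] a"] subgroup_pow[OF sZ that(2)] that(3) by auto
  qed
  ultimately have "gam k \<subseteq> ?Z" by blast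
  then have "t \<in> two_step k"
    using tc cm_swap[of _ t] subgroup.m_inv_closed[OF gam_subgroup] by (auto simp: two_step_iff cent_mod_def)
  then show False using t k by (auto simp: uniform_def)
qed

lemma gens_cm_not_gam3: assumes "gens x y" shows "cm G x y \<notin> gam 3"
proof
  assume c: "cm G x y \<in> gam 3"
  have "conj_class (cm G x y) \<subseteq> gam 3" using c normal_conj[OF gam_normal] by (auto simp: conj_class_def)
  then have "generate G (conj_class (cm G x y)) \<subseteq> gam 3" by (intro generate_subgroup_incl gam_subgroup)
  then have "gam 2 \<subseteq> gam 3" using derived_subset_conj_class[OF assms] by (simp add: gam_2)
  moreover have "gam 3 \<subset> gam 2" using gam_psubset[of 2] gam_nontrivial[of 2] large by (simp add: eval_nat_numeral)
  ultimately show False by auto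
qed

text \<open>Of the \<open>p + 1\<close> elements \<open>y, x, x y, \<dots>, x y\<^sup>p\<^sup>-\<^sup>1\<close> any two generate the group, so each proper
  subgroup contains at most one of them.\<close>

lemma avoid_two_step:
  assumes gen: "gens x y" and K: "finite K" "card K \<le> p" "\<And>k. k \<in> K \<Longrightarrow> 2 \<le> k \<and> k + 2 \<le> n"
  shows "\<exists>t\<in>carrier G. t \<notin> two_step 1 \<and> (\<forall>k\<in>K. t \<notin> two_step k)"
proof -
  define \<tau> where "\<tau> j = (if j < p then x \<otimes> y [^] j else y)" for j
  have xy: "x \<in> carrier G" "y \<in> carrier G" and g: "generate G {x, y} = carrier G" using gen by auto
  have whole: "C = carrier G" if "subgroup C G" "x \<in> C" "y \<in> C" for C
    using generate_subgroup_incl[of "{x, y}" C] that g subgroup.subset[OF that(1)] by auto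
  have two: "C = carrier G" if C: "subgroup C G" and ij: "i < j" "j \<le> p" "\<tau> i \<in> C" "\<tau> j \<in> C" for C i j
  proof (rule whole[OF C])
    have ti: "x \<otimes> y [^] i \<in> C" using ij by (simp add: \<tau>_def)
    show yC: "y \<in> C"
    proof (cases "j < p")
      case False then show ?thesis using ij by (simp add: \<tau>_def)
    next
      case True
      then have tj: "x \<otimes> y [^] j \<in> C" using ij by (simp add: \<tau>_def)
      have "y [^] j = y [^] i \<otimes> y [^] (j - i)" using ij xy by (simp add: nat_pow_mult)
      then have "inv (x \<otimes> y [^] i) \<otimes> (x \<otimes> y [^] j) = y [^] (j - i)" using xy by (simp add: word)
      then have "y [^] (j - i) \<in> C" using ti tj C by (metis subgroup.m_closed subgroup.m_inv_closed)
      moreover have "\<not> p dvd (j - i)" using ij True by (auto dest: dvd_imp_le)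
      then have "coprime (j - i) p" using prime_imp_coprime[OF prime] coprime_commute by blast
      ultimately show ?thesis using pow_coprime_mem[OF C xy(2)] by blast
    qed
    have "(x \<otimes> y [^] i) \<otimes> inv (y [^] i) \<in> C"
      by (rule subgroup.m_closed[OF C ti subgroup.m_inv_closed[OF C subgroup_pow[OF C yC]]])
    then show "x \<in> C" using xy by (simp add: word)
  qed
  have "\<exists>j\<le>p. \<forall>k\<in>K. \<tau> j \<notin> two_step k"
  proof (rule ccontr)
    assume "\<not> ?thesis"
    then obtain f where f: "\<And>j. j \<le> p \<Longrightarrow> f j \<in> K \<and> \<tau> j \<in> two_step (f j)" by metis
    have "\<not> inj_on f {..p}"
    proof
      assume "inj_on f {..p}"
      then have "card {..p} \<le> card K" using f K(1) by (intro card_inj_on_le[of f]) auto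
      then show False using K(2) by simp
    qed
    then obtain i j where ij: "i \<le> p" "j \<le> p" "i < j" "f i = f j"
      unfolding inj_on_def by (metis atMost_iff linorder_neqE_nat)
    have "two_step (f i) = carrier G"
      using f[OF ij(1)] f[OF ij(2)] ij by (intro two[OF two_step_subgroup ij(3,2)]) auto
    then show False using two_step_proper f[OF ij(1)] K(3) by blast
  qed
  then obtain j where j: "j \<le> p" "\<forall>k\<in>K. \<tau> j \<notin> two_step k" by blast
  have tc: "\<tau> j \<in> carrier G" using xy by (simp add: \<tau>_def)
  \<comment> \<open>The index 1 is not part of the pigeonhole: \<open>\<tau> j\<close> generates the
    group together with some \<open>v\<close>, and the commutator of the two lies outside
    \<open>gam 3\<close>.\<close>
  have "\<exists>v. gens (\<tau> j) v"
  proof (cases "j < p")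
    case True
    have s: "subgroup (generate G {\<tau> j, y}) G" using tc xy by (intro generate_is_subgroup) auto
    have in_: "\<tau> j \<in> generate G {\<tau> j, y}" "y \<in> generate G {\<tau> j, y}" by (auto intro: generate.incl)
    then have "\<tau> j \<otimes> inv (y [^] j) \<in> generate G {\<tau> j, y}"
      using subgroup_pow[OF s] s by (simp add: subgroup.m_closed subgroup.m_inv_closed)
    then have "x \<in> generate G {\<tau> j, y}" using True xy by (simp add: \<tau>_def word)
    then have "generate G {\<tau> j, y} = carrier G" using whole[OF s] in_ by simp
    then show ?thesis using tc xy by blast
  next
    case False
    then have "\<tau> j = y" by (simp add: \<tau>_def)
    then show ?thesis using gen by (metis insert_commute)
  qed
  then obtain v where v: "gens (\<tau> j) v" by blast
  have "\<tau> j \<notin> two_step 1" using gens_cm_not_gam3[OF v] v by (auto simp: two_step_iff eval_nat_numeral)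
  then show ?thesis using j tc by blast
qed

text \<open>Successive approximation: \<open>z\<close> is the error of the conjugate of
  \<open>t\<close>, and each step pushes it one term deeper.\<close>

lemma uniform_conj:
  assumes t: "uniform m t" and m: "m \<le> n" and w: "w \<in> gam 2" and j: "2 \<le> j" "j \<le> m"
  shows "\<exists>h\<in>carrier G. \<exists>z\<in>gam j. h \<otimes> t \<otimes> inv h = z \<otimes> (w \<otimes> t)"
  using j
proof (induction j rule: nat_induct_at_least)
  case base
  have "t \<in> carrier G" "w \<in> carrier G" "inv w \<in> gam 2"
    using t w uniform_carrier gam_carrier gam_subgroup by (auto intro: subgroup.m_inv_closed)
  then have "\<one> \<otimes> t \<otimes> inv \<one> = inv w \<otimes> (w \<otimes> t)" by (simp add: word)
  then show ?case using \<open>inv w \<in> gam 2\<close> by blast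
next
  case (Suc j)
  have tc: "t \<in> carrier G" and wc: "w \<in> carrier G" using t w uniform_carrier gam_carrier by auto
  obtain h z where h: "h \<in> carrier G" "z \<in> gam j" "h \<otimes> t \<otimes> inv h = z \<otimes> (w \<otimes> t)" using Suc by auto
  let ?T = "z \<otimes> (w \<otimes> t)"
  have zc: "z \<in> carrier G" using h gam_carrier by auto
  have z2: "z \<in> gam 2" using h gam_mono[OF Suc.hyps] by auto
  have T: "uniform m ?T" using uniform_mult[OF uniform_mult[OF t w] z2] .
  obtain i where i: "j = Suc i" "1 \<le> i" using Suc.hyps by (cases j) auto
  have Tc: "?T \<in> carrier G" using T by (rule uniform_carrier)
  have "?T \<notin> two_step i" using T i Suc.prems by (auto simp: uniform_def)
  \<comment> \<open>The commutator of this \<open>g\<close> with \<open>?T\<close> generates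
    \<open>gam j\<close> modulo \<open>gam (Suc j)\<close>, so conjugation by a suitable power of
    \<open>g\<close> cancels \<open>z\<close>.\<close>
  then obtain g where g: "g \<in> gam i" "cm G ?T g \<notin> gam (i + 2)" using Tc by (auto simp: two_step_iff)
  have gc: "g \<in> carrier G" using g gam_carrier by auto
  let ?c = "cm G g ?T"
  have c: "?c \<in> gam j" using gam_Suc_cm[OF g(1) Tc i(2)] i by simp
  have c': "?c \<notin> gam (Suc j)"
    using g(2) cm_swap[OF gc Tc] subgroup.m_inv_closed[OF gam_subgroup, of ?c "Suc j"] i by auto
  have iz: "inv z \<in> gam j" using h gam_subgroup by (simp add: subgroup.m_inv_closed)
  have jn: "j < n" using Suc.prems m by simp
  obtain y a where y: "y \<in> gam (Suc j)" "inv z = y \<otimes> ?c [^] (a::nat)"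
    using gam_level[OF Suc.hyps jn c c' iz] by auto
  have yc: "y \<in> carrier G" using y gam_carrier by auto
  let ?g = "g [^] a" let ?n = "cm G ?g ?T \<otimes> inv (?c [^] a)"
  have n: "?n \<in> gam (Suc j)" using cm_pow_mod[OF g(1) i(2) Tc, of a] i by simp
  have "?c [^] a = inv y \<otimes> inv z" using y yc gc Tc by (simp add: word)
  then have "cm G ?g ?T \<otimes> z = ?n \<otimes> inv y" using yc zc gc Tc by (simp add: word)
  then have z': "cm G ?g ?T \<otimes> z \<in> gam (Suc j)" using n y gam_subgroup by (simp add: subgroup.m_closed subgroup.m_inv_closed)
  have "(?g \<otimes> h) \<otimes> t \<otimes> inv (?g \<otimes> h) = ?g \<otimes> (h \<otimes> t \<otimes> inv h) \<otimes> inv ?g"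
    using gc h(1) tc by (simp add: word)
  also have "\<dots> = cm G ?g ?T \<otimes> ?T" unfolding h(3) using gc Tc by (intro conj_eq_cm) auto
  also have "\<dots> = (cm G ?g ?T \<otimes> z) \<otimes> (w \<otimes> t)" using gc Tc zc wc tc by (simp add: m_assoc)
  finally show ?case using z' gc h by (meson m_closed nat_pow_closed)
qed

text \<open>G' has index p^2 and G' <x> is a proper subgroup, so it is either G' or contains it with
  index \<open>p\<close>. In the second case a maximal subgroup of it above G' is G' itself and
  contains x^p.\<close>

lemma pth_power_gam_2: assumes x: "x \<in> carrier G" shows "x [^] p \<in> gam 2"
proof -
  let ?D = "gam 2" let ?X = "generate G {x}" let ?K = "?D <#> ?X" let ?GK = "G\<lparr>carrier := ?K\<rparr>"
  have sX: "subgroup ?X G" using x by (intro generate_is_subgroup) auto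
  have sK: "subgroup ?K G" by (rule mult_norm_subgroup[OF gam_normal sX])
  have sub: "?D \<subseteq> ?K" "?X \<subseteq> ?K" using subset_set_mult[OF gam_subgroup sX] by auto
  have xK: "x \<in> ?K" using sub by (auto intro: generate.incl)
  have nt: "derived G (carrier G) \<noteq> {\<one>}" using gam_nontrivial[of 2] large by (simp add: gam_2)
  then have "?X \<noteq> carrier G" using cyclic_derived_trivial[OF x] by auto
  then obtain M where M: "subgroup M G" "?X \<subseteq> M" "M \<noteq> carrier G" "derived G (carrier G) \<subseteq> M"
    using frattini[OF sX] by auto
  then have "?K \<subseteq> M" by (intro set_mult_least) (auto simp: gam_2)
  then have KG: "?K \<subset> carrier G" using M subgroup.subset[OF M(1)] by auto
  interpret K: finite_p_group ?GK p using sK by (rule sub_finite_p_group)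
  show ?thesis
  proof (cases "?D = ?K")
    case True then show ?thesis using xK subgroup_pow[OF sK xK] by simp
  next
    case False
    then obtain L where L: "subgroup L ?GK" "?D \<subseteq> L" "L \<noteq> ?K" "\<forall>x\<in>?K. x [^] p \<in> L"
      using K.frattini[of ?D] subgroup_incl[OF gam_subgroup sK sub(1)] by (auto simp: subgroup_nat_pow)
    have sL: "subgroup L G" using L(1) sK incl_subgroup by blast
    have LK: "L \<subset> ?K" using L subgroup.subset[OF L(1)] by auto
    have "p * card L dvd card ?K" by (rule card_subgroup_dvd[OF sL sK LK])
    moreover have "p * card ?K dvd order G" unfolding order_def by (rule card_subgroup_dvd[OF sK subgroup_self KG])
    ultimately have "p * (p * card L) dvd order G" by (meson dvd_trans dvd_refl mult_dvd_mono)
    moreover have "n = Suc (Suc (n - 2))" using large by simp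
    then have "p ^ n = p * (p * p ^ (n - 2))" by (metis power_Suc)
    then have "order G = p * (p * card ?D)" using order card_gam[of 2] large by simp
    ultimately have "card L dvd card ?D" using p_ge_2 by simp
    moreover have "0 < card ?D"
      using finite_subgroup[OF gam_subgroup] subgroup.one_closed[OF gam_subgroup] by (auto simp: card_gt_0_iff)
    ultimately have "card L \<le> card ?D" by (rule dvd_imp_le)
    then have "?D = L" using card_seteq[OF finite_subgroup[OF sL] L(2)] by simp
    then show ?thesis using L(4) xK by auto
  qed
qed

text \<open>\<open>t\<close> commutes with t^p, but by \<open>uniform_cm\<close> with no element of
  \<open>gam j\<close> outside \<open>gam (Suc j)\<close>, even modulo \<open>gam (j + 2)\<close>.
  So t^p sinks step by step.\<close>

lemma uniform_pow:
  assumes t: "uniform m t" and m: "m \<le> n" and j: "2 \<le> j" "Suc j \<le> m"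
  shows "t [^] p \<in> gam j"
  using j
proof (induction j rule: nat_induct_at_least)
  case base then show ?case using pth_power_gam_2 t uniform_carrier by auto
next
  case (Suc j)
  have tc: "t \<in> carrier G" using t by (rule uniform_carrier)
  have "cm G t (t [^] p) = \<one>"
    using tc cm_eq_one_iff[of t "t [^] p"] nat_pow_Suc[of t p] nat_pow_Suc2[OF tc, of p] by simp
  then have "cm G t (t [^] p) \<in> gam (j + 2)" using subgroup.one_closed[OF gam_subgroup] by simp
  moreover have "t [^] p \<in> gam j" using Suc by simp
  ultimately show ?case using uniform_cm[OF t Suc.hyps _ m, of "t [^] p"] Suc.prems by auto
qed

lemma uniform_pow_mult:
  assumes t: "uniform m t" and m: "3 \<le> m" "m \<le> n" and w: "w \<in> gam 2"
  shows "(w \<otimes> t) [^] p \<otimes> inv (t [^] p) \<in> gam m"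
proof -
  obtain h z where h: "h \<in> carrier G" "z \<in> gam m" "h \<otimes> t \<otimes> inv h = z \<otimes> (w \<otimes> t)"
    using uniform_conj[OF t m(2) w, of m] m by auto
  let ?u = "w \<otimes> t"
  have tc: "t \<in> carrier G" and wc: "w \<in> carrier G" and zc: "z \<in> carrier G"
    using t w h uniform_carrier gam_carrier by auto
  obtain j where j: "m = Suc j" using m by (cases m) auto
  then have "t [^] p \<in> gam j" using m by (intro uniform_pow[OF t m(2)]) auto
  then have 1: "cm G h (t [^] p) \<in> gam m" using gam_cm_right[OF h(1)] j m by simp
  have eq: "(z \<otimes> ?u) [^] p = cm G h (t [^] p) \<otimes> t [^] p"
    unfolding h(3)[symmetric] conj_pow[OF h(1) tc] by (rule conj_eq_cm) (use h tc in auto)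
  have 2: "inv ((z \<otimes> ?u) [^] p \<otimes> inv (?u [^] p)) \<in> gam m"
    using pow_mod_normal[OF gam_normal h(2), of ?u p] wc tc
    by (intro subgroup.m_inv_closed[OF gam_subgroup]) auto
  have "?u [^] p \<otimes> inv (t [^] p) = inv ((z \<otimes> ?u) [^] p \<otimes> inv (?u [^] p)) \<otimes> ((z \<otimes> ?u) [^] p \<otimes> inv (t [^] p))"
    using wc tc zc by (simp add: inv_mult_group m_assoc inv_mult_cancel)
  also have "(z \<otimes> ?u) [^] p \<otimes> inv (t [^] p) = cm G h (t [^] p)" unfolding eq using h tc by (simp add: m_assoc)
  finally show ?thesis using 1 2 by (simp add: subgroup.m_closed[OF gam_subgroup])
qed

lemma iterate_cm_gam:
  assumes "u \<in> gam j" "w \<in> gam i" shows "(cm G u ^^ k) w \<in> gam (i + k * j)"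
proof (induction k)
  case (Suc k)
  have "cm G u ((cm G u ^^ k) w) \<in> gam (j + (i + k * j))" using assms(1) Suc by (rule gam_cm)
  moreover have "j + (i + k * j) = i + Suc k * j" by simp
  ultimately show ?case by simp
qed (use assms in simp)

lemma power_gam_min:
  assumes t: "t \<in> carrier G" and w: "w \<in> gam i" and i: "2 \<le> i" and m: "1 \<le> m"
    and pow: "\<And>c. c \<in> gam (min (Suc i) m) \<Longrightarrow> c [^] p \<in> gam (min (i + p) m)"
  shows "(w \<otimes> t) [^] p \<otimes> inv (t [^] p) \<otimes> inv (w [^] p) \<otimes> inv ((cm G (w \<otimes> t) ^^ (p - 1)) w) \<in> gam (min (i + p) m)"
proof -
  interpret F: filtered_group G "\<lambda>k. gam (min k m)"
    by (simp add: filtered_group_def filtered_group_axioms_def filtration_gam_min is_group)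
  have w': "w \<in> gam (min i m)" using w gam_mono[of "min i m" i] by auto
  show ?thesis by (rule F.power_mod_filtration[OF t w' i _ prime]) (use pow m in auto)
qed

text \<open>Modulo \<open>gam m\<close> the powers (w t)^p and t^p agree, so the other two factors
  in \<open>power_gam_min\<close> have to cancel.\<close>

lemma uniform_power_residue:
  assumes t: "uniform m t" and m: "3 \<le> m" "m \<le> n" and w: "w \<in> gam i" and i: "2 \<le> i"
    and pow: "\<And>c. c \<in> gam (min (Suc i) m) \<Longrightarrow> c [^] p \<in> gam (min (i + p) m)"
  shows "(cm G (w \<otimes> t) ^^ (p - 1)) w \<otimes> w [^] p \<in> gam (min (i + p) m)"
proof -
  let ?N = "gam (min (i + p) m)" let ?I = "(cm G (w \<otimes> t) ^^ (p - 1)) w"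
  have sN: "subgroup ?N G" by (rule gam_subgroup)
  have tc: "t \<in> carrier G" and wc: "w \<in> carrier G" using t w uniform_carrier gam_carrier by auto
  let ?X = "(w \<otimes> t) [^] p \<otimes> inv (t [^] p)"
  have Ic: "(cm G (w \<otimes> t) ^^ k) w \<in> carrier G" for k using tc wc by (induction k) auto
  have "w \<in> gam 2" using w gam_mono[OF i] by auto
  then have "?X \<in> gam m" by (rule uniform_pow_mult[OF t m])
  then have X: "?X \<in> ?N" using gam_mono[of "min (i + p) m" m] by auto
  have Y: "?X \<otimes> inv (w [^] p) \<otimes> inv ?I \<in> ?N" using m by (intro power_gam_min[OF tc w i _ pow]) auto
  have "inv (inv ?X \<otimes> (?X \<otimes> inv (w [^] p) \<otimes> inv ?I)) \<in> ?N"
    by (rule subgroup.m_inv_closed[OF sN subgroup.m_closed[OF sN subgroup.m_inv_closed[OF sN X] Y]])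
  also have "inv (inv ?X \<otimes> (?X \<otimes> inv (w [^] p) \<otimes> inv ?I)) = ?I \<otimes> w [^] p"
    using tc wc Ic[of "p - 1"] by (simp add: word)
  finally show ?thesis .
qed

text \<open>Downward induction on \<open>i\<close>: the case i + 1 supplies the assumption on p-th
  powers in \<open>uniform_power_residue\<close>, and the iterated commutator gains p - 1
  steps.\<close>

lemma uniform_power_upper:
  assumes t: "uniform m t" and m: "3 \<le> m" "m \<le> n" and i: "2 \<le> i" and w: "w \<in> gam i"
  shows "w [^] p \<in> gam (min (i + p - 1) m)"
proof (cases "m \<le> i")
  case True
  then have "w [^] p \<in> gam i" using w gam_subgroup by (simp add: subgroup_pow)
  then show ?thesis by (rule gam_antimono) (use True in linarith)
next
  case False
  then have "i \<le> m" by simp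
  then show ?thesis using i w
  proof (induction i arbitrary: w rule: inc_induct)
    case base
    then have "w [^] p \<in> gam m" using gam_subgroup by (simp add: subgroup_pow)
    then show ?case by (rule gam_antimono) linarith
  next
    case (step i)
    have wc: "w \<in> carrier G" using step gam_carrier by auto
    have tc: "t \<in> carrier G" using t by (rule uniform_carrier)
    let ?I = "(cm G (w \<otimes> t) ^^ (p - 1)) w" let ?N = "gam (min (i + p - 1) m)"
    have "c [^] p \<in> gam (min (i + p) m)" if "c \<in> gam (min (Suc i) m)" for c
      using step.IH[of c] that step by (simp add: min_def split: if_splits)
    then have "?I \<otimes> w [^] p \<in> gam (min (i + p) m)"
      using uniform_power_residue[OF t m step.prems(2,1)] by blast
    then have 1: "?I \<otimes> w [^] p \<in> ?N" by (rule gam_antimono) linarith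
    have "?I \<in> gam (i + (p - 1) * 1)" using iterate_cm_gam[of "w \<otimes> t" 1 w i] wc tc step by simp
    then have I: "?I \<in> ?N" by (rule gam_antimono) (use p_ge_2 in linarith)
    have "inv ?I \<otimes> (?I \<otimes> w [^] p) \<in> ?N"
      by (rule subgroup.m_closed[OF gam_subgroup subgroup.m_inv_closed[OF gam_subgroup I] 1])
    then show ?case using wc gam_carrier[OF I] by (simp add: inv_mult_cancel)
  qed
qed

lemma iterate_cm_uniform:
  assumes u: "uniform m u" and m: "m \<le> n" and w: "w \<in> gam i" "w \<notin> gam (Suc i)" and i: "2 \<le> i"
  shows "i + Suc k \<le> m \<Longrightarrow> (cm G u ^^ k) w \<in> gam (i + k) \<and> (cm G u ^^ k) w \<notin> gam (Suc (i + k))"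
proof (induction k)
  case 0 then show ?case using w by simp
next
  case (Suc k)
  then have IH: "(cm G u ^^ k) w \<in> gam (i + k)" "(cm G u ^^ k) w \<notin> gam (Suc (i + k))" by auto
  have "cm G u ((cm G u ^^ k) w) \<notin> gam (i + k + 2)"
    using Suc.prems i by (intro uniform_cm[OF u _ _ m IH]) auto
  moreover have "cm G u ((cm G u ^^ k) w) \<in> gam (Suc (i + k))"
    using gam_cm_right[OF uniform_carrier[OF u] IH(1)] i by simp
  ultimately show ?case by simp
qed

text \<open>The iterated commutator descends exactly p - 1 steps, and modulo
  \<open>gam (i + p)\<close> it is the inverse of w^p.\<close>

lemma uniform_power_exact:
  assumes t: "uniform m t" and m: "m \<le> n" and i: "2 \<le> i" and w: "w \<in> gam i" "w \<notin> gam (Suc i)"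
    and ip: "i + p \<le> m"
  shows "w [^] p \<notin> gam (i + p)"
proof
  assume wp: "w [^] p \<in> gam (i + p)"
  let ?I = "(cm G (w \<otimes> t) ^^ (p - 1)) w"
  have m3: "3 \<le> m" using i ip p_ge_2 by simp
  have wc: "w \<in> carrier G" using w gam_carrier by auto
  have "w \<in> gam 2" using w gam_mono[OF i] by auto
  then have u: "uniform m (w \<otimes> t)" by (rule uniform_mult[OF t])
  have I: "?I \<notin> gam (i + p)" "?I \<in> carrier G"
    using iterate_cm_uniform[OF u m w i, of "p - 1"] ip p_ge_2 gam_carrier by auto
  have "c [^] p \<in> gam (min (i + p) m)" if "c \<in> gam (min (Suc i) m)" for c
    using uniform_power_upper[OF t m3 m, of "Suc i" c] that i ip p_ge_2 by (simp add: min_def split: if_splits)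
  then have "?I \<otimes> w [^] p \<in> gam (min (i + p) m)" using uniform_power_residue[OF t m3 m w(1) i] by blast
  then have 1: "?I \<otimes> w [^] p \<in> gam (i + p)" using ip by (simp add: min_absorb1)
  have "(?I \<otimes> w [^] p) \<otimes> inv (w [^] p) \<in> gam (i + p)"
    by (rule subgroup.m_closed[OF gam_subgroup 1 subgroup.m_inv_closed[OF gam_subgroup wp]])
  then show False using I wc by (simp add: m_assoc)
qed

text \<open>Suppose d = [u, g] is not in \<open>gam (j + 2)\<close> for some \<open>g\<close> in
  \<open>gam j\<close>. Conjugation by \<open>u\<close> takes g to d g and fixes g^p modulo
  \<open>gam (j + p + 1)\<close>, so (d g)^p and g^p agree there. The power formula turns this into
  d^p in \<open>gam (j + p + 1)\<close>, against \<open>uniform_power_exact\<close>.\<close>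

lemma two_step_periodic:
  assumes t: "uniform (j + p + 1) t" and j: "2 \<le> j" "j + p + 1 \<le> n"
  shows "two_step (j + p - 1) \<subseteq> two_step j"
proof
  fix u assume u: "u \<in> two_step (j + p - 1)"
  have uc: "u \<in> carrier G" using u by (simp add: two_step_iff)
  let ?m = "j + p + 1"
  have m: "3 \<le> ?m" "?m \<le> n" using j by auto
  show "u \<in> two_step j"
  proof (rule ccontr)
    assume "u \<notin> two_step j"
    then obtain g where g: "g \<in> gam j" and d2: "cm G u g \<notin> gam (j + 2)" using uc by (auto simp: two_step_iff)
    let ?d = "cm G u g" let ?I = "(cm G (?d \<otimes> g) ^^ (p - 1)) ?d"
    have gc: "g \<in> carrier G" using g gam_carrier by auto
    have d: "?d \<in> gam (Suc j)" using gam_cm_right[OF uc g] j by simp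
    have dc: "?d \<in> carrier G" using uc gc by simp
    have "g [^] p \<in> gam (j + p - 1)" using uniform_power_upper[OF t m j(1) g] by simp
    then have "cm G u (g [^] p) \<in> gam (j + p - 1 + 2)" using u by (simp add: two_step_iff)
    then have 1: "cm G u (g [^] p) \<in> gam ?m" using p_ge_2 by simp
    have "(?d \<otimes> g) [^] p = (u \<otimes> g \<otimes> inv u) [^] p" using uc gc by (simp add: conj_eq_cm)
    also have "\<dots> = cm G u (g [^] p) \<otimes> g [^] p"
      unfolding conj_pow[OF uc gc] by (rule conj_eq_cm) (use uc gc in auto)
    finally have 2: "(?d \<otimes> g) [^] p \<otimes> inv (g [^] p) = cm G u (g [^] p)" using uc gc by (simp add: m_assoc)
    have "(?d \<otimes> g) [^] p \<otimes> inv (g [^] p) \<otimes> inv (?d [^] p) \<otimes> inv ?I \<in> gam (min (Suc j + p) ?m)"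
    proof (rule power_gam_min[OF gc d])
      fix c assume "c \<in> gam (min (Suc (Suc j)) ?m)"
      then have "c \<in> gam (j + 2)" using p_ge_2 by (simp add: min_def split: if_splits)
      then show "c [^] p \<in> gam (min (Suc j + p) ?m)" using uniform_power_upper[OF t m, of "j + 2" c] by simp
    qed (use j in auto)
    then have 3: "cm G u (g [^] p) \<otimes> inv (?d [^] p) \<otimes> inv ?I \<in> gam ?m" using 2 by simp
    \<comment> \<open>Commutation with an element of \<open>gam j\<close> gains j >= 2 steps each
      time, so here the iterated commutator is negligible.\<close>
    have "?d \<otimes> g \<in> gam j" using d g gam_Suc_subset gam_subgroup by (blast intro: subgroup.m_closed)
    then have "?I \<in> gam (Suc j + (p - 1) * j)" using d by (rule iterate_cm_gam)
    moreover have "?m \<le> Suc j + (p - 1) * j"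
    proof -
      have "(p - 1) * 2 \<le> (p - 1) * j" using j by (intro mult_le_mono) auto
      moreover have "p \<le> (p - 1) * 2" using p_ge_2 by linarith
      ultimately show ?thesis by linarith
    qed
    ultimately have I: "?I \<in> gam ?m" using gam_mono by blast
    have sm: "subgroup (gam ?m) G" by (rule gam_subgroup)
    have "inv (inv (cm G u (g [^] p)) \<otimes> ((cm G u (g [^] p) \<otimes> inv (?d [^] p) \<otimes> inv ?I) \<otimes> ?I)) \<in> gam ?m"
      by (rule subgroup.m_inv_closed[OF sm subgroup.m_closed[OF sm subgroup.m_inv_closed[OF sm 1]
            subgroup.m_closed[OF sm 3 I]]])
    then have "?d [^] p \<in> gam ?m" using uc gc gam_carrier[OF I] by (simp add: m_assoc inv_mult_cancel)
    moreover have "?d [^] p \<notin> gam (Suc j + p)"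
      using d2 j by (intro uniform_power_exact[OF t m(2) _ d]) auto
    ultimately show False by simp
  qed
qed

text \<open>For k > p an element outside \<open>two_step i\<close> for i = 1, ..., p and i = k
  avoids, by induction, all indices up to \<open>k\<close>. It is thus uniform for k + 2, and
  periodicity places \<open>two_step k\<close> inside \<open>two_step (k - p + 1)\<close>.\<close>

lemma two_step_bounded:
  assumes gen: "gens x y"
  shows "2 \<le> k \<Longrightarrow> k + 2 \<le> n \<Longrightarrow> \<exists>k0. 2 \<le> k0 \<and> k0 \<le> p \<and> two_step k \<subseteq> two_step k0"
proof (induction k rule: less_induct)
  case (less k)
  show ?case
  proof (cases "k \<le> p")
    case True then show ?thesis using less.prems by blast
  next
    case False
    define j where "j = k - p + 1"
    have j: "2 \<le> j" "j < k" "j + p + 1 = k + 2" "j + p - 1 = k" using False p_ge_2 by (auto simp: j_def)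
    \<comment> \<open>The p - 1 indices from 2 to \<open>p\<close> together with \<open>k\<close>:
      exactly as many as \<open>avoid_two_step\<close> permits.\<close>
    have cK: "card (insert k {2..p}) \<le> p" using False p_ge_2 by simp
    have K: "2 \<le> i \<and> i + 2 \<le> n" if "i \<in> insert k {2..p}" for i
      using that less.prems large by auto
    obtain t where t: "t \<in> carrier G" "t \<notin> two_step 1" "\<forall>i\<in>insert k {2..p}. t \<notin> two_step i"
      using avoid_two_step[OF gen _ cK K] by blast
    have "uniform (k + 2) t" unfolding uniform_def
    proof (intro conjI t allI impI)
      fix i assume i: "1 \<le> i" "i + 2 \<le> k + 2"
      consider "i = 1" | "i = k" | "2 \<le> i" "i < k" using i by linarith
      then show "t \<notin> two_step i"
      proof cases
        case 3
        then obtain i0 where "2 \<le> i0" "i0 \<le> p" "two_step i \<subseteq> two_step i0" using less.IH[of i] less.prems by auto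
        then show ?thesis using t by auto
      qed (use t in auto)
    qed
    then have "two_step k \<subseteq> two_step j" using two_step_periodic[of j t] j less.prems by simp
    then show ?thesis using less.IH[of j] j less.prems by fastforce
  qed
qed

lemma uniform_exists: assumes gen: "gens x y" shows "\<exists>t. uniform n t"
proof -
  have K: "2 \<le> i \<and> i + 2 \<le> n" if "i \<in> {2..p}" for i using that large by auto
  obtain t where t: "t \<in> carrier G" "t \<notin> two_step 1" "\<forall>i\<in>{2..p}. t \<notin> two_step i"
    using avoid_two_step[OF gen, of "{2..p}", OF _ _ K] by auto
  have "t \<notin> two_step k" if k: "1 \<le> k" "k + 2 \<le> n" for k
  proof (cases "k = 1")
    case False
    then obtain k0 where "2 \<le> k0" "k0 \<le> p" "two_step k \<subseteq> two_step k0"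
      using two_step_bounded[OF gen, of k] k by auto
    then show ?thesis using t by auto
  qed (use t in simp)
  then show ?thesis using t by (auto simp: uniform_def)
qed

text \<open>Both p-th powers lie in \<open>gam (i + p - 1)\<close>, that of \<open>g\<close> not one
  term deeper, so induction on \<open>k\<close> continues at the new level; from level
  \<open>n\<close> on everything is trivial.\<close>

lemma same_level_pow:
  assumes t: "uniform n t"
  shows "2 \<le> i \<Longrightarrow> g \<in> gam i \<Longrightarrow> g \<notin> gam (Suc i) \<Longrightarrow> h \<in> gam i \<Longrightarrow>
    g [^] (p ^ k) = \<one> \<Longrightarrow> h [^] (p ^ k) = \<one>"
proof (induction k arbitrary: i g h)
  case 0
  have "g = \<one>" using 0(5) gam_carrier[OF 0(2)] by simp
  then show ?case using 0 subgroup.one_closed[OF gam_subgroup] by auto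
next
  case (Suc k)
  have c: "g \<in> carrier G" "h \<in> carrier G" using Suc.prems gam_carrier by auto
  have n3: "3 \<le> n" using large by simp
  have gp: "g [^] p \<in> gam (min (i + p - 1) n)" and hp: "h [^] p \<in> gam (min (i + p - 1) n)"
    using uniform_power_upper[OF t n3 order.refl Suc.prems(1)] Suc.prems by auto
  have "(h [^] p) [^] (p ^ k) = \<one>"
  proof (cases "i + p \<le> n")
    case True
    have "g [^] p \<notin> gam (Suc (i + p - 1))"
      using uniform_power_exact[OF t order.refl Suc.prems(1-3) True] p_ge_2 by simp
    moreover have "(g [^] p) [^] (p ^ k) = \<one>" using Suc.prems c by (simp add: nat_pow_pow)
    moreover have "min (i + p - 1) n = i + p - 1" "2 \<le> i + p - 1"
      using True Suc.prems(1) p_ge_2 by linarith+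
    ultimately show ?thesis using Suc.IH[of "i + p - 1" "g [^] p" "h [^] p"] gp hp by metis
  next
    case False
    then have "n \<le> i + p - 1" by linarith
    then have "h [^] p = \<one>" using hp gam_n by (simp add: min_absorb2)
    then show ?thesis by simp
  qed
  then show ?case using c by (simp add: nat_pow_pow)
qed

lemma maximal_class_commutator:
  assumes gen: "gens x y" "gens x' y'" and c: "cm G x y [^] (p ^ k) = \<one>"
  shows "cm G x' y' [^] (p ^ k) = \<one>"
proof -
  obtain t where t: "uniform n t" using uniform_exists[OF gen(1)] by blast
  have "cm G x y \<in> gam 2" "cm G x' y' \<in> gam 2" using gen cm_in_derived by (auto simp: gam_2)
  then show ?thesis
    using same_level_pow[OF t order.refl _ _ _ c] gens_cm_not_gam3[OF gen(1)] by (simp add: eval_nat_numeral)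
qed

end

text \<open>Formulated with trivial p^k-th powers instead of orders; exchanging the two pairs then
  gives the equality of the orders.\<close>

lemma (in finite_p_group) commutator_order_invariant:
  assumes gen: "gens x y" "gens x' y'" and c: "cm G x y [^] (p ^ k) = \<one>"
    and cases: "regular_p_group p G \<or> maximal_class p G \<or> powerful_p_group p G \<or>
         regular_p_group p (commutator_group G) \<or> powerful_p_group p (commutator_group G) \<or>
         order_closed p (commutator_group G) \<or> order G \<le> p ^ (p + 2) \<or> nilpotency_class G \<le> p"
  shows "cm G x' y' [^] (p ^ k) = \<one>"
proof -
  let ?D = "derived G (carrier G)" let ?GD = "G\<lparr>carrier := ?D\<rparr>"
  have sD: "subgroup ?D G" using gam_subgroup[of 2] by (simp add: gam_2)
  interpret D: finite_p_group ?GD p using sD by (rule sub_finite_p_group)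
  have CG: "commutator_group G = ?GD" by (simp add: commutator_group_def)
  have DG: "?D \<subseteq> carrier G" using sD by (rule subgroup.subset)
  have c': "cm G x' y' \<in> ?D" "cm G x y \<in> ?D" using gen by (auto intro: cm_in_derived)
  have closed: ?thesis
    if "\<And>a b. a \<in> ?D \<Longrightarrow> b \<in> ?D \<Longrightarrow> a [^] (p ^ k) = \<one> \<Longrightarrow> b [^] (p ^ k) = \<one> \<Longrightarrow> (a \<otimes> b) [^] (p ^ k) = \<one>"
    using derived_exponent[OF gen(1) c that c'(1)] .
  \<comment> \<open>Small order gives i = p + 2 and small class gives some i <= p + 1; both are at
    most 2 p since p >= 2.\<close>
  have low_class: ?thesis if "gam i = {\<one>}" "i \<le> 2 * p" for i
    using derived_closed_of_class[OF gam_trivial_mono[OF that]] by (intro closed) auto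
  have small: ?thesis if "order G \<le> p ^ (p + 2)"
    using gam_trivial_of_order[OF that] p_ge_2 by (intro low_class[of "p + 2"]) auto
  from cases show ?thesis
  proof (elim disjE)
    assume "regular_p_group p G"
    then show ?thesis using regular_closed DG by (intro closed) blast
  next
    assume mc: "maximal_class p G"
    show ?thesis
    proof (cases "order G \<le> p ^ (p + 2)")
      case False
      let ?n = "Suc (nilpotency_class G)"
      have o: "order G = p ^ ?n" using mc by (simp add: maximal_class_def)
      have "p + 2 < ?n"
      proof (rule ccontr)
        assume "\<not> p + 2 < ?n"
        then have "p ^ ?n \<le> p ^ (p + 2)" using p_ge_2 by (intro power_increasing) auto
        then show False using False o by simp
      qed
      then interpret maximal_class_group G p ?n
        by unfold_locales (use o in auto)
      show ?thesis using maximal_class_commutator[OF gen c] .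
    qed (rule small)
  next
    assume "powerful_p_group p G"
    then have "?D = generate G {cm G x y}" by (rule powerful_derived_cyclic[OF _ gen(1)])
    then have "cm G x' y' \<in> generate G {cm G x y}" using c' by simp
    moreover have cc: "cm G x y \<in> carrier G" using gen by auto
    moreover have "ord (cm G x y) \<noteq> 0" using ord_ge_1[OF fin cc] by simp
    ultimately obtain a :: nat where "cm G x' y' = cm G x y [^] a" using generate_pow_nat by auto
    then have "cm G x' y' [^] (p ^ k) = (cm G x y [^] (p ^ k)) [^] a"
      using cc by (simp add: nat_pow_pow mult.commute)
    then show ?thesis using c by simp
  next
    assume "regular_p_group p (commutator_group G)"
    then show ?thesis using D.regular_closed by (intro closed) (auto simp: CG subgroup_nat_pow)
  next
    assume pw: "powerful_p_group p (commutator_group G)"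
    let ?S = "conj_class (cm G x y)"
    have cc: "cm G x y \<in> carrier G" using gen by auto
    have "?D \<lhd> G" using gam_normal[of 2] by (simp add: gam_2)
    then have SD: "?S \<subseteq> ?D" using normal_conj c' by (auto simp: conj_class_def)
    then have "generate G ?S = ?D"
      using derived_subset_conj_class[OF gen(1)] generate_subgroup_incl[OF SD sD] by auto
    then have "generate ?GD ?S = ?D" using generate_consistent[OF SD sD] by simp
    moreover have "s [^] (p ^ k) = \<one>" if "s \<in> ?S" for s
      using that c cc by (auto simp: conj_class_def conj_pow)
    ultimately show ?thesis
      using powerful_exponent[OF D.finite_p_group_axioms pw[unfolded CG], of ?S k "cm G x' y'"] SD c'
      by (simp add: subgroup_nat_pow)
  next
    assume "order_closed p (commutator_group G)"
    then show ?thesis using D.order_closed_closed by (intro closed) (auto simp: CG subgroup_nat_pow)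
  next
    assume "nilpotency_class G \<le> p"
    then show ?thesis using nilpotency_class_gam p_ge_2 by (intro low_class) auto
  qed (rule small)
qed

section \<open>The surface of an origami\<close>

definition wrap :: "real \<Rightarrow> real" where "wrap a = (if a = 1 then 0 else a)"

text \<open>Every point of a square is glued to a point off the right and the upper edge; \<open>nform\<close>
  moves it there, crossing first the right and then the upper edge.\<close>

definition nform :: "'a origami \<Rightarrow> 'a \<times> real \<times> real \<Rightarrow> 'a \<times> real \<times> real" where
  "nform X P = (case P of (s, a, b) \<Rightarrow>
     let r = (if a = 1 then right X s else s) in (if b = 1 then upper X r else r, wrap a, wrap b))"

definition corner :: "'a \<times> real \<times> real \<Rightarrow> bool" where
  "corner P \<longleftrightarrow> fst (snd P) \<in> {0, 1} \<and> snd (snd P) \<in> {0, 1}"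

definition open_square :: "(real \<times> real) set" where "open_square = {0<..<1} \<times> {0<..<1}"

lemma open_square_subset: "open_square \<subseteq> unit_square" by (auto simp: open_square_def unit_square_def)

lemma snd_nform: "snd (nform X (s, a, b)) = (wrap a, wrap b)"
  by (simp add: nform_def Let_def)

lemma torus_point_eqD:
  assumes "torus_point z = torus_point z'" "z \<in> unit_square" "z' \<in> unit_square"
  shows "wrap (fst z) = wrap (fst z')" "wrap (snd z) = wrap (snd z')"
proof -
  have "z \<in> torus_point z" by (simp add: torus_point_def)
  then have "z \<in> torus_point z'" using assms(1) by simp
  then have i: "fst z - fst z' \<in> \<int>" "snd z - snd z' \<in> \<int>" by (auto simp: torus_point_def)
  have "wrap a = wrap b" if ab: "a - b \<in> \<int>" "a \<in> {0..1}" "b \<in> {0..1}" for a b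
  proof -
    obtain k :: int where k: "a - b = of_int k" using ab(1) by (auto simp: Ints_def)
    have "\<bar>of_int k\<bar> \<le> (1::real)" using k[symmetric] ab by auto
    then have "\<bar>k\<bar> \<le> 1" by (metis of_int_abs of_int_le_1_iff)
    then consider "k = -1" | "k = 0" | "k = 1" by linarith
    then show ?thesis using k ab by cases (auto simp: wrap_def)
  qed
  then show "wrap (fst z) = wrap (fst z')" "wrap (snd z) = wrap (snd z')"
    using i assms(2,3) by (auto simp: unit_square_def)
qed

lemma torus_point_eqI:
  assumes "wrap a = wrap c" "wrap b = wrap d"
  shows "torus_point (a, b) = torus_point (c, d)"
proof -
  have "x - y \<in> \<int>" if "wrap x = wrap y" for x y :: real
    using that by (auto simp: wrap_def split: if_splits)
  from this[OF assms(1)] this[OF assms(2)] obtain k l :: int where "a = c + of_int k" "b = d + of_int l"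
    by (auto simp: Ints_def algebra_simps)
  moreover have "x - (c + of_int k) \<in> \<int> \<longleftrightarrow> x - c \<in> \<int>" for x c :: real and k :: int
    by (metis (no_types, lifting) Ints_add Ints_diff Ints_of_int add_diff_cancel_left' diff_diff_eq diff_add_cancel)
  ultimately show ?thesis by (auto simp: torus_point_def)
qed

section \<open>Normal forms of glued points\<close>

locale origami_surface =
  fixes X :: "'a origami"
  assumes origami: "origami X"
begin

abbreviation "S \<equiv> squares X"
abbreviation "R \<equiv> right X"
abbreviation "U \<equiv> upper X"
abbreviation "T \<equiv> S \<times> unit_square"
abbreviation "pr \<equiv> glue_proj X"
abbreviation "glued \<equiv> equivclp (edge_glued X)"

lemma finite_S: "finite S" and S_ne: "S \<noteq> {}" and R_bij: "bij_betw R S S" and U_bij: "bij_betw U S S"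
  using origami by (auto simp: origami_def)

lemma R_S: "s \<in> S \<Longrightarrow> R s \<in> S" and U_S: "s \<in> S \<Longrightarrow> U s \<in> S"
  using R_bij U_bij by (auto simp: bij_betw_def)

lemma edge_glued_T: "edge_glued X P Q \<Longrightarrow> P \<in> T \<and> Q \<in> T"
  by (auto simp: unit_square_def R_S U_S elim!: edge_glued.cases)

lemma nform_T: "P \<in> T \<Longrightarrow> nform X P \<in> T"
  by (auto simp: nform_def Let_def wrap_def unit_square_def R_S U_S)

lemma glued_edge: "edge_glued X P Q \<Longrightarrow> glued P Q"
  by (rule r_into_equivclp)

lemma glued_nform: assumes "P \<in> T" shows "glued P (nform X P)"
proof -
  obtain s a b where P: "P = (s, a, b)" by (cases P)
  have s: "s \<in> S" "a \<in> {0..1}" "b \<in> {0..1}" using assms P by (auto simp: unit_square_def)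
  define r where "r = (if a = 1 then R s else s)"
  have 1: "glued (s, a, b) (r, wrap a, b)"
    using glued_edge[OF edge_glued.vertical[OF s(1,3)]] by (simp add: r_def wrap_def)
  have "r \<in> S" "wrap a \<in> {0..1}" using s R_S by (auto simp: r_def wrap_def)
  then have 2: "glued (r, wrap a, b) (if b = 1 then U r else r, wrap a, wrap b)"
    using glued_edge[OF edge_glued.horizontal, of r "wrap a"] by (auto simp: wrap_def)
  from equivclp_trans[OF 1 2] show ?thesis unfolding P nform_def Let_def r_def by (simp only: prod.case)
qed

text \<open>Corners are excluded in the last claim because going right and then up may lead to
  another square than going up and then right.\<close>

lemma edge_glued_nform:
  assumes "edge_glued X P Q"
  shows "snd (nform X P) = snd (nform X Q)" "corner P \<longleftrightarrow> corner Q"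
    "\<not> corner P \<Longrightarrow> nform X P = nform X Q"
  using assms by (auto simp: nform_def wrap_def corner_def Let_def elim!: edge_glued.cases)

lemma glued_induct:
  assumes "glued P Q" "I P" "\<And>A B. edge_glued X A B \<Longrightarrow> I A \<longleftrightarrow> I B" shows "I Q"
  using assms(1,2) by (induction rule: equivclp_induct) (use assms(3) in auto)

lemma glued_T: assumes "glued P Q" "P \<in> T" shows "Q \<in> T"
  using assms by (rule glued_induct) (auto dest: edge_glued_T)

lemma glued_snd_nform: assumes "glued P Q" shows "snd (nform X P) = snd (nform X Q)"
  using assms by (rule glued_induct[where I = "\<lambda>Q. snd (nform X P) = snd (nform X Q)"])
    (auto dest: edge_glued_nform)

lemma glued_corner: assumes "glued P Q" shows "corner P \<longleftrightarrow> corner Q"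
  using assms by (rule glued_induct[where I = "\<lambda>Q. corner P \<longleftrightarrow> corner Q"]) (auto dest: edge_glued_nform)

lemma glued_nform_eq:
  assumes "glued P Q" "\<not> corner P" shows "nform X P = nform X Q"
proof -
  have "\<not> corner Q \<and> nform X P = nform X Q"
    by (rule glued_induct[OF assms(1), where I = "\<lambda>Q. \<not> corner Q \<and> nform X P = nform X Q"])
      (use assms edge_glued_nform in metis)+
  then show ?thesis by simp
qed

lemma pr_iff: "P \<in> T \<Longrightarrow> Q \<in> pr P \<longleftrightarrow> glued P Q"
  unfolding glue_proj_def gluing_def Image_singleton mem_Collect_eq prod.case
  using glued_T by blast

lemma pr_eq_iff: "P \<in> T \<Longrightarrow> Q \<in> T \<Longrightarrow> pr P = pr Q \<longleftrightarrow> glued P Q"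
  using eq_equiv_class_iff[OF equiv_gluing, of P X Q]
  unfolding glue_proj_def gluing_def mem_Collect_eq prod.case by blast

lemma pr_points: "P \<in> T \<Longrightarrow> pr P \<in> surface_points X"
  by (auto simp: glue_proj_def surface_points_def quotient_def)

lemma points_pr: "Q \<in> surface_points X \<Longrightarrow> \<exists>P\<in>T. Q = pr P"
  by (auto simp: glue_proj_def surface_points_def quotient_def)

lemma covering_pr:
  assumes "(s, z) \<in> T" shows "covering X (pr (s, z)) = torus_point z"
proof -
  have "torus_point z' = torus_point z" if "(t, z') \<in> pr (s, z)" for t z'
  proof -
    have "snd (nform X (s, z)) = snd (nform X (t, z'))"
      using that assms pr_iff glued_snd_nform by blast
    then have "wrap (fst z) = wrap (fst z')" "wrap (snd z) = wrap (snd z')"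
      by (cases z; cases z'; simp add: snd_nform)+
    from torus_point_eqI[OF this] show ?thesis by simp
  qed
  moreover have "(s, z) \<in> pr (s, z)" using assms by (simp add: pr_iff)
  ultimately show ?thesis by (force simp: covering_def)
qed

lemma nform_open_square:
  assumes "nform X P = (t, z)" "z \<in> open_square" shows "P = (t, z)"
  using assms by (cases P) (auto simp: nform_def Let_def wrap_def open_square_def split: if_splits)

lemma pr_open_square:
  assumes P: "P \<in> T" and t: "t \<in> S" and z: "z \<in> open_square" and eq: "pr P = pr (t, z)"
  shows "P = (t, z)"
proof -
  have tz: "(t, z) \<in> T" using t z open_square_subset by auto
  have "\<not> corner (t, z)" using z by (auto simp: corner_def open_square_def)
  moreover have "nform X (t, z) = (t, z)" using z by (auto simp: nform_def wrap_def open_square_def)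
  ultimately have "nform X P = (t, z)"
    using glued_nform_eq[of "(t, z)" P] eq pr_eq_iff[OF P tz] equivclp_sym by metis
  then show ?thesis using nform_open_square z by blast
qed

section \<open>Open sets of the surface\<close>

lemma openin_squares:
  "openin (disjoint_squares X) W \<longleftrightarrow>
     W \<subseteq> T \<and> (\<forall>s\<in>S. openin (top_of_set unit_square) {z. (s, z) \<in> W})" (is "?L \<longleftrightarrow> ?R")
proof
  assume L: ?L
  have "W \<subseteq> T" using openin_subset[OF L] by (simp add: disjoint_squares_def)
  moreover have "openin (top_of_set unit_square) {z. (s, z) \<in> W}" if "s \<in> S" for s
  proof (subst openin_subopen, intro ballI)
    fix z assume "z \<in> {z. (s, z) \<in> W}"
    then have "(s, z) \<in> W" by simp
    from L[unfolded disjoint_squares_def openin_prod_topology_alt, rule_format, OF this]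
    obtain A V where V: "openin (top_of_set unit_square) V" "s \<in> A" "z \<in> V" "A \<times> V \<subseteq> W"
      by (elim exE conjE)
    then have "V \<subseteq> {z. (s, z) \<in> W}" by auto
    then show "\<exists>V. openin (top_of_set unit_square) V \<and> z \<in> V \<and> V \<subseteq> {z. (s, z) \<in> W}"
      using V(1,3) by (intro exI conjI)
  qed
  ultimately show ?R by blast
next
  assume R: ?R
  show ?L unfolding disjoint_squares_def openin_prod_topology_alt
  proof (intro allI impI)
    fix s z assume sz: "(s, z) \<in> W"
    then have s: "s \<in> S" using R by auto
    then have "openin (top_of_set unit_square) {z. (s, z) \<in> W}" using R by (elim conjE) (rule bspec)
    moreover have "{s} \<times> {z. (s, z) \<in> W} \<subseteq> W" by auto
    moreover have "openin (discrete_topology S) {s}" using s by simp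
    ultimately show "\<exists>A V. openin (discrete_topology S) A \<and> openin (top_of_set unit_square) V \<and>
        s \<in> A \<and> z \<in> V \<and> A \<times> V \<subseteq> W"
      using sz by (intro exI[of _ "{s}"] exI[of _ "{z. (s, z) \<in> W}"] conjI) simp_all
  qed
qed

lemma topspace_squares: "topspace (disjoint_squares X) = T"
  by (simp add: disjoint_squares_def)

lemma openin_surfaceI:
  assumes W: "W \<subseteq> T" and sat: "\<And>P Q. P \<in> W \<Longrightarrow> glued P Q \<Longrightarrow> Q \<in> W"
    and op: "\<And>s. s \<in> S \<Longrightarrow> openin (top_of_set unit_square) {z. (s, z) \<in> W}"
  shows "openin (surface X) (pr ` W)"
proof -
  have "{P \<in> T. pr P \<in> pr ` W} = W"
  proof (intro equalityI subsetI)
    fix P assume P: "P \<in> {P \<in> T. pr P \<in> pr ` W}"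
    then have "pr P \<in> pr ` W" by simp
    then obtain Q where Q: "Q \<in> W" "pr P = pr Q" by (rule imageE)
    then have "glued Q P" using pr_eq_iff[of Q P] P W by blast
    then show "P \<in> W" using sat Q by blast
  qed (use W in auto)
  then show ?thesis
    using W op by (auto simp: surface_def openin_quotient_topology topspace_squares openin_squares)
qed

lemma continuous_map_square:
  assumes "s \<in> S" shows "continuous_map (top_of_set unit_square) (surface X) (\<lambda>z. pr (s, z))"
  unfolding continuous_map_def
proof (intro conjI allI impI)
  show "(\<lambda>z. pr (s, z)) \<in> topspace (top_of_set unit_square) \<rightarrow> topspace (surface X)"
    using assms pr_points by (auto simp: topspace_surface)
  fix V assume "openin (surface X) V"
  then have "openin (disjoint_squares X) {P \<in> T. pr P \<in> V}"
    by (simp add: surface_def openin_quotient_topology topspace_squares)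
  then have "openin (top_of_set unit_square) {z. (s, z) \<in> {P \<in> T. pr P \<in> V}}"
    using assms unfolding openin_squares by blast
  then show "openin (top_of_set unit_square) {z \<in> topspace (top_of_set unit_square). pr (s, z) \<in> V}"
    using assms by simp
qed

text \<open>A neighbourhood of a point of the surface, as a set of points of the squares.  It is saturated
  since \<open>\<epsilon>\<close> is at most the distance of the point from the edges it does not lie on.\<close>

lemma small_neighbourhood_saturated:
  assumes z: "z \<in> unit_square" and Q: "Q = pr (r0, z0)" "(r0, z0) \<in> T" "torus_point z0 = torus_point z"
    and e: "0 < \<epsilon>" "\<epsilon> \<le> 1 / 4" "\<And>c. c \<in> {fst z, snd z} \<Longrightarrow> c \<notin> {0, 1} \<Longrightarrow> \<epsilon> \<le> c \<and> \<epsilon> \<le> 1 - c"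
  defines "W \<equiv> {(r, w). r \<in> S \<and> w \<in> unit_square \<and> (\<exists>z'. (r, z') \<in> Q \<and> dist w z' < \<epsilon>)}"
  shows "P \<in> W \<Longrightarrow> glued P P' \<Longrightarrow> P' \<in> W"
proof -
  have z0: "z0 \<in> unit_square" using Q by simp
  have coords: "wrap x = wrap (fst z)" "wrap y = wrap (snd z)" "x \<in> {0..1}" "y \<in> {0..1}" "r \<in> S"
    if "(r, x, y) \<in> Q" for r x y
  proof -
    have g: "glued (r0, z0) (r, x, y)" using that Q pr_iff by simp
    then have "snd (nform X (r, x, y)) = snd (nform X (r0, fst z0, snd z0))"
      using glued_snd_nform by fastforce
    then show "wrap x = wrap (fst z)" "wrap y = wrap (snd z)"
      using torus_point_eqD[OF Q(3) z0 z] by (cases z0; simp add: snd_nform)+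
    show "x \<in> {0..1}" "y \<in> {0..1}" "r \<in> S" using glued_T[OF g Q(2)] by (auto simp: unit_square_def)
  qed
  have move: "P' \<in> Q" if "P \<in> Q" "glued P P'" for P P'
    using that Q pr_iff equivclp_trans by metis
  \<comment> \<open>A representative close to an edge lies on it, so it can be carried across the
    gluing together with the nearby point of \<open>W\<close>.\<close>
  have edge: "x = l" if "wrap x = wrap c" "x \<in> {0..1}" "c \<in> {fst z, snd z}" "l \<in> {0, 1}" "\<bar>l - x\<bar> < \<epsilon>" for x c l
  proof -
    show ?thesis
    proof (cases "c \<in> {0, 1}")
      case True
      then have "wrap x = 0" using that(1) by (auto simp: wrap_def)
      then have "x = 0 \<or> x = 1" by (auto simp: wrap_def split: if_splits)
      then show ?thesis using that(4,5) e(2) by auto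
    next
      case False
      then have c: "\<epsilon> \<le> c" "\<epsilon> \<le> 1 - c" using e(3)[OF that(3)] by auto
      have "x = c" using that(1) False by (auto simp: wrap_def split: if_splits)
      then show ?thesis using that(4,5) c by auto
    qed
  qed
  have near: "\<bar>a - x\<bar> < \<epsilon>" "\<bar>b - y\<bar> < \<epsilon>" if "dist (a, b) (x, y) < \<epsilon>" for a b x y :: real
    using that dist_fst_le[of "(a, b)" "(x, y)"] dist_snd_le[of "(a, b)" "(x, y)"]
    by (auto simp: dist_real_def)
  have dist1: "dist (a, b) (a, y) = \<bar>b - y\<bar>" "dist (b, a) (y, a) = \<bar>b - y\<bar>" for a b y :: real
    by (simp_all add: dist_Pair_Pair dist_real_def)
  have memW: "(r, w) \<in> W" if "r \<in> S" "w \<in> unit_square" "(r, z') \<in> Q" "dist w z' < \<epsilon>" for r w z'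
    using that by (auto simp only: W_def)
  have iff: "P \<in> W \<longleftrightarrow> P' \<in> W" if E: "edge_glued X P P'" for P P'
    using E
  proof cases
    case (vertical s b)
    have T: "R s \<in> S" "(1, b) \<in> unit_square" "(0, b) \<in> unit_square" using vertical R_S by (auto simp: unit_square_def)
    have g: "glued (s, 1, y) (R s, 0, y)" if "y \<in> {0..1}" for y
      using glued_edge edge_glued.vertical vertical that by metis
    show ?thesis
    proof
      assume "P \<in> W"
      then obtain x y where xy: "(s, x, y) \<in> Q" "dist (1, b) (x, y) < \<epsilon>" using vertical by (auto simp: W_def)
      have "x = 1" using edge[OF coords(1)[OF xy(1)] coords(3)[OF xy(1)], of 1] near(1)[OF xy(2)] by simp
      then have q: "(R s, 0, y) \<in> Q" using move[OF _ g] xy coords(4)[OF xy(1)] by simp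
      show "P' \<in> W" using memW[OF T(1,3) q] near(2)[OF xy(2)] dist1(1)[of 0 b y] vertical by simp
    next
      assume "P' \<in> W"
      then obtain x y where xy: "(R s, x, y) \<in> Q" "dist (0, b) (x, y) < \<epsilon>" using vertical by (auto simp: W_def)
      have "x = 0" using edge[OF coords(1)[OF xy(1)] coords(3)[OF xy(1)], of 0] near(1)[OF xy(2)] by simp
      then have q: "(s, 1, y) \<in> Q" using move[OF _ equivclp_sym[OF g]] xy coords(4)[OF xy(1)] by simp
      show "P \<in> W" using memW[OF _ T(2) q] near(2)[OF xy(2)] dist1(1)[of 1 b y] vertical by simp
    qed
  next
    case (horizontal s a)
    have T: "U s \<in> S" "(a, 1) \<in> unit_square" "(a, 0) \<in> unit_square" using horizontal U_S by (auto simp: unit_square_def)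
    have g: "glued (s, x, 1) (U s, x, 0)" if "x \<in> {0..1}" for x
      using glued_edge edge_glued.horizontal horizontal that by metis
    show ?thesis
    proof
      assume "P \<in> W"
      then obtain x y where xy: "(s, x, y) \<in> Q" "dist (a, 1) (x, y) < \<epsilon>" using horizontal by (auto simp: W_def)
      have "y = 1" using edge[OF coords(2)[OF xy(1)] coords(4)[OF xy(1)], of 1] near(2)[OF xy(2)] by simp
      then have q: "(U s, x, 0) \<in> Q" using move[OF _ g] xy coords(3)[OF xy(1)] by simp
      show "P' \<in> W" using memW[OF T(1,3) q] near(1)[OF xy(2)] dist1(2)[of a 0 x] horizontal by simp
    next
      assume "P' \<in> W"
      then obtain x y where xy: "(U s, x, y) \<in> Q" "dist (a, 0) (x, y) < \<epsilon>" using horizontal by (auto simp: W_def)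
      have "y = 0" using edge[OF coords(2)[OF xy(1)] coords(4)[OF xy(1)], of 0] near(2)[OF xy(2)] by simp
      then have q: "(s, x, 1) \<in> Q" using move[OF _ equivclp_sym[OF g]] xy coords(3)[OF xy(1)] by simp
      show "P \<in> W" using memW[OF _ T(2) q] near(1)[OF xy(2)] dist1(2)[of a 1 x] horizontal by simp
    qed
  qed
  assume "P \<in> W" "glued P P'"
  from this(2,1) show "P' \<in> W" by (rule glued_induct) (rule iff)
qed

section \<open>Deck transformations take squares to squares\<close>

lemma deck_point:
  assumes "f \<in> carrier (deck_group X)" "s \<in> S" "z \<in> unit_square"
  shows "\<exists>r z0. f (pr (s, z)) = pr (r, z0) \<and> (r, z0) \<in> T \<and> torus_point z0 = torus_point z"
proof -
  have sz: "pr (s, z) \<in> surface_points X" using assms by (intro pr_points) auto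
  have "f \<in> Bij (surface_points X)" using assms(1) by (simp add: deck_group_def)
  then have "f (pr (s, z)) \<in> surface_points X" using sz Bij_imp_funcset by blast
  then obtain P where P: "P \<in> T" "f (pr (s, z)) = pr P" using points_pr by blast
  moreover have "covering X (f (pr (s, z))) = covering X (pr (s, z))" using assms(1) sz by (simp add: deck_group_def)
  ultimately show ?thesis using covering_pr assms by (cases P) auto
qed

lemma continuous_deck:
  assumes "f \<in> carrier (deck_group X)" "s \<in> S"
  shows "continuous_map (top_of_set unit_square) (surface X) (\<lambda>z. f (pr (s, z)))"
proof -
  have "continuous_map (surface X) (surface X) f"
    using assms(1) by (auto simp: deck_group_def homeomorphic_eq_everything_map)
  from continuous_map_compose[OF continuous_map_square[OF assms(2)] this] show ?thesis by (simp add: o_def)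
qed

text \<open>As \<open>f\<close> preserves the covering, interior points keep their coordinates. The
  sets \<open>A t\<close> of points sent to the square \<open>t\<close> are disjoint, relatively
  open and cover the open square, so by connectedness one of them is everything.\<close>

lemma deck_open_square:
  assumes f: "f \<in> carrier (deck_group X)" and s: "s \<in> S"
  shows "\<exists>t\<in>S. \<forall>z\<in>open_square. f (pr (s, z)) = pr (t, z)"
proof -
  define A where "A t = {z \<in> open_square. f (pr (s, z)) = pr (t, z)}" for t
  have ex: "\<exists>t\<in>S. z \<in> A t" if z: "z \<in> open_square" for z
  proof -
    have zu: "z \<in> unit_square" using z open_square_subset by auto
    obtain r z0 where r: "f (pr (s, z)) = pr (r, z0)" "(r, z0) \<in> T" "torus_point z0 = torus_point z"
      using deck_point[OF f s zu] by blast
    have "wrap (fst z0) = fst z" "wrap (snd z0) = snd z"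
      using torus_point_eqD[OF r(3) _ zu] r(2) z by (auto simp: open_square_def wrap_def)
    then have "z0 = z" using z by (cases z0; cases z) (auto simp: wrap_def open_square_def split: if_splits)
    then show ?thesis using r z by (auto simp: A_def)
  qed
  have disj: "A t \<inter> A t' = {}" if "t \<noteq> t'" "t \<in> S" "t' \<in> S" for t t'
  proof (rule equals0I)
    fix z assume z: "z \<in> A t \<inter> A t'"
    then have "pr (t, z) = pr (t', z)" "z \<in> open_square" by (auto simp: A_def)
    then have "(t, z) = (t', z)" using that open_square_subset by (intro pr_open_square) auto
    then show False using that by simp
  qed
  have op: "openin (top_of_set open_square) (A t)" if t: "t \<in> S" for t
  proof -
    have oi: "openin (top_of_set unit_square) open_square"
      using open_square_subset by (intro open_subset) (auto simp: open_square_def intro!: open_Times)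
    have "openin (surface X) (pr ` ({t} \<times> open_square))"
    proof (rule openin_surfaceI)
      show "{t} \<times> open_square \<subseteq> T" using t open_square_subset by auto
      show "Q \<in> {t} \<times> open_square" if PQ: "P \<in> {t} \<times> open_square" "glued P Q" for P Q
      proof -
        have P: "P \<in> T" using PQ t open_square_subset by auto
        then have "pr Q = pr P" using PQ glued_T pr_eq_iff by metis
        then have "Q = P" using PQ t pr_open_square[of Q t "snd P"] glued_T[OF PQ(2) P] by auto
        then show ?thesis using PQ by simp
      qed
      show "openin (top_of_set unit_square) {z. (s', z) \<in> {t} \<times> open_square}" for s'
        using oi by (cases "s' = t") auto
    qed
    then have "openin (top_of_set unit_square)
        {z \<in> topspace (top_of_set unit_square). f (pr (s, z)) \<in> pr ` ({t} \<times> open_square)}"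
      using continuous_deck[OF f s] unfolding continuous_map_def by blast
    then obtain V where V: "open V"
      "{z \<in> unit_square. f (pr (s, z)) \<in> pr ` ({t} \<times> open_square)} = unit_square \<inter> V"
      by (auto simp: openin_open)
    then have "open_square \<inter> {z \<in> unit_square. f (pr (s, z)) \<in> pr ` ({t} \<times> open_square)} = open_square \<inter> V"
      using open_square_subset by blast
    then have o: "openin (top_of_set open_square)
        (open_square \<inter> {z \<in> unit_square. f (pr (s, z)) \<in> pr ` ({t} \<times> open_square)})"
      using openin_open_Int[OF V(1)] by simp
    have "open_square \<inter> {z \<in> unit_square. f (pr (s, z)) \<in> pr ` ({t} \<times> open_square)} = A t"
    proof (intro equalityI subsetI)
      fix z assume z: "z \<in> open_square \<inter> {z \<in> unit_square. f (pr (s, z)) \<in> pr ` ({t} \<times> open_square)}"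
      then obtain z' where z': "z' \<in> open_square" "f (pr (s, z)) = pr (t, z')" by auto
      obtain t' where t': "t' \<in> S" "z \<in> A t'" using ex[of z] z by blast
      then have "pr (t', z) = pr (t, z')" using z' by (simp add: A_def)
      then have "(t', z) = (t, z')" using t' z t z' open_square_subset by (intro pr_open_square) auto
      then show "z \<in> A t" using t' by simp
    qed (use open_square_subset in \<open>auto simp: A_def\<close>)
    then show ?thesis using o by simp
  qed
  have conn: "connected open_square" unfolding open_square_def by (intro connected_Times) auto
  have half: "(1/2, 1/2) \<in> open_square" by (simp add: open_square_def)
  obtain t where t: "t \<in> S" "(1/2, 1/2) \<in> A t" using ex[OF half] by blast
  let ?B = "\<Union>t'\<in>S - {t}. A t'"
  have B: "openin (top_of_set open_square) ?B" using op by (intro openin_Union) auto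
  have "?B = {}"
  proof (rule ccontr)
    assume Bne: "?B \<noteq> {}"
    have 1: "A t \<inter> ?B = {}" using disj t by blast
    have 2: "open_square \<subseteq> A t \<union> ?B" using ex by blast
    have 3: "A t \<noteq> {}" using t(2) by blast
    show False using conn[unfolded connected_openin] op[OF t(1)] B 1 2 3 Bne by metis
  qed
  then have "open_square \<subseteq> A t" using ex by blast
  then show ?thesis using t by (auto simp: A_def)
qed

lemma open_square_dense:
  assumes "z \<in> unit_square" "0 < \<delta>" shows "\<exists>w\<in>open_square. dist w z < \<delta>"
proof -
  \<comment> \<open>The point \<open>z\<close> is moved towards the centre (1/2, 1/2) by the ratio
    \<open>\<eta>\<close>.\<close>
  define \<eta> where "\<eta> = min (1/2) (\<delta> / 2)"
  have \<eta>: "0 < \<eta>" "\<eta> \<le> 1/2" "\<eta> < \<delta>" using assms by (auto simp: \<eta>_def)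
  obtain a b where z: "z = (a, b)" by (cases z)
  have ab: "0 \<le> a" "a \<le> 1" "0 \<le> b" "b \<le> 1" using assms z by (auto simp: unit_square_def)
  have "0 < c + \<eta> * (1/2 - c) \<and> c + \<eta> * (1/2 - c) < 1 \<and> \<bar>c + \<eta> * (1/2 - c) - c\<bar> \<le> \<eta> / 2" if c: "0 \<le> c" "c \<le> 1" for c
  proof -
    have eq: "c + \<eta> * (1/2 - c) = (1 - \<eta>) * c + \<eta> / 2" by (simp add: algebra_simps)
    have k: "0 \<le> (1 - \<eta>) * c" "(1 - \<eta>) * c \<le> 1 - \<eta>"
      using \<eta> c mult_left_mono[of c 1 "1 - \<eta>"] by auto
    have "\<bar>1/2 - c\<bar> \<le> 1/2" using c by (simp add: abs_if)
    then have "\<bar>\<eta> * (1/2 - c)\<bar> \<le> \<eta> * (1/2)" unfolding abs_mult using \<eta> by (intro mult_mono) auto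
    then have "\<bar>c + \<eta> * (1/2 - c) - c\<bar> \<le> \<eta> / 2" by simp
    moreover have "0 < c + \<eta> * (1/2 - c)" unfolding eq using k \<eta> by linarith
    moreover have "c + \<eta> * (1/2 - c) < 1" unfolding eq using k \<eta> by linarith
    ultimately show ?thesis by simp
  qed
  from this[OF ab(1,2)] this[OF ab(3,4)] have *: "(a + \<eta> * (1/2 - a), b + \<eta> * (1/2 - b)) \<in> open_square"
    "dist (a + \<eta> * (1/2 - a)) a \<le> \<eta> / 2" "dist (b + \<eta> * (1/2 - b)) b \<le> \<eta> / 2"
    by (auto simp: open_square_def dist_real_def)
  have "dist (a + \<eta> * (1/2 - a), b + \<eta> * (1/2 - b)) (a, b) \<le> \<eta>"
    unfolding dist_Pair_Pair using sqrt_sum_squares_le_sum[of "dist (a + \<eta> * (1/2 - a)) a" "dist (b + \<eta> * (1/2 - b)) b"] * by auto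
  then show ?thesis using *(1) \<eta> z by (auto intro!: bexI[of _ "(a + \<eta> * (1/2 - a), b + \<eta> * (1/2 - b))"])
qed

text \<open>Continuity at the boundary: interior points \<open>w\<close> close to \<open>z\<close>
  go to (t, w) and into a small neighbourhood of the class \<open>?Q\<close>, so \<open>?Q\<close>
  has a representative (t, z') close to \<open>w\<close>. It agrees with \<open>z\<close> modulo the
  lattice and has distance less than 1 from it, whence z' = z.\<close>

lemma deck_square:
  assumes f: "f \<in> carrier (deck_group X)" and s: "s \<in> S"
  shows "\<exists>t\<in>S. \<forall>z\<in>unit_square. f (pr (s, z)) = pr (t, z)"
proof -
  obtain t where t: "t \<in> S" "\<And>z. z \<in> open_square \<Longrightarrow> f (pr (s, z)) = pr (t, z)" using deck_open_square[OF f s] by blast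
  have "f (pr (s, z)) = pr (t, z)" if z: "z \<in> unit_square" for z
  proof -
    let ?Q = "f (pr (s, z))"
    obtain r0 z0 where Q: "?Q = pr (r0, z0)" "(r0, z0) \<in> T" "torus_point z0 = torus_point z"
      using deck_point[OF f s z] by blast
    \<comment> \<open>The distance of a coordinate from the edges it does not lie on, capped at 1/4
      so that opposite edges stay apart.\<close>
    define m where "m c = (if c \<in> {0, 1} then 1/4 else min (1/4) (min c (1 - c)))" for c :: real
    define \<epsilon> where "\<epsilon> = min (m (fst z)) (m (snd z))"
    have "0 < m c \<and> m c \<le> 1/4" if "c \<in> {0..1}" for c using that by (auto simp: m_def min_def)
    then have "0 < m (fst z) \<and> m (fst z) \<le> 1/4" "0 < m (snd z)" using z by (auto simp: unit_square_def)
    then have e: "0 < \<epsilon>" "\<epsilon> \<le> 1/4" by (auto simp: \<epsilon>_def min_def)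
    have e': "\<epsilon> \<le> c \<and> \<epsilon> \<le> 1 - c" if "c \<in> {fst z, snd z}" "c \<notin> {0, 1}" for c
      using that by (auto simp: \<epsilon>_def m_def)
    define W where "W = {(r, w). r \<in> S \<and> w \<in> unit_square \<and> (\<exists>z'. (r, z') \<in> ?Q \<and> dist w z' < \<epsilon>)}"
    have WT: "W \<subseteq> T" by (auto simp: W_def)
    have sat: "P' \<in> W" if "P \<in> W" "glued P P'" for P P'
      using small_neighbourhood_saturated[OF z Q e e', of P P'] that by (simp add: W_def)
    have "openin (surface X) (pr ` W)"
    proof (rule openin_surfaceI[OF WT sat])
      fix r assume r: "r \<in> S"
      have "w \<in> (\<Union>z'\<in>{z'. (r, z') \<in> ?Q}. ball z' \<epsilon>) \<longleftrightarrow> (\<exists>z'. (r, z') \<in> ?Q \<and> dist w z' < \<epsilon>)" for w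
        by (simp only: UN_iff mem_Collect_eq mem_ball dist_commute Bex_def)
      then have "{w. (r, w) \<in> W} = unit_square \<inter> (\<Union>z'\<in>{z'. (r, z') \<in> ?Q}. ball z' \<epsilon>)"
        using r unfolding W_def by blast
      moreover have "open (\<Union>z'\<in>{z'. (r, z') \<in> ?Q}. ball z' \<epsilon>)" by (intro open_UN ballI open_ball)
      ultimately show "openin (top_of_set unit_square) {w. (r, w) \<in> W}"
        using openin_open_Int by (simp only:)
    qed
    then have o: "openin (top_of_set unit_square) {w \<in> topspace (top_of_set unit_square). f (pr (s, w)) \<in> pr ` W}"
      using continuous_deck[OF f s] unfolding continuous_map_def by blast
    define B where "B = {w \<in> unit_square. f (pr (s, w)) \<in> pr ` W}"
    have oB: "openin (top_of_set unit_square) B" using o by (simp add: B_def)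
    have "(r0, z0) \<in> ?Q" using Q by (simp add: pr_iff)
    moreover have "dist z0 z0 < \<epsilon>" using e by simp
    ultimately have "(r0, z0) \<in> W" using Q(2) unfolding W_def by blast
    then have "z \<in> B" using z Q by (auto simp: B_def)
    then obtain \<delta> where "0 < \<delta>" and B: "\<And>w. w \<in> unit_square \<Longrightarrow> dist w z < \<delta> \<Longrightarrow> w \<in> B"
      using oB unfolding openin_euclidean_subtopology_iff by blast
    then have d: "0 < \<delta>" "\<And>w. w \<in> unit_square \<Longrightarrow> dist w z < \<delta> \<Longrightarrow> f (pr (s, w)) \<in> pr ` W"
      by (auto simp: B_def)
    obtain w where w: "w \<in> open_square" "dist w z < min \<delta> \<epsilon>" using open_square_dense[OF z, of "min \<delta> \<epsilon>"] d e by auto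
    have wu: "w \<in> unit_square" using w open_square_subset by auto
    have "pr (t, w) \<in> pr ` W" using d(2)[OF wu] w t(2)[OF w(1)] by simp
    then obtain P where P: "P \<in> W" "pr P = pr (t, w)" by auto
    then have "P = (t, w)" using pr_open_square[OF _ t(1) w(1), of P] WT by auto
    then obtain z' where z': "(t, z') \<in> ?Q" "dist w z' < \<epsilon>" using P by (auto simp: W_def)
    have g: "glued (r0, z0) (t, z')" using z' Q pr_iff by simp
    have z'u: "z' \<in> unit_square" using glued_T[OF g Q(2)] by simp
    have "snd (nform X (t, z')) = snd (nform X (r0, z0))" using glued_snd_nform[OF g] by simp
    then have wr: "wrap (fst z') = wrap (fst z)" "wrap (snd z') = wrap (snd z)"
      using torus_point_eqD[OF Q(3) _ z] Q(2) by (cases z'; cases z0; auto simp: snd_nform)+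
    have "dist z' z \<le> dist w z' + dist w z" by (metis dist_commute dist_triangle)
    then have dz: "dist z' z < 1" using z' w e by auto
    then have "\<bar>fst z' - fst z\<bar> < 1" "\<bar>snd z' - snd z\<bar> < 1"
      using dist_fst_le[of z' z] dist_snd_le[of z' z] by (auto simp: dist_real_def)
    then have "fst z' = fst z" "snd z' = snd z"
      using wr z z'u by (auto simp: wrap_def unit_square_def split: if_splits)
    then have "z' = z" by (simp add: prod_eq_iff)
    then have "glued (r0, z0) (t, z)" using g by simp
    then show ?thesis using Q pr_eq_iff[OF Q(2), of "(t, z)"] t z by simp
  qed
  then show ?thesis using t by blast
qed

text \<open>By finiteness \<open>A\<close> is closed under left and lower neighbours too, so the
  squares in \<open>A\<close> and those outside it form disjoint saturated open sets.\<close>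

lemma connected_squares:
  assumes A: "A \<subseteq> S" "A \<noteq> {}" "\<And>s. s \<in> A \<Longrightarrow> R s \<in> A" "\<And>s. s \<in> A \<Longrightarrow> U s \<in> A"
  shows "A = S"
proof (rule ccontr)
  assume "A \<noteq> S"
  have mem_iff: "g s \<in> A \<longleftrightarrow> s \<in> A" if g: "bij_betw g S S" "\<And>s. s \<in> A \<Longrightarrow> g s \<in> A" and s: "s \<in> S" for g s
  proof
    assume "g s \<in> A"
    have inj: "inj_on g A" using g(1) A(1) by (meson bij_betw_imp_inj_on inj_on_subset)
    have "g ` A = A" using g(2) finite_subset[OF A(1) finite_S] inj by (intro endo_inj_surj) auto
    then obtain s' where "s' \<in> A" "g s' = g s" using \<open>g s \<in> A\<close> by (metis imageE)
    then show "s \<in> A" using g(1) s A(1) by (metis bij_betw_imp_inj_on inj_onD subsetD)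
  qed (use g in auto)
  have "fst P \<in> A \<longleftrightarrow> fst Q \<in> A" if "edge_glued X P Q" for P Q
    using that mem_iff[OF R_bij A(3)] mem_iff[OF U_bij A(4)] by cases auto
  then have inv: "fst P \<in> A \<longleftrightarrow> fst Q \<in> A" if "glued P Q" for P Q
    using that by (rule_tac glued_induct[where I = "\<lambda>Q. fst P \<in> A \<longleftrightarrow> fst Q \<in> A"]) auto
  have op: "openin (surface X) (pr ` (B \<times> unit_square))" if B: "B = A \<or> B = S - A" for B
  proof (rule openin_surfaceI)
    show "B \<times> unit_square \<subseteq> T" using B A by auto
    show "Q \<in> B \<times> unit_square" if "P \<in> B \<times> unit_square" "glued P Q" for P Q
    proof -
      have "P \<in> T" using that(1) B A(1) by auto
      then have "Q \<in> T" by (rule glued_T[OF that(2)])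
      then show ?thesis using that(1) B inv[OF that(2)] by (cases P; cases Q) auto
    qed
    show "openin (top_of_set unit_square) {z. (s, z) \<in> B \<times> unit_square}" for s
      by (cases "s \<in> B") auto
  qed
  have conn: "connected_space (surface X)" using origami by (simp add: origami_def)
  have cover: "topspace (surface X) \<subseteq> pr ` (A \<times> unit_square) \<union> pr ` ((S - A) \<times> unit_square)"
  proof
    fix Q assume "Q \<in> topspace (surface X)"
    then have "Q \<in> surface_points X" by (simp add: topspace_surface)
    then obtain P where P: "P \<in> T" "Q = pr P" using points_pr by blast
    then show "Q \<in> pr ` (A \<times> unit_square) \<union> pr ` ((S - A) \<times> unit_square)" by (cases P) auto
  qed
  have disj: "pr ` (A \<times> unit_square) \<inter> pr ` ((S - A) \<times> unit_square) = {}"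
  proof (rule equals0I)
    fix Q assume "Q \<in> pr ` (A \<times> unit_square) \<inter> pr ` ((S - A) \<times> unit_square)"
    then obtain P P' where "P \<in> A \<times> unit_square" "P' \<in> (S - A) \<times> unit_square" "pr P = pr P'" by auto
    then show False using inv[of P P'] pr_eq_iff[of P P'] A by auto
  qed
  have "unit_square \<noteq> {}" by (auto simp: unit_square_def)
  then have ne: "pr ` (A \<times> unit_square) \<noteq> {}" "pr ` ((S - A) \<times> unit_square) \<noteq> {}"
    using A \<open>A \<noteq> S\<close> by auto
  show False using conn[unfolded connected_space_def] op[of A] op[of "S - A"] cover disj ne by metis
qed

end

section \<open>Deck transformations and vertices\<close>

context origami_surface
begin

abbreviation "D \<equiv> deck_group X"

definition square_map :: "(('a \<times> real \<times> real) set \<Rightarrow> ('a \<times> real \<times> real) set) \<Rightarrow> 'a \<Rightarrow> 'a" where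
  "square_map f s = (SOME t. t \<in> S \<and> (\<forall>z\<in>unit_square. f (pr (s, z)) = pr (t, z)))"

lemma square_map:
  assumes "f \<in> carrier D" "s \<in> S"
  shows "square_map f s \<in> S" "z \<in> unit_square \<Longrightarrow> f (pr (s, z)) = pr (square_map f s, z)"
proof -
  have "square_map f s \<in> S \<and> (\<forall>z\<in>unit_square. f (pr (s, z)) = pr (square_map f s, z))"
    unfolding square_map_def by (rule someI_ex) (use deck_square[OF assms] in blast)
  then show "square_map f s \<in> S" "z \<in> unit_square \<Longrightarrow> f (pr (s, z)) = pr (square_map f s, z)" by auto
qed

lemma centre: "(1/2, 1/2) \<in> open_square" "(1/2, 1/2) \<in> unit_square"
  by (auto simp: open_square_def unit_square_def)

lemma square_map_unique:
  assumes "f \<in> carrier D" "s \<in> S" "P \<in> T" "f (pr (s, (1/2, 1/2))) = pr P"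
  shows "fst P = square_map f s"
proof -
  have "pr P = pr (square_map f s, (1/2, 1/2))" using assms square_map centre by metis
  then have "P = (square_map f s, (1/2, 1/2))"
    using assms square_map(1) centre(1) by (intro pr_open_square)
  then show ?thesis by simp
qed

text \<open>Evaluation at the midpoint of the common edge: it is no corner, so its class determines
  the square of the normal form.\<close>

lemma square_map_right: assumes "f \<in> carrier D" "s \<in> S" shows "square_map f (R s) = R (square_map f s)"
proof -
  let ?t = "square_map f s" let ?r = "square_map f (R s)"
  have st: "?t \<in> S" "?r \<in> S" using square_map(1) assms R_S by auto
  have u: "(1, 1/2) \<in> unit_square" "(0, 1/2) \<in> unit_square" by (auto simp: unit_square_def)
  have eq: "pr (t, (1, 1/2)) = pr (R t, (0, 1/2))" if "t \<in> S" for t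
    using that u R_S glued_edge[OF edge_glued.vertical[OF that, of "1/2"]] by (subst pr_eq_iff) auto
  have "pr (?r, (0, 1/2)) = f (pr (s, (1, 1/2)))"
    using square_map(2)[OF assms(1) R_S[OF assms(2)] u(2)] eq[OF assms(2)] by simp
  also have "\<dots> = pr (R ?t, (0, 1/2))" using square_map(2)[OF assms u(1)] eq[OF st(1)] by simp
  finally have "glued (?r, (0, 1/2)) (R ?t, (0, 1/2))" using st u R_S by (subst (asm) pr_eq_iff) auto
  from glued_nform_eq[OF this] show ?thesis by (simp add: corner_def nform_def wrap_def)
qed

lemma square_map_upper: assumes "f \<in> carrier D" "s \<in> S" shows "square_map f (U s) = U (square_map f s)"
proof -
  let ?t = "square_map f s" let ?r = "square_map f (U s)"
  have st: "?t \<in> S" "?r \<in> S" using square_map(1) assms U_S by auto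
  have u: "(1/2, 1) \<in> unit_square" "(1/2, 0) \<in> unit_square" by (auto simp: unit_square_def)
  have eq: "pr (t, (1/2, 1)) = pr (U t, (1/2, 0))" if "t \<in> S" for t
    using that u U_S glued_edge[OF edge_glued.horizontal[OF that, of "1/2"]] by (subst pr_eq_iff) auto
  have "pr (?r, (1/2, 0)) = f (pr (s, (1/2, 1)))"
    using square_map(2)[OF assms(1) U_S[OF assms(2)] u(2)] eq[OF assms(2)] by simp
  also have "\<dots> = pr (U ?t, (1/2, 0))" using square_map(2)[OF assms u(1)] eq[OF st(1)] by simp
  finally have "glued (?r, (1/2, 0)) (U ?t, (1/2, 0))" using st u U_S by (subst (asm) pr_eq_iff) auto
  from glued_nform_eq[OF this] show ?thesis by (simp add: corner_def nform_def wrap_def)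
qed

text \<open>The squares on which both maps agree are closed under neighbours, so they are all
  squares. Extensionality settles the arguments off the surface.\<close>

lemma square_map_faithful:
  assumes f: "f \<in> carrier D" and g: "g \<in> carrier D" and s: "s \<in> S" "square_map f s = square_map g s"
  shows "f = g"
proof -
  let ?A = "{s \<in> S. square_map f s = square_map g s}"
  have "?A = S" using s f g by (intro connected_squares) (auto simp: square_map_right square_map_upper R_S U_S)
  then have eq: "square_map f s = square_map g s" if "s \<in> S" for s using that by blast
  have "f Q = g Q" if Q: "Q \<in> surface_points X" for Q
  proof -
    obtain P where "P \<in> T" "Q = pr P" using points_pr[OF Q] by blast
    then show ?thesis using square_map(2)[OF f] square_map(2)[OF g] eq by (cases P) auto
  qed
  moreover have "f \<in> extensional (surface_points X)" "g \<in> extensional (surface_points X)"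
    using f g by (auto simp: deck_group_def dest: Bij_imp_extensional)
  ultimately show ?thesis by (intro extensionalityI)
qed

lemma square_map_mult:
  assumes fg: "f \<in> carrier D" "g \<in> carrier D" "f \<otimes>\<^bsub>D\<^esub> g \<in> carrier D" and s: "s \<in> S"
  shows "square_map (f \<otimes>\<^bsub>D\<^esub> g) s = square_map f (square_map g s)"
proof -
  have B: "f \<in> Bij (surface_points X)" "g \<in> Bij (surface_points X)" using fg by (auto simp: deck_group_def)
  have pt: "pr (s, (1/2, 1/2)) \<in> surface_points X" using s centre by (intro pr_points) auto
  have "(f \<otimes>\<^bsub>D\<^esub> g) (pr (s, (1/2, 1/2))) = f (g (pr (s, (1/2, 1/2))))"
    using B pt by (simp add: deck_group_def BijGroup_def compose_def)
  also have "\<dots> = pr (square_map f (square_map g s), (1/2, 1/2))"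
    using square_map fg s centre by metis
  finally show ?thesis
    using square_map_unique[OF fg(3) s, of "(square_map f (square_map g s), (1/2, 1/2))"]
      square_map(1) fg s centre by auto
qed

text \<open>The image of a base square under \<open>f\<close> gets the label \<open>f\<close>. Deck
  transformations commute with \<open>R\<close> and \<open>U\<close> and multiply labels on the
  left, so passing to a neighbour is a multiplication on the right. \<open>u\<close> and
  \<open>v\<close> generate, because the squares labelled by the subgroup they generate are closed
  under neighbours.\<close>

lemma normal_labelling:
  assumes norm: "normal_origami X" and grp: "group D"
  shows "\<exists>u v \<phi>. u \<in> carrier D \<and> v \<in> carrier D \<and> bij_betw \<phi> (carrier D) S \<and>
    (\<forall>f\<in>carrier D. R (\<phi> f) = \<phi> (f \<otimes>\<^bsub>D\<^esub> u) \<and> U (\<phi> f) = \<phi> (f \<otimes>\<^bsub>D\<^esub> v)) \<and> generate D {u, v} = carrier D"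
proof -
  interpret D: group D by (rule grp)
  obtain s0 where s0: "s0 \<in> S" using S_ne by auto
  define \<phi> where "\<phi> f = square_map f s0" for f
  have trans: "\<exists>f\<in>carrier D. square_map f s0 = t" if t: "t \<in> S" for t
  proof -
    obtain f where f: "f \<in> carrier D" "f ` square_in_surface X s0 = square_in_surface X t"
      using norm s0 t unfolding normal_origami_def by blast
    have "pr (s0, (1/2, 1/2)) \<in> square_in_surface X s0" using centre by (auto simp: square_in_surface_def)
    then have "f (pr (s0, (1/2, 1/2))) \<in> square_in_surface X t" using f(2) by blast
    then obtain z where "z \<in> unit_square" "f (pr (s0, (1/2, 1/2))) = pr (t, z)"
      by (auto simp: square_in_surface_def)
    then show ?thesis using square_map_unique[OF f(1) s0, of "(t, z)"] t f(1) by auto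
  qed
  have "inj_on \<phi> (carrier D)"
    unfolding \<phi>_def by (rule inj_onI) (rule square_map_faithful[OF _ _ s0])
  moreover have "\<phi> ` carrier D = S"
  proof (intro equalityI subsetI)
    fix t assume "t \<in> S"
    then show "t \<in> \<phi> ` carrier D" using trans unfolding \<phi>_def by blast
  qed (use square_map(1)[OF _ s0] in \<open>auto simp: \<phi>_def\<close>)
  ultimately have bij: "bij_betw \<phi> (carrier D) S" by (simp add: bij_betw_def)
  obtain u where u: "u \<in> carrier D" "square_map u s0 = R s0" using trans R_S s0 by blast
  obtain v where v: "v \<in> carrier D" "square_map v s0 = U s0" using trans U_S s0 by blast
  have ru: "R (\<phi> f) = \<phi> (f \<otimes>\<^bsub>D\<^esub> u)" "U (\<phi> f) = \<phi> (f \<otimes>\<^bsub>D\<^esub> v)" if "f \<in> carrier D" for f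
    using that u v s0 by (simp_all add: \<phi>_def square_map_mult square_map_right[symmetric] square_map_upper[symmetric])
  let ?A = "generate D {u, v}"
  have A: "subgroup ?A D" using u v by (intro D.generate_is_subgroup) auto
  have AD: "?A \<subseteq> carrier D" using A by (rule subgroup.subset)
  have uvA: "u \<in> ?A" "v \<in> ?A" by (auto intro: generate.incl)
  have "\<phi> ` ?A = S"
  proof (rule connected_squares)
    show "\<phi> ` ?A \<subseteq> S" using bij AD by (auto simp: bij_betw_def)
    show "\<phi> ` ?A \<noteq> {}" using uvA by auto
    show "R s \<in> \<phi> ` ?A" if "s \<in> \<phi> ` ?A" for s
      using that ru(1) AD subgroup.m_closed[OF A _ uvA(1)] by auto
    show "U s \<in> \<phi> ` ?A" if "s \<in> \<phi> ` ?A" for s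
      using that ru(2) AD subgroup.m_closed[OF A _ uvA(2)] by auto
  qed
  then have "\<phi> ` ?A = \<phi> ` carrier D" using bij by (simp add: bij_betw_def)
  then have "?A = carrier D"
    using inj_on_image_eq_iff[of \<phi> "carrier D" ?A "carrier D"] bij AD by (simp add: bij_betw_def)
  then show ?thesis using u v bij ru by blast
qed

end

section \<open>Vertices and cone angles of a labelled origami\<close>

locale labelled_origami = origami_surface X + D: group D
  for X :: "'a origami" and D :: "('d, 'm) monoid_scheme" (structure) +
  fixes u v :: 'd and \<phi> :: "'d \<Rightarrow> 'a"
  assumes u: "u \<in> carrier D" and v: "v \<in> carrier D" and bij: "bij_betw \<phi> (carrier D) (squares X)"
    and right: "f \<in> carrier D \<Longrightarrow> right X (\<phi> f) = \<phi> (f \<otimes> u)"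
    and upper: "f \<in> carrier D \<Longrightarrow> upper X (\<phi> f) = \<phi> (f \<otimes> v)"
begin

definition lab :: "'a \<Rightarrow> 'd" where "lab = inv_into (carrier D) \<phi>"

lemma \<phi>_S: "f \<in> carrier D \<Longrightarrow> \<phi> f \<in> S" using bij by (auto simp: bij_betw_def)
lemma lab_carrier: "s \<in> S \<Longrightarrow> lab s \<in> carrier D"
  using bij unfolding lab_def by (metis bij_betw_def inv_into_into)
lemma \<phi>_lab: "s \<in> S \<Longrightarrow> \<phi> (lab s) = s" using bij unfolding lab_def by (metis bij_betw_inv_into_right)
lemma lab_\<phi>: "f \<in> carrier D \<Longrightarrow> lab (\<phi> f) = f" using bij unfolding lab_def by (metis bij_betw_inv_into_left)
lemma lab_right: "s \<in> S \<Longrightarrow> lab (R s) = lab s \<otimes> u"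
  using right[OF lab_carrier] \<phi>_lab lab_\<phi> lab_carrier u by (metis D.m_closed)
lemma lab_upper: "s \<in> S \<Longrightarrow> lab (U s) = lab s \<otimes> v"
  using upper[OF lab_carrier] \<phi>_lab lab_\<phi> lab_carrier v by (metis D.m_closed)

lemma finite_D: "finite (carrier D)" using bij finite_S bij_betw_finite by blast

text \<open>The change of label along one full turn around the lower left corner of a square: left,
  down, right, up.\<close>

definition c :: 'd where "c = inv u \<otimes> inv v \<otimes> u \<otimes> v"

lemma c_carrier: "c \<in> carrier D" using u v by (simp add: c_def)

abbreviation "Z \<equiv> generate D {c}"

lemma Z_subgroup: "subgroup Z D" using c_carrier by (intro D.generate_is_subgroup) auto

lemma Z_pow: assumes "z \<in> Z" shows "\<exists>k::nat. z = c [^] k"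
proof -
  have "D.ord c \<noteq> 0" using D.ord_ge_1[OF finite_D c_carrier] by simp
  then show ?thesis using D.generate_pow_nat[OF c_carrier] assms by auto
qed

lemma card_Z: "card Z = D.ord c" using D.generate_pow_card[OF c_carrier] by simp

text \<open>For a corner this is the label of a square that has it as its lower left corner.\<close>

definition key :: "'a \<times> real \<times> real \<Rightarrow> 'd" where "key P = lab (fst (nform X P))"

lemma key_carrier: "P \<in> T \<Longrightarrow> key P \<in> carrier D"
  using nform_T[of P] lab_carrier by (auto simp: key_def)

lemma nform_corner: "P \<in> T \<Longrightarrow> corner P \<Longrightarrow> nform X P = (\<phi> (key P), 0, 0)"
  using nform_T[of P] by (cases P) (auto simp: key_def \<phi>_lab corner_def nform_def wrap_def Let_def)

text \<open>The key can change only between (s, 1, 1) and (U s, 1, 0): one normal form is reached by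
  going right and then up, the other by going up and then right, and the labels differ by the factor
  inv c.\<close>

lemma edge_key:
  assumes "edge_glued X A B" "corner A" shows "inv (key A) \<otimes> key B \<in> Z"
proof -
  have kA: "key A \<in> carrier D" using key_carrier edge_glued_T[OF assms(1)] by blast
  have triv: ?thesis if "key B = key A"
    using that kA subgroup.one_closed[OF Z_subgroup] by simp
  from assms(1) show ?thesis
  proof cases
    case (vertical s b)
    have "key B = key A" unfolding key_def vertical(1,2) by (simp add: nform_def Let_def)
    then show ?thesis by (rule triv)
  next
    case (horizontal s a)
    show ?thesis
    proof (cases "a = 1")
      case True
      have l: "lab s \<in> carrier D" using horizontal(3) by (rule lab_carrier)
      have A: "key A = lab s \<otimes> u \<otimes> v" and B: "key B = lab s \<otimes> v \<otimes> u"
        unfolding key_def horizontal(1,2) using True horizontal(3)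
        by (simp_all add: nform_def Let_def lab_right lab_upper R_S U_S)
      have "inv (key A) \<otimes> key B = inv v \<otimes> (inv u \<otimes> ((inv (lab s) \<otimes> lab s) \<otimes> (v \<otimes> u)))"
        unfolding A B using l u v by (simp only: D.inv_mult_group D.m_assoc D.m_closed D.inv_closed)
      also have "\<dots> = inv c" using l u v by (simp add: c_def D.inv_mult_group D.m_assoc)
      finally show ?thesis
        using subgroup.m_inv_closed[OF Z_subgroup, of c] generate.incl[of c "{c}" D] by simp
    next
      case False
      have "key B = key A" unfolding key_def horizontal(1,2) using False by (simp add: nform_def Let_def)
      then show ?thesis by (rule triv)
    qed
  qed
qed

lemma glued_key:
  assumes "glued P Q" "P \<in> T" "corner P" shows "inv (key P) \<otimes> key Q \<in> Z"
proof -
  let ?I = "\<lambda>Q. Q \<in> T \<and> corner Q \<and> inv (key P) \<otimes> key Q \<in> Z"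
  have kP: "key P \<in> carrier D" using assms(2) by (rule key_carrier)
  have "?I Q"
  proof (rule glued_induct[OF assms(1), where I = ?I])
    show "?I P" using assms kP subgroup.one_closed[OF Z_subgroup] by simp
    fix A B assume E: "edge_glued X A B"
    have T: "A \<in> T" "B \<in> T" using edge_glued_T[OF E] by auto
    have k: "key A \<in> carrier D" "key B \<in> carrier D" using T key_carrier by auto
    have cc: "corner A \<longleftrightarrow> corner B" using E by (rule edge_glued_nform)
    have "inv (key P) \<otimes> key B \<in> Z \<longleftrightarrow> inv (key P) \<otimes> key A \<in> Z" if "corner A"
    proof -
      have e: "inv (key A) \<otimes> key B \<in> Z" using edge_key[OF E that] .
      have 1: "inv (key P) \<otimes> key B = (inv (key P) \<otimes> key A) \<otimes> (inv (key A) \<otimes> key B)"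
        using kP k by (simp add: D.m_assoc D.inv_solve_left' flip: D.m_assoc[of "key A"])
      have 2: "inv (key P) \<otimes> key A = (inv (key P) \<otimes> key B) \<otimes> inv (inv (key A) \<otimes> key B)"
        using kP k by (simp add: D.inv_mult_group D.m_assoc flip: D.m_assoc[of "key B"])
      show ?thesis
        using subgroup.m_closed[OF Z_subgroup _ e] subgroup.m_closed[OF Z_subgroup _ subgroup.m_inv_closed[OF Z_subgroup e]]
          1 2 by metis
    qed
    then show "?I A \<longleftrightarrow> ?I B" using T cc by blast
  qed
  then show ?thesis by simp
qed

lemma corner_points: "g \<in> carrier D \<Longrightarrow> (\<phi> g, 0, 0) \<in> T" by (auto simp: \<phi>_S unit_square_def)

lemma glued_corner_step: assumes g: "g \<in> carrier D" shows "glued (\<phi> g, 0, 0) (\<phi> (g \<otimes> c), 0, 0)"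
proof -
  \<comment> \<open>The square diagonally below to the left: leaving it right and then up leads to g
    c, up and then right to g.\<close>
  let ?f = "g \<otimes> inv u \<otimes> inv v" let ?s = "\<phi> ?f"
  have f: "?f \<in> carrier D" using g u v by simp
  have s: "?s \<in> S" using f by (rule \<phi>_S)
  have eq: "?f \<otimes> u \<otimes> v = g \<otimes> c" "?f \<otimes> v \<otimes> u = g" using g u v by (simp_all add: c_def D.m_assoc)
  have T: "(?s, 1, 1) \<in> T" "(U ?s, 1, 0) \<in> T" using s U_S by (auto simp: unit_square_def)
  have n1: "nform X (?s, 1, 1) = (\<phi> (g \<otimes> c), 0, 0)"
    using f u by (simp add: nform_def wrap_def right upper eq)
  have n2: "nform X (U ?s, 1, 0) = (\<phi> g, 0, 0)"
    using f v by (simp add: nform_def wrap_def right upper eq)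
  have "glued (\<phi> g, 0, 0) (U ?s, 1, 0)" using glued_nform[OF T(2)] n2 by (simp add: equivclp_sym)
  moreover have "glued (U ?s, 1, 0) (?s, 1, 1)"
    using glued_edge[OF edge_glued.horizontal[OF s, of 1]] by (simp add: equivclp_sym)
  moreover have "glued (?s, 1, 1) (\<phi> (g \<otimes> c), 0, 0)" using glued_nform[OF T(1)] n1 by simp
  ultimately show ?thesis by (meson equivclp_trans)
qed

lemma glued_corner_Z: assumes "g \<in> carrier D" "z \<in> Z" shows "glued (\<phi> g, 0, 0) (\<phi> (g \<otimes> z), 0, 0)"
proof -
  obtain k :: nat where z: "z = c [^] k" using Z_pow assms by blast
  have "glued (\<phi> g, 0, 0) (\<phi> (g \<otimes> c [^] k), 0, 0)"
  proof (induction k)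
    case (Suc k)
    have "glued (\<phi> (g \<otimes> c [^] k), 0, 0) (\<phi> (g \<otimes> c [^] k \<otimes> c), 0, 0)"
      using assms c_carrier by (intro glued_corner_step) auto
    with Suc show ?case using assms c_carrier by (simp add: D.m_assoc) (meson equivclp_trans)
  qed (use assms in simp)
  then show ?thesis using z by simp
qed

text \<open>A coordinate 0 of \<open>n\<close> comes from 0 and 1, any other from itself. So the
  fibre is one interior point, two points on edges or four corners, with the same total
  angle.\<close>

lemma fibre_angle:
  assumes n: "n \<in> T" "nform X n = n"
  shows "finite {P \<in> T. nform X P = n} \<and> (\<Sum>(s, z)\<in>{P \<in> T. nform X P = n}. square_angle z) = 2 * pi"
proof -
  obtain t a0 b0 where n': "n = (t, a0, b0)" by (cases n)
  have t: "t \<in> S" and ab: "0 \<le> a0" "a0 \<le> 1" "0 \<le> b0" "b0 \<le> 1" using n n' by (auto simp: unit_square_def)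
  have ab1: "a0 \<noteq> 1" "b0 \<noteq> 1" using n(2) n' by (auto simp: nform_def Let_def wrap_def split: if_splits)
  define A where "A = (if a0 = 0 then {0, 1} else {a0})"
  define B where "B = (if b0 = 0 then {0, 1} else {b0})"
  let ?F = "{P \<in> T. nform X P = n}"
  have wA: "a \<in> A \<longleftrightarrow> wrap a = a0" if "a \<in> {0..1}" for a using ab1 by (auto simp: A_def wrap_def)
  have wB: "b \<in> B \<longleftrightarrow> wrap b = b0" if "b \<in> {0..1}" for b using ab1 by (auto simp: B_def wrap_def)
  have AB: "A \<subseteq> {0..1}" "B \<subseteq> {0..1}" using ab by (auto simp: A_def B_def)
  have injR: "R s = R s' \<Longrightarrow> s \<in> S \<Longrightarrow> s' \<in> S \<Longrightarrow> s = s'" and injU: "U s = U s' \<Longrightarrow> s \<in> S \<Longrightarrow> s' \<in> S \<Longrightarrow> s = s'" for s s'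
    using R_bij U_bij by (auto simp: bij_betw_def inj_on_def)
  have bijF: "bij_betw snd ?F (A \<times> B)"
    unfolding bij_betw_def
  proof
    show "inj_on snd ?F"
    proof (rule inj_onI)
      fix P Q assume PQ: "P \<in> ?F" "Q \<in> ?F" "snd P = snd Q"
      obtain s s' a b where eq: "P = (s, a, b)" "Q = (s', a, b)" using PQ(3) by (cases P; cases Q) auto
      have S: "s \<in> S" "s' \<in> S" using PQ eq by auto
      have "fst (nform X P) = fst (nform X Q)" using PQ by simp
      then have "(if a = 1 then R s else s) = (if a = 1 then R s' else s')"
        using injU[of "if a = 1 then R s else s" "if a = 1 then R s' else s'"] S R_S
        by (cases "b = 1") (simp_all add: eq nform_def Let_def)
      then have "s = s'" using injR[OF _ S] by (cases "a = 1") simp_all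
      then show "P = Q" using eq by simp
    qed
    show "snd ` ?F = A \<times> B"
    proof (intro equalityI subsetI)
      fix z assume "z \<in> snd ` ?F"
      then obtain s where s: "(s, z) \<in> T" "nform X (s, z) = n" by auto
      then have "(wrap (fst z), wrap (snd z)) = (a0, b0)" using n' snd_nform[of X s "fst z" "snd z"] by simp
      then show "z \<in> A \<times> B" using s wA[of "fst z"] wB[of "snd z"] by (cases z) (auto simp: unit_square_def)
    next
      fix z assume z: "z \<in> A \<times> B"
      obtain a b where ab': "z = (a, b)" "a \<in> A" "b \<in> B" using z by auto
      have sur: "\<exists>s\<in>S. R s = r" "\<exists>s\<in>S. U s = r" if "r \<in> S" for r
        using that R_bij U_bij unfolding bij_betw_def by (metis imageE)+
      obtain r where r: "r \<in> S" "(if b = 1 then U r else r) = t" using sur(2)[OF t] t by (cases "b = 1") auto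
      obtain s where s: "s \<in> S" "(if a = 1 then R s else s) = r" using sur(1)[OF r(1)] r by (cases "a = 1") auto
      have w: "wrap a = a0" "wrap b = b0" using ab' wA wB AB by auto
      have "nform X (s, a, b) = n" unfolding nform_def n' Let_def prod.case s(2) r(2) w ..
      moreover have "(s, a, b) \<in> T" using s ab' AB by (auto simp: unit_square_def)
      ultimately show "z \<in> snd ` ?F" using ab'(1) by force
    qed
  qed
  have "finite (A \<times> B)" by (simp add: A_def B_def)
  then have fin: "finite ?F" using bij_betw_finite[OF bijF] by simp
  have "(\<Sum>(s, z)\<in>?F. square_angle z) = (\<Sum>P\<in>?F. square_angle (snd P))" by (simp add: case_prod_beta)
  also have "\<dots> = (\<Sum>z\<in>A \<times> B. square_angle z)" by (rule sum.reindex_bij_betw[OF bijF])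
  also have "\<dots> = (\<Sum>a\<in>A. \<Sum>b\<in>B. square_angle (a, b))" by (simp add: sum.cartesian_product)
  also have "\<dots> = 2 * pi" using ab1 by (simp add: A_def B_def square_angle_def)
  finally show ?thesis using fin by simp
qed

lemma nform_nform: "nform X (nform X P) = nform X P"
  by (cases P) (auto simp: nform_def Let_def wrap_def)

text \<open>The class is the disjoint union of the fibres of \<open>nform\<close> over the normal
  forms it contains.\<close>

lemma cone_angle_pr:
  assumes P: "P \<in> T" shows "cone_angle (pr P) = 2 * pi * card (nform X ` pr P)"
proof -
  let ?N = "nform X ` pr P"
  have QT: "pr P \<subseteq> T" using pr_iff[OF P] glued_T P by blast
  have N_sub: "?N \<subseteq> S \<times> {snd (nform X P)}"
  proof
    fix n assume "n \<in> ?N"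
    then obtain Q where Q: "Q \<in> pr P" "n = nform X Q" by auto
    then have "snd n = snd (nform X P)" using pr_iff[OF P] glued_snd_nform by metis
    moreover have "fst n \<in> S" using nform_T[of Q] Q QT by (auto simp: mem_Times_iff)
    ultimately show "n \<in> S \<times> {snd (nform X P)}" by (simp add: mem_Times_iff)
  qed
  then have finN: "finite ?N" using finite_S by (meson finite.emptyI finite_SigmaI finite_insert finite_subset)
  have "pr P = (\<Union>n\<in>?N. {Q \<in> T. nform X Q = n})"
  proof (intro equalityI subsetI)
    fix Q assume "Q \<in> pr P" then show "Q \<in> (\<Union>n\<in>?N. {Q \<in> T. nform X Q = n})" using QT by auto
  next
    fix Q assume "Q \<in> (\<Union>n\<in>?N. {Q \<in> T. nform X Q = n})"
    then obtain Q' where Q: "Q \<in> T" "Q' \<in> pr P" "nform X Q = nform X Q'" by auto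
    have "Q' \<in> T" using Q QT by auto
    then have "glued Q' Q" using glued_nform[of Q'] glued_nform[OF Q(1)] Q(3)
      by (metis equivclp_sym equivclp_trans)
    then show "Q \<in> pr P" using Q(2) pr_iff[OF P] by (meson equivclp_trans)
  qed
  then have "cone_angle (pr P) = (\<Sum>(s, z)\<in>(\<Union>n\<in>?N. {Q \<in> T. nform X Q = n}). square_angle z)"
    by (simp only: cone_angle_def)
  also have "\<dots> = (\<Sum>n\<in>?N. \<Sum>(s, z)\<in>{Q \<in> T. nform X Q = n}. square_angle z)"
  proof (rule sum.UNION_disjoint[OF finN])
    show "\<forall>n\<in>?N. finite {Q \<in> T. nform X Q = n}"
      using fibre_angle nform_nform nform_T QT by blast
  qed auto
  also have "\<dots> = (\<Sum>n\<in>?N. 2 * pi)"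
  proof (rule sum.cong[OF refl])
    fix n assume "n \<in> ?N"
    then have "n \<in> T" "nform X n = n" using nform_nform nform_T QT by auto
    then show "(\<Sum>(s, z)\<in>{Q \<in> T. nform X Q = n}. square_angle z) = 2 * pi" using fibre_angle by blast
  qed
  finally show ?thesis by simp
qed

lemma cone_angle_noncorner:
  assumes "P \<in> T" "\<not> corner P" shows "card (nform X ` pr P) = 1"
proof -
  have "nform X ` pr P = {nform X P}"
  proof (intro equalityI subsetI)
    fix n assume "n \<in> nform X ` pr P"
    then obtain Q where "glued P Q" "n = nform X Q" using pr_iff[OF assms(1)] by blast
    then show "n \<in> {nform X P}" using glued_nform_eq[OF _ assms(2)] by simp
  next
    fix n assume "n \<in> {nform X P}"
    moreover have "P \<in> pr P" using pr_iff[OF assms(1)] by simp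
    ultimately show "n \<in> nform X ` pr P" by simp
  qed
  then show ?thesis by simp
qed

text \<open>The normal forms in the class are the lower left corners of the squares with labels in
  the left coset of \<open>Z\<close> through the key of \<open>P\<close>.\<close>

lemma cone_angle_corner:
  assumes P: "P \<in> T" "corner P" shows "card (nform X ` pr P) = D.ord c"
proof -
  have k: "key P \<in> carrier D" using P key_carrier by simp
  have Zc: "z \<in> carrier D" if "z \<in> Z" for z using that Z_subgroup subgroup.mem_carrier by metis
  have g0: "glued P (\<phi> (key P), 0, 0)" using glued_nform[OF P(1)] nform_corner[OF P] by simp
  have "nform X ` pr P = (\<lambda>z. (\<phi> (key P \<otimes> z), 0, 0)) ` Z"
  proof (intro equalityI subsetI)
    fix n assume "n \<in> nform X ` pr P"
    then obtain Q where Q: "glued P Q" "n = nform X Q" using pr_iff[OF P(1)] by auto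
    have QT: "Q \<in> T" "corner Q" using glued_T[OF Q(1) P(1)] glued_corner[OF Q(1)] P(2) by auto
    have "inv (key P) \<otimes> key Q \<in> Z" using glued_key[OF Q(1) P] .
    moreover have "key P \<otimes> (inv (key P) \<otimes> key Q) = key Q" using k key_carrier[OF QT(1)]
      by (simp flip: D.m_assoc)
    ultimately show "n \<in> (\<lambda>z. (\<phi> (key P \<otimes> z), 0, 0)) ` Z"
      using Q(2) nform_corner[OF QT] by (metis (no_types, lifting) image_eqI)
  next
    fix n assume "n \<in> (\<lambda>z. (\<phi> (key P \<otimes> z), 0::real, 0::real)) ` Z"
    then obtain z where z: "z \<in> Z" "n = (\<phi> (key P \<otimes> z), 0, 0)" by auto
    have "glued P n" using equivclp_trans[OF g0 glued_corner_Z[OF k z(1)]] z by simp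
    moreover have "nform X n = n" using z by (simp add: nform_def wrap_def)
    ultimately show "n \<in> nform X ` pr P" using pr_iff[OF P(1)] by (metis image_eqI)
  qed
  moreover have "inj_on (\<lambda>z. (\<phi> (key P \<otimes> z), 0::real, 0::real)) Z"
  proof (rule inj_onI)
    fix z z' assume zz: "z \<in> Z" "z' \<in> Z" "(\<phi> (key P \<otimes> z), 0::real, 0::real) = (\<phi> (key P \<otimes> z'), 0, 0)"
    have "key P \<otimes> z = key P \<otimes> z'" using zz lab_\<phi> k Zc by (metis D.m_closed prod.inject)
    then show "z = z'" using k Zc zz by simp
  qed
  ultimately show ?thesis by (simp add: card_image card_Z)
qed

definition vertices :: "('a \<times> real \<times> real) set set" where
  "vertices = (\<lambda>g. pr (\<phi> g, 0, 0)) ` carrier D"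

lemma corner_vertices: assumes "P \<in> T" shows "corner P \<longleftrightarrow> pr P \<in> vertices"
proof
  assume c: "corner P"
  have "pr P = pr (\<phi> (key P), 0, 0)"
    using glued_nform[OF assms] nform_corner[OF assms c] nform_T[OF assms] pr_eq_iff assms by metis
  then show "pr P \<in> vertices" using key_carrier[OF assms] by (auto simp: vertices_def)
next
  assume "pr P \<in> vertices"
  then obtain g where "g \<in> carrier D" "pr P = pr (\<phi> g, 0, 0)" by (auto simp: vertices_def)
  then have "glued P (\<phi> g, 0, 0)" using pr_eq_iff[OF assms corner_points] by blast
  from glued_corner[OF this] show "corner P" by (simp add: corner_def)
qed

lemma card_vertices: "card vertices * D.ord c = card (carrier D)"
proof -
  have fib: "card {g \<in> carrier D. pr (\<phi> g, 0, 0) = Q} = D.ord c" if Q: "Q \<in> vertices" for Q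
  proof -
    obtain h where h: "h \<in> carrier D" "Q = pr (\<phi> h, 0, 0)" using Q by (auto simp: vertices_def)
    have Zc: "z \<in> carrier D" if "z \<in> Z" for z using that Z_subgroup subgroup.mem_carrier by metis
    have kk: "key (\<phi> g, 0, 0) = g" if "g \<in> carrier D" for g
      using that by (simp add: key_def nform_def lab_\<phi>)
    have "{g \<in> carrier D. pr (\<phi> g, 0, 0) = Q} = (\<lambda>z. h \<otimes> z) ` Z"
    proof (intro equalityI subsetI)
      fix g assume g: "g \<in> {g \<in> carrier D. pr (\<phi> g, 0, 0) = Q}"
      then have gc: "g \<in> carrier D" by simp
      then have "glued (\<phi> h, 0, 0) (\<phi> g, 0, 0)"
        using g h pr_eq_iff[OF corner_points[OF h(1)] corner_points[OF gc]] by simp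
      then have "inv (key (\<phi> h, 0, 0)) \<otimes> key (\<phi> g, 0, 0) \<in> Z"
        by (rule glued_key[OF _ corner_points[OF h(1)]]) (simp add: corner_def)
      then have "inv h \<otimes> g \<in> Z" using kk h gc by simp
      moreover have "h \<otimes> (inv h \<otimes> g) = g" using h gc by (simp flip: D.m_assoc)
      ultimately show "g \<in> (\<lambda>z. h \<otimes> z) ` Z" by (metis image_eqI)
    next
      fix g assume "g \<in> (\<lambda>z. h \<otimes> z) ` Z"
      then obtain z where z: "z \<in> Z" "g = h \<otimes> z" by auto
      have gc: "g \<in> carrier D" using z h Zc by simp
      have "glued (\<phi> h, 0, 0) (\<phi> g, 0, 0)" using glued_corner_Z[OF h(1) z(1)] z by simp
      then show "g \<in> {g \<in> carrier D. pr (\<phi> g, 0, 0) = Q}"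
        using gc h pr_eq_iff[OF corner_points[OF h(1)] corner_points[OF gc]] by simp
    qed
    moreover have "inj_on (\<lambda>z. h \<otimes> z) Z" using h Zc by (auto intro!: inj_onI)
    ultimately show ?thesis by (simp add: card_image card_Z)
  qed
  have "card (carrier D) = (\<Sum>g\<in>carrier D. 1)" by simp
  also have "\<dots> = (\<Sum>Q\<in>vertices. \<Sum>g\<in>{g \<in> carrier D. pr (\<phi> g, 0, 0) = Q}. 1)"
    unfolding vertices_def by (rule sum.image_gen[OF finite_D])
  also have "\<dots> = (\<Sum>Q\<in>vertices. D.ord c)" using fib by (intro sum.cong) auto
  finally show ?thesis by simp
qed

lemma multiplicity:
  assumes "1 < a"
  shows "points_of_multiplicity X a = (if a = D.ord c then vertices else {})"
proof -
  have eq: "pr P \<in> points_of_multiplicity X a \<longleftrightarrow> a = D.ord c \<and> pr P \<in> vertices" if P: "P \<in> T" for P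
  proof -
    have "pr P \<in> points_of_multiplicity X a \<longleftrightarrow> card (nform X ` pr P) = a"
      using pr_points[OF P] by (simp add: points_of_multiplicity_def cone_angle_pr[OF P])
    then show ?thesis using assms cone_angle_corner[OF P] cone_angle_noncorner[OF P] corner_vertices[OF P]
      by (cases "corner P") auto
  qed
  have "points_of_multiplicity X a \<subseteq> surface_points X" by (auto simp: points_of_multiplicity_def)
  moreover have "vertices \<subseteq> surface_points X" using corner_points pr_points by (auto simp: vertices_def)
  moreover have "Q \<in> points_of_multiplicity X a \<longleftrightarrow> a = D.ord c \<and> Q \<in> vertices" if "Q \<in> surface_points X" for Q
    using points_pr[OF that] eq by blast
  ultimately show ?thesis by (auto split: if_splits)
qed

text \<open>An entry \<open>a\<close> of the symbol stands for multiplicity a + 1, hence the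
  subtraction; for trivial \<open>c\<close> there are no singularities and the list is
  empty.\<close>

lemma labelled_stratum:
  "X \<in> stratum (if D.ord c = 1 then [] else [(card (carrier D) div D.ord c, D.ord c - 1)])"
proof -
  have e: "1 \<le> D.ord c" using D.ord_ge_1[OF finite_D c_carrier] by simp
  show ?thesis
  proof (cases "D.ord c = 1")
    case True
    then have "singularities X = {}" by (auto simp: singularities_def multiplicity)
    then show ?thesis using True origami by (simp add: stratum_def)
  next
    case False
    then have e1: "1 < D.ord c" using e by simp
    have "singularities X = vertices" using e1 by (auto simp: singularities_def multiplicity)
    moreover have "card vertices = card (carrier D) div D.ord c"
      using e by (simp flip: card_vertices)
    ultimately show ?thesis using e1 origami by (simp add: stratum_def multiplicity)
  qed
qed

end

section \<open>Strata\<close>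

lemma (in finite_p_group) commutator_ord_eq:
  assumes "gens x y" "gens x' y'"
    and cases: "regular_p_group p G \<or> maximal_class p G \<or> powerful_p_group p G \<or>
         regular_p_group p (commutator_group G) \<or> powerful_p_group p (commutator_group G) \<or>
         order_closed p (commutator_group G) \<or> order G \<le> p ^ (p + 2) \<or> nilpotency_class G \<le> p"
  shows "ord (cm G x y) = ord (cm G x' y')"
proof -
  have "ord (cm G b b') dvd ord (cm G a a')" if g: "gens a a'" "gens b b'" for a a' b b'
  proof -
    have c: "cm G a a' \<in> carrier G" "cm G b b' \<in> carrier G" using g by auto
    obtain k where k: "ord (cm G a a') = p ^ k" using ord_p_power[OF c(1)] by blast
    then have "cm G a a' [^] (p ^ k) = \<one>" using pow_ord_eq_1[OF c(1)] by simp
    from commutator_order_invariant[OF g this cases] show ?thesis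
      using pow_eq_id[OF c(2)] k by simp
  qed
  then show ?thesis using assms(1,2) by (meson dvd_antisym)
qed

lemma p_origami_stratum:
  fixes G :: "('g, 'm) monoid_scheme" and X :: "'a origami"
  assumes G: "group G" and X: "p_origami p X" and iso: "deck_group X \<cong> G"
  shows "\<exists>x y. group.gens G x y \<and> X \<in> stratum (if group.ord G (cm G x y) = 1 then []
    else [(order G div group.ord G (cm G x y), group.ord G (cm G x y) - 1)])"
proof -
  interpret G: group G by (rule G)
  have norm: "normal_origami X" and grpD: "group (deck_group X)"
    using X by (auto simp: p_origami_def p_group_def)
  interpret origami_surface X using norm by unfold_locales (simp add: normal_origami_def)
  obtain u v \<phi> where lab: "u \<in> carrier (deck_group X)" "v \<in> carrier (deck_group X)"
    "bij_betw \<phi> (carrier (deck_group X)) (squares X)"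
    "\<And>f. f \<in> carrier (deck_group X) \<Longrightarrow>
      right X (\<phi> f) = \<phi> (f \<otimes>\<^bsub>deck_group X\<^esub> u) \<and> upper X (\<phi> f) = \<phi> (f \<otimes>\<^bsub>deck_group X\<^esub> v)"
    and gen: "generate (deck_group X) {u, v} = carrier (deck_group X)"
    using normal_labelling[OF norm grpD] by blast
  interpret L: labelled_origami X "deck_group X" u v \<phi>
    using grpD lab by (simp add: labelled_origami_def labelled_origami_axioms_def origami_surface_axioms)
  obtain \<psi> where \<psi>: "\<psi> \<in> iso (deck_group X) G" using iso by (auto simp: is_iso_def)
  interpret \<psi>: group_hom "deck_group X" G \<psi>
    using \<psi> by unfold_locales (simp add: iso_def)
  have bij\<psi>: "bij_betw \<psi> (carrier (deck_group X)) (carrier G)" using \<psi> by (simp add: iso_def)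
  let ?D = "deck_group X"
  \<comment> \<open>Inverses, because \<open>L.c\<close> is the commutator of inv u and inv v; these
    generate the deck group as well.\<close>
  let ?u = "inv\<^bsub>?D\<^esub> u" let ?v = "inv\<^bsub>?D\<^esub> v" let ?x = "\<psi> ?u" let ?y = "\<psi> ?v"
  have uv: "?u \<in> carrier ?D" "?v \<in> carrier ?D" using lab by auto
  have sg: "subgroup (generate ?D {?u, ?v}) ?D" using uv by (intro L.D.generate_is_subgroup) auto
  have "inv\<^bsub>?D\<^esub> ?u \<in> generate ?D {?u, ?v}" "inv\<^bsub>?D\<^esub> ?v \<in> generate ?D {?u, ?v}"
    by (auto intro: generate.inv)
  then have "generate ?D {u, v} \<subseteq> generate ?D {?u, ?v}"
    using lab sg by (intro L.D.generate_subgroup_incl) auto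
  then have "generate ?D {?u, ?v} = carrier ?D" using gen subgroup.subset[OF sg] by auto
  then have "generate G (\<psi> ` {?u, ?v}) = carrier G"
    using \<psi>.generate_img[of "{?u, ?v}"] uv bij\<psi> by (simp add: bij_betw_def)
  then have gens: "G.gens ?x ?y" using uv by simp
  have cm: "cm G ?x ?y = \<psi> L.c" using lab by (simp add: cm_def L.c_def)
  have one: "\<psi> d = \<one>\<^bsub>G\<^esub> \<longleftrightarrow> d = \<one>\<^bsub>?D\<^esub>" if "d \<in> carrier ?D" for d
    using that bij\<psi> \<psi>.hom_one L.D.one_closed unfolding bij_betw_def by (metis inj_onD)
  have "\<psi> L.c [^]\<^bsub>G\<^esub> n = \<one>\<^bsub>G\<^esub> \<longleftrightarrow> L.c [^]\<^bsub>?D\<^esub> n = \<one>\<^bsub>?D\<^esub>" for n :: nat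
    using one[of "L.c [^]\<^bsub>?D\<^esub> n"] \<psi>.hom_nat_pow[OF L.c_carrier, of n] L.c_carrier by simp
  then have "G.ord (\<psi> L.c) dvd n \<longleftrightarrow> L.D.ord L.c dvd n" for n
    using G.pow_eq_id[of "\<psi> L.c" n] L.D.pow_eq_id[OF L.c_carrier, of n] L.c_carrier by simp
  then have ord: "G.ord (\<psi> L.c) = L.D.ord L.c" by (meson dvd_antisym dvd_refl)
  have card: "order G = card (carrier ?D)" using bij_betw_same_card[OF bij\<psi>] by (simp add: order_def)
  have "X \<in> stratum (if G.ord (cm G ?x ?y) = 1 then []
      else [(order G div G.ord (cm G ?x ?y), G.ord (cm G ?x ?y) - 1)])"
    unfolding cm ord card by (rule L.labelled_stratum)
  then show ?thesis using gens by blast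
qed

theorem theorem2:
  fixes G :: "('g, 'm) monoid_scheme" and p :: nat
    and X :: "'a origami" and Y :: "'b origami"
  assumes "prime p" and "p_group p G" and "two_generated G"
    and "regular_p_group p G \<or>
         maximal_class p G \<or>
         powerful_p_group p G \<or>
         regular_p_group p (commutator_group G) \<or>
         powerful_p_group p (commutator_group G) \<or>
         order_closed p (commutator_group G) \<or>
         order G \<le> p ^ (p + 2) \<or>
         nilpotency_class G \<le> p"
    and "p_origami p X" and "deck_group X \<cong> G"
    and "p_origami p Y" and "deck_group Y \<cong> G"
  shows "\<exists>ks. stratum_symbol ks \<and> X \<in> stratum ks \<and> Y \<in> stratum ks"
proof -
  have grp: "group G" using assms(2) by (simp add: p_group_def)
  interpret G: finite_p_group G p
    using grp assms(1,2) by (simp add: finite_p_group_def finite_p_group_axioms_def)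
  let ?ks = "\<lambda>e. if e = 1 then [] else [(order G div e, e - 1)]"
  obtain x y where xy: "G.gens x y" "X \<in> stratum (?ks (G.ord (cm G x y)))"
    using p_origami_stratum[OF grp assms(5,6)] by blast
  obtain x' y' where xy': "G.gens x' y'" "Y \<in> stratum (?ks (G.ord (cm G x' y')))"
    using p_origami_stratum[OF grp assms(7,8)] by blast
  have eq: "G.ord (cm G x y) = G.ord (cm G x' y')" using G.commutator_ord_eq[OF xy(1) xy'(1) assms(4)] .
  have c: "cm G x y \<in> carrier G" using xy(1) by auto
  \<comment> \<open>The second bound makes the number of singularities in the symbol
    positive.\<close>
  have "1 \<le> G.ord (cm G x y)" "G.ord (cm G x y) \<le> order G"
    using G.ord_ge_1[OF G.fin c] G.ord_le_group_order[OF G.fin c] by auto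
  then have "stratum_symbol (?ks (G.ord (cm G x y)))"
    by (simp add: stratum_symbol_def div_greater_zero_iff)
  then show ?thesis using xy(2) xy'(2) eq by metis
qed

end
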